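(* Let $\phi^\theta$ be a rotation of $\mathbb{R}^2$ (of angle $\theta$), let $p\in(2,\infty)$ and $s>\frac{2}{p}$, and set $\delta:=\min\left(s-\frac{2}{p},\frac{1}{p}\right)>0$. Then for every $\gamma\in(0,\delta)$ there exists a constant $C$ such that for every $\epsilon\in(0,1)$ and every function $F\in \mathrm{BMO}(\mathbb{R}^2)\cap W^{s,p}(\mathbb{R}^2)$, $$\|F\circ\phi^\theta\|_{\mathrm{BMO}(\mathbb{R}^2)}\le C\,\epsilon^{-1}\left(1+\log\epsilon^{-1}\right)\|F\|_{\mathrm{BMO}(\mathbb{R}^2)}+C\,\epsilon^{\frac{\gamma}{2}}\,\|F\|_{W^{s,p}(\mathbb{R}^2)}.$$
   Context: $\mathrm{BMO}(\mathbb{R}^2)$ denotes the biparameter (Chang–Fefferman, product) BMO space, defined as follows. Let $\mathbb{D}=\mathbb{D}^0=\{2^k[j,j+1): j,k\in\mathbb{Z}\}$. For $\delta_0\in\mathbb{R}$ let $\mathbb{D}^{\delta_0}=\{\delta_I+I: I\in\mathbb{D}\}$, where $\delta_I=\delta_0$ if $|I|\le 1$, $\delta_I=\delta_0+\frac13(|I|-1)$ if $|I|=2^k$ with $k>0$ even, and $\delta_I=\delta_0+\frac13(2|I|-1)$ if $|I|=2^k$ with $k>0$ odd. For an interval $I=[a,b)$ the Haar wavelet is $h_I=|I|^{-1/2}\big(\mathbf{1}_{[a,\frac{a+b}{2})}-\mathbf{1}_{[\frac{a+b}{2},b)}\big)$. For $a,b\in\{0,\delta_0\}$ and $F\in L^2_{loc}(\mathbb{R}^2)$,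 $$\|F\|_{\mathrm{BMO}^{a,b}(\mathbb{R}^2)}=\sup_{\Omega}\Big(\frac{1}{|\Omega|}\sum_{\substack{I\in\mathbb{D}^a,\ J\in\mathbb{D}^b\\ I\times J\subset\Omega}}|\langle F,h_I\otimes h_J\rangle|^2\Big)^{1/2},$$ the supremum being over all (nonempty) open sets $\Omega\subset\mathbb{R}^2$ of finite measure. A parameter $\delta_0\in(0,1/2)$ is fixed once and for all such that the product BMO space is the intersection of the four dyadic spaces: $\mathrm{BMO}(\mathbb{R}^2)=\bigcap_{a,b\in\{0,\delta_0\}}\mathrm{BMO}^{a,b}(\mathbb{R}^2)$, with $\|F\|_{\mathrm{BMO}(\mathbb{R}^2)}=\sup_{a,b\in\{0,\delta_0\}}\|F\|_{\mathrm{BMO}^{a,b}(\mathbb{R}^2)}$; this is taken as the definition. (It is a pseudo-norm.) $W^{s,p}(\mathbb{R}^2)$ is the usual $L^p$-based (possibly fractional) Sobolev space of order $s$, e.g. with norm $\|(1-\Delta)^{s/2}F\|_{L^p}$. The rotation $\phi^\theta$ is the linear map with matrix $\begin{bmatrix}\cos\theta&-\sin\theta\\ \sin\theta&\cos\theta\end{bmatrix}$. *)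

theory Defs
  imports "HOL-Analysis.Analysis"
begin

text \<open>The plane is the type \<open>real \<times> real\<close>, whose norm and inner product are the Euclidean ones.
  Functions are complex-valued and Lebesgue measurable.\<close>

section \<open>Dyadic grids and Haar wavelets\<close>

definition dyadic_interval :: "int \<Rightarrow> int \<Rightarrow> real set" where
  "dyadic_interval k j = {2 powi k * of_int j ..< 2 powi k * (of_int j + 1)}"

definition dyadic_grid :: "real set set" where
  "dyadic_grid = {dyadic_interval k j |k j. True}"

text \<open>The translation applied to the dyadic intervals of length \<open>2 powi k\<close>.\<close>

definition grid_shift :: "real \<Rightarrow> int \<Rightarrow> real" where
  "grid_shift \<delta>0 k =
     (if k \<le> 0 then \<delta>0
      else if even k then \<delta>0 + (2 powi k - 1) / 3
      else \<delta>0 + (2 * 2 powi k - 1) / 3)"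

text \<open>\<open>shifted_grid 0\<close> is not \<open>dyadic_grid\<close>: its intervals of length greater than 1 are translated.
  The unshifted grid is therefore always written \<open>dyadic_grid\<close>.\<close>

definition shifted_grid :: "real \<Rightarrow> real set set" where
  "shifted_grid \<delta>0 = {(+) (grid_shift \<delta>0 k) ` dyadic_interval k j |k j. True}"

text \<open>The argument of \<open>haar\<close> is meant to be an interval \<open>{a..<b}\<close> with \<open>a < b\<close>.\<close>

definition haar :: "real set \<Rightarrow> real \<Rightarrow> real" where
  "haar I x =
     (let a = Inf I; b = Sup I in
      (indicator {a ..< (a + b) / 2} x - indicator {(a + b) / 2 ..< b} x) / sqrt (b - a))"

lemma haar_atLeastLessThan:
  assumes "a < b"
  shows "haar {a..<b} x =
    (indicator {a ..< (a + b) / 2} x - indicator {(a + b) / 2 ..< b} x) / sqrt (b - a)"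
  using assms by (simp add: haar_def)

definition haar_coeff :: "(real \<times> real \<Rightarrow> complex) \<Rightarrow> real set \<Rightarrow> real set \<Rightarrow> complex" where
  "haar_coeff F I J = (LINT z|lebesgue. F z * of_real (haar I (fst z) * haar J (snd z)))"

section \<open>Product BMO\<close>

definition L2_loc :: "(real \<times> real \<Rightarrow> complex) set" where
  "L2_loc = {F \<in> borel_measurable lebesgue.
     \<forall>K. compact K \<longrightarrow> set_integrable lebesgue K (\<lambda>z. (cmod (F z))\<^sup>2)}"

definition ennsqrt :: "ennreal \<Rightarrow> ennreal" where
  "ennsqrt x = (if x = \<infinity> then \<infinity> else ennreal (sqrt (enn2real x)))"

definition bmo_grid_norm ::
    "real set set \<Rightarrow> real set set \<Rightarrow> (real \<times> real \<Rightarrow> complex) \<Rightarrow> ennreal" where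
  "bmo_grid_norm A B F =
     (SUP \<Omega>\<in>{\<Omega>. open \<Omega> \<and> \<Omega> \<noteq> {} \<and> emeasure lebesgue \<Omega> < \<infinity>}.
        ennsqrt ((\<Sum>\<^sub>\<infinity>(I, J)\<in>{(I, J). I \<in> A \<and> J \<in> B \<and> I \<times> J \<subseteq> \<Omega>}.
                    ennreal ((cmod (haar_coeff F I J))\<^sup>2))
                 / emeasure lebesgue \<Omega>))"

definition bmo_norm :: "real \<Rightarrow> (real \<times> real \<Rightarrow> complex) \<Rightarrow> ennreal" where
  "bmo_norm \<delta>0 F =
     (SUP (A, B)\<in>{dyadic_grid, shifted_grid \<delta>0} \<times> {dyadic_grid, shifted_grid \<delta>0}.
        bmo_grid_norm A B F)"

definition BMO :: "real \<Rightarrow> (real \<times> real \<Rightarrow> complex) set" where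
  "BMO \<delta>0 = {F \<in> L2_loc. bmo_norm \<delta>0 F < \<infinity>}"

section \<open>Sobolev spaces\<close>

definition Lp_space :: "real \<Rightarrow> (real \<times> real \<Rightarrow> complex) set" where
  "Lp_space p = {f \<in> borel_measurable lebesgue. integrable lebesgue (\<lambda>z. cmod (f z) powr p)}"

definition Lp_norm :: "real \<Rightarrow> (real \<times> real \<Rightarrow> complex) \<Rightarrow> real" where
  "Lp_norm p f = (LINT z|lebesgue. cmod (f z) powr p) powr (1 / p)"

text \<open>\<open>D i j\<close> plays the role of the partial derivative of \<open>\<phi>\<close> of order \<open>i\<close> in the first and
  \<open>j\<close> in the second variable.\<close>

definition schwartz :: "(real \<times> real \<Rightarrow> complex) \<Rightarrow> bool" where
  "schwartz \<phi> \<longleftrightarrow>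
     (\<exists>D :: nat \<Rightarrow> nat \<Rightarrow> real \<times> real \<Rightarrow> complex. D 0 0 = \<phi> \<and>
        (\<forall>i j z. (D i j has_derivative
           (\<lambda>h. fst h *\<^sub>R D (Suc i) j z + snd h *\<^sub>R D i (Suc j) z)) (at z)) \<and>
        (\<forall>i j N. bounded (range (\<lambda>z. (1 + norm z) ^ N *\<^sub>R D i j z))))"

definition fourier :: "(real \<times> real \<Rightarrow> complex) \<Rightarrow> real \<times> real \<Rightarrow> complex" where
  "fourier \<phi> \<xi> = (LINT z|lebesgue. \<phi> z * cis (- (z \<bullet> \<xi>)))"

definition inverse_fourier :: "(real \<times> real \<Rightarrow> complex) \<Rightarrow> real \<times> real \<Rightarrow> complex" where
  "inverse_fourier \<psi> z = (LINT \<xi>|lebesgue. \<psi> \<xi> * cis (z \<bullet> \<xi>)) / of_real ((2 * pi)\<^sup>2)"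

text \<open>\<open>bessel_op s\<close> is the operator \<open>(1 - \<Delta>)\<close> to the power \<open>s/2\<close> on Schwartz functions.\<close>

definition bessel_op :: "real \<Rightarrow> (real \<times> real \<Rightarrow> complex) \<Rightarrow> real \<times> real \<Rightarrow> complex" where
  "bessel_op s \<phi> = inverse_fourier (\<lambda>\<xi>. of_real ((1 + (norm \<xi>)\<^sup>2) powr (s / 2)) * fourier \<phi> \<xi>)"

text \<open>The function \<open>f\<close> represents the tempered distribution obtained by applying \<open>(1 - \<Delta>)\<close> to the
  power \<open>s/2\<close> to \<open>F\<close>. The multiplier is even, so the operator is its own transpose under the
  bilinear pairing.\<close>

definition has_bessel_derivative ::
    "real \<Rightarrow> (real \<times> real \<Rightarrow> complex) \<Rightarrow> (real \<times> real \<Rightarrow> complex) \<Rightarrow> bool" where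
  "has_bessel_derivative s F f \<longleftrightarrow>
     (\<forall>\<phi>. schwartz \<phi> \<longrightarrow>
        (LINT z|lebesgue. f z * \<phi> z) = (LINT z|lebesgue. F z * bessel_op s \<phi> z))"

text \<open>For \<open>s \<ge> 0\<close>, which is the only case used, membership of \<open>F\<close> in \<open>Lp_space p\<close> is automatic
  for a tempered distribution \<open>F\<close>; here it ensures that \<open>F\<close> is one.\<close>

definition Sobolev :: "real \<Rightarrow> real \<Rightarrow> (real \<times> real \<Rightarrow> complex) set" where
  "Sobolev s p = {F \<in> Lp_space p. \<exists>f \<in> Lp_space p. has_bessel_derivative s F f}"

text \<open>The function chosen by \<open>SOME\<close> is unique up to a null set.\<close>

definition Sobolev_norm :: "real \<Rightarrow> real \<Rightarrow> (real \<times> real \<Rightarrow> complex) \<Rightarrow> real" where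
  "Sobolev_norm s p F = Lp_norm p (SOME f. f \<in> Lp_space p \<and> has_bessel_derivative s F f)"

section \<open>Rotations\<close>

definition rotation :: "real \<Rightarrow> real \<times> real \<Rightarrow> real \<times> real" where
  "rotation \<theta> = (\<lambda>(x, y). (cos \<theta> * x - sin \<theta> * y, sin \<theta> * x + cos \<theta> * y))"

end

(* A rotation preserves the sup norm, and Bessel's inequality for the Haar systems bounds the
   product BMO norm of any function by its sup norm. It is therefore enough to bound the sup norm of
   F by the right-hand side. If Q is a dyadic square of side 2^-n, then the average of F over Q
   differs from a combination of its averages over three rectangles with a side of length 2^(2n) by
   (3n)^2 rectangular martingale differences, and each of these is at most a constant times the BMO
   norm, even that of the unshifted grid. Write F as the Bessel potential of order s of a function f
   in L^p. The averages over the large rectangles are bounded by a power of their measure times the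
   norm of f, and the oscillation of F on Q is at most a constant times 2^(-n eta) times the norm of
   f, for 0 < eta < s - 2/p. The theorem follows with 2^-n comparable to epsilon, because
   n^2 is then at most a constant times (1/epsilon) (1 + log (1/epsilon)).

   The hypothesis on f is tested against Bessel potentials of Gaussians only. They are mixtures of
   Gaussians, which gives all the estimates. *)

theory Submission
  imports Defs "HOL-Probability.Characteristic_Functions"
begin

section \<open>Gaussian kernels\<close>

text \<open>Since s > 2/p, the Sobolev norm alone already controls the sup norm; the BMO norm is
  brought in to make its coefficient small. Telescoping in both directions leaves three boundary
  averages, and it is the membership of f in L^p that makes them small. This dictates the lengths: a
  rectangle of sides 2^(2n) and 2^(-n) has measure 2^n, so its average is of size 2^(-n/p). The
  oscillation is estimated with the Hoelder exponent \<eta> = \<delta>/2, and both Sobolev terms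
  reach the power \<gamma>/2 of \<epsilon> because \<gamma>/2 is below 1/p and below \<eta>.

  F is given up to a null set and is tied to f by a distributional identity. The estimates through f
  are therefore proved for the convolution of F with a Gaussian of variance v, with constants free
  of v, and carried over to averages of F as v tends to 0. The pointwise bound is recovered from
  averages over all small boxes.\<close>

text \<open>Hoelder's inequality combined with the interpolation bound
  \<open>K powr (1/p) * L powr (1 - 1/p)\<close> for the norm of k in the dual exponent. Young's
  inequality at a fixed scale t is integrated against k, using k \<le> K in the term with
  \<open>f z powr p\<close> and the integral of k in the other.\<close>

lemma nn_integral_mult_le_Lp:
  fixes f k :: "'a \<Rightarrow> real"
  assumes [measurable]: "f \<in> borel_measurable M" "k \<in> borel_measurable M"
    and f0: "\<And>z. 0 \<le> f z" and k0: "\<And>z. 0 \<le> k z" and kK: "\<And>z. k z \<le> K"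
    and p: "1 < p" and N0: "0 \<le> N" and K0: "0 < K" and L0: "0 < L"
    and fN: "(\<integral>\<^sup>+z. f z powr p \<partial>M) \<le> ennreal (N powr p)"
    and kL: "(\<integral>\<^sup>+z. k z \<partial>M) \<le> ennreal L"
  shows "(\<integral>\<^sup>+z. f z * k z \<partial>M) \<le> ennreal (N * K powr (1/p) * L powr (1 - 1/p))"
proof (cases "N = 0")
  case True
  then have "(\<integral>\<^sup>+z. f z powr p \<partial>M) = 0" using fN p by simp
  then have "AE z in M. ennreal (f z powr p) = 0" by (subst (asm) nn_integral_0_iff_AE) auto
  then have "AE z in M. f z = 0"
  proof eventually_elim
    fix z assume "ennreal (f z powr p) = 0"
    then have "f z powr p \<le> 0" by (simp only: ennreal_eq_0_iff)
    then show "f z = 0" by (simp add: order_antisym_conv)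
  qed
  then have "(\<integral>\<^sup>+z. f z * k z \<partial>M) = (\<integral>\<^sup>+z. 0 \<partial>M)" by (intro nn_integral_cong_AE) auto
  then show ?thesis by simp
next
  case False
  then have N: "N > 0" using N0 by simp
  \<comment> \<open>The value at which the two terms of the integrated bound balance:
    \<open>t powr (1-p) * K * N powr p = t * L\<close>.\<close>
  define t where "t = N * K powr (1/p) * L powr (-1/p)"
  have t: "t > 0" unfolding t_def using N K0 L0 by simp
  have young: "x \<le> x powr p * t powr (1-p) / p + (1 - 1/p) * t" if "x \<ge> 0" for x
  proof (cases "x = 0")
    case True then show ?thesis using p t by (simp add: field_simps)
  next
    case False
    then have x: "x > 0" using that by simp
    have "(x powr p * t powr (1-p)) powr (1/p) * t powr (1 - 1/p)
      \<le> 1/p * (x powr p * t powr (1-p)) + (1 - 1/p) * t"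
      by (rule Youngs_inequality_0) (use p x t in auto)
    moreover have "(x powr p * t powr (1-p)) powr (1/p) * t powr (1 - 1/p) = x"
    proof -
      have "(x powr p * t powr (1-p)) powr (1/p) * t powr (1 - 1/p) = x * (t powr ((1-p)/p) * t powr (1 - 1/p))"
        using p x t by (simp add: powr_mult powr_powr)
      also have "t powr ((1-p)/p) * t powr (1 - 1/p) = 1"
        using p t by (simp add: powr_add[symmetric] diff_divide_distrib)
      finally show ?thesis by simp
    qed
    ultimately show ?thesis by simp
  qed
  have "(\<integral>\<^sup>+z. f z * k z \<partial>M) \<le> (\<integral>\<^sup>+z. ennreal (t powr (1-p) / p * K) * ennreal (f z powr p) + ennreal ((1-1/p) * t) * ennreal (k z) \<partial>M)"
  proof (intro nn_integral_mono)
    fix z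
    have "f z * k z \<le> (f z powr p * t powr (1-p) / p + (1 - 1/p) * t) * k z"
      by (intro mult_right_mono young f0 k0)
    also have "\<dots> = (f z powr p * t powr (1-p) / p) * k z + (1 - 1/p) * t * k z" by (simp add: algebra_simps)
    also have "\<dots> \<le> (f z powr p * t powr (1-p) / p) * K + (1 - 1/p) * t * k z"
      using kK[of z] p by (intro add_right_mono mult_left_mono) auto
    also have "\<dots> = (t powr (1-p) / p * K) * (f z powr p) + ((1-1/p) * t) * k z" by simp
    finally have "ennreal (f z * k z) \<le> ennreal ((t powr (1-p) / p * K) * (f z powr p) + ((1-1/p) * t) * k z)"
      by (rule ennreal_leI)
    also have "\<dots> = ennreal (t powr (1-p) / p * K) * ennreal (f z powr p) + ennreal ((1-1/p) * t) * ennreal (k z)"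
      using p t K0 k0 by (simp add: ennreal_mult[symmetric] ennreal_plus[symmetric] del: ennreal_plus)
    finally show "ennreal (f z * k z) \<le> \<dots>" .
  qed
  also have "\<dots> = ennreal (t powr (1-p) / p * K) * (\<integral>\<^sup>+z. f z powr p \<partial>M) + ennreal ((1-1/p) * t) * (\<integral>\<^sup>+z. k z \<partial>M)"
    by (subst nn_integral_add) (auto simp: nn_integral_cmult)
  also have "\<dots> \<le> ennreal (t powr (1-p) / p * K) * ennreal (N powr p) + ennreal ((1-1/p) * t) * ennreal L"
    by (intro add_mono mult_left_mono fN kL) auto
  also have "\<dots> = ennreal (t powr (1-p) / p * K * N powr p + (1-1/p) * t * L)"
    using p t K0 L0 by (simp add: ennreal_mult[symmetric] ennreal_plus[symmetric] del: ennreal_plus)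
  also have "t powr (1-p) / p * K * N powr p + (1-1/p) * t * L = N * K powr (1/p) * L powr (1 - 1/p)"
  proof -
    have e: "t powr (1-p) = N powr (1-p) * K powr ((1-p)/p) * L powr (1 - 1/p)"
    proof -
      have "- ((1 - p) / p) = 1 - 1/p" using p by (simp add: field_simps)
      then show ?thesis unfolding t_def using N K0 L0 by (simp add: powr_mult powr_powr)
    qed
    have "t powr (1-p) * K * N powr p = (N powr (1-p) * N powr p) * (K powr ((1-p)/p) * K powr 1) * L powr (1 - 1/p)"
      unfolding e using K0 by simp
    also have "N powr (1-p) * N powr p = N" using N by (simp add: powr_add[symmetric])
    also have "K powr ((1-p)/p) * K powr 1 = K powr (1/p)"
      unfolding powr_add[symmetric] using p by (intro arg_cong[where f="\<lambda>x. K powr x"]) (simp add: field_simps)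
    finally have 1: "t powr (1-p) * K * N powr p = N * K powr (1/p) * L powr (1-1/p)" .
    have "L powr (-1/p) * L powr 1 = L powr (1-1/p)" unfolding powr_add[symmetric] by simp
    then have 2: "t * L = N * K powr (1/p) * L powr (1-1/p)"
      unfolding t_def using L0 by (simp add: mult_ac)
    have "t powr (1-p) / p * K * N powr p + (1-1/p) * t * L
      = (t powr (1-p) * K * N powr p) / p + (1-1/p) * (t * L)" by simp
    also have "\<dots> = N * K powr (1/p) * L powr (1 - 1/p)" unfolding 1 2 using p by (simp add: field_simps)
    finally show ?thesis .
  qed
  finally show ?thesis .
qed

definition gauss :: "real \<Rightarrow> real \<times> real \<Rightarrow> real \<times> real \<Rightarrow> real" where
  "gauss t a z = exp (- (norm (z - a))\<^sup>2 / (2 * t)) / (2 * pi * t)"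

lemma norm_prod_square: "(norm z)\<^sup>2 = (fst z)\<^sup>2 + (snd z)\<^sup>2" for z :: "real \<times> real"
  by (cases z) (simp add: norm_Pair)

lemma gauss_normal_density:
  assumes "t > 0"
  shows "gauss t a z = normal_density (fst a) (sqrt t) (fst z) * normal_density (snd a) (sqrt t) (snd z)"
proof -
  have "sqrt (2 * pi * t) * sqrt (2 * pi * t) = 2 * pi * t" using assms by simp
  then show ?thesis using assms unfolding gauss_def normal_density_def norm_prod_square
    by (simp add: exp_add[symmetric] add_divide_distrib[symmetric] diff_divide_distrib)
qed

lemma gauss_commute: "gauss t a z = gauss t z a"
  by (simp add: gauss_def norm_minus_commute)

lemma gauss_nonneg: "t > 0 \<Longrightarrow> 0 \<le> gauss t a z" and gauss_pos: "t > 0 \<Longrightarrow> 0 < gauss t a z"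
  by (auto simp: gauss_def)

lemma gauss_le: assumes "t > 0" shows "gauss t a z \<le> 1 / (2 * pi * t)"
  using assms by (simp add: gauss_def divide_right_mono)

lemma borel_measurable_gauss[measurable (raw)]:
  assumes [measurable]: "t \<in> borel_measurable M" "a \<in> borel_measurable M" "z \<in> borel_measurable M"
  shows "(\<lambda>x. gauss (t x) (a x) (z x)) \<in> borel_measurable M"
  unfolding gauss_def by measurable

lemma nn_integral_gauss:
  assumes t: "t > 0" shows "(\<integral>\<^sup>+z. gauss t a z \<partial>lborel) = 1"
proof -
  have 1: "(\<integral>\<^sup>+x. normal_density m (sqrt t) x \<partial>lborel) = 1" for m
    using t by (subst nn_integral_eq_integral) auto
  have "(\<integral>\<^sup>+z. gauss t a z \<partial>lborel) = (\<integral>\<^sup>+z. ennreal (normal_density (fst a) (sqrt t) (fst z)) * ennreal (normal_density (snd a) (sqrt t) (snd z)) \<partial>(lborel \<Otimes>\<^sub>M lborel))"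
    unfolding lborel_prod by (intro nn_integral_cong) (simp add: gauss_normal_density[OF t] ennreal_mult)
  also have "\<dots> = 1"
    by (subst lborel.nn_integral_fst[symmetric]) (auto simp: nn_integral_cmult nn_integral_multc 1)
  finally show ?thesis .
qed

lemma integrable_gauss: assumes t: "t > 0" shows "integrable lborel (gauss t a)"
  using nn_integral_gauss[OF t, of a] gauss_nonneg[OF t]
  by (intro integrableI_nonneg) (auto simp: borel_measurable_gauss)

lemma integral_gauss: assumes t: "t > 0" shows "(LINT z|lborel. gauss t a z) = 1"
  using nn_integral_gauss[OF t, of a] gauss_nonneg[OF t] integrable_gauss[OF t, of a]
  by (subst (asm) nn_integral_eq_integral) (auto simp: borel_measurable_gauss)

text \<open>The parallelogram law moves both squares to the midpoint. The product thus has the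
  explicit integral \<open>exp (- (dist a b)\<^sup>2 / (8 * t))\<close>, the affinity that enters
  the Hellinger distance.\<close>

lemma sqrt_gauss_mult:
  assumes t: "t > 0"
  shows "sqrt (gauss t a z) * sqrt (gauss t b z) = exp (- (dist a b)\<^sup>2 / (8 * t)) * gauss t ((1/2) *\<^sub>R (a + b)) z"
proof -
  let ?A = "(norm (z - a))\<^sup>2" and ?B = "(norm (z - b))\<^sup>2"
  have par: "?A + ?B = 2 * (norm (z - (1/2) *\<^sub>R (a + b)))\<^sup>2 + (dist a b)\<^sup>2 / 2"
    unfolding dist_norm norm_prod_square by (simp add: power2_eq_square field_simps)
  have "gauss t a z * gauss t b z = (exp (- (dist a b)\<^sup>2 / (8 * t)) * gauss t ((1/2) *\<^sub>R (a + b)) z)\<^sup>2"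
  proof -
    have "- ?A / (2 * t) + - ?B / (2 * t) = - (?A + ?B) / (2 * t)" by (simp add: add_divide_distrib diff_divide_distrib)
    also have "\<dots> = 2 * (- (dist a b)\<^sup>2 / (8 * t)) + 2 * (- (norm (z - (1/2) *\<^sub>R (a + b)))\<^sup>2 / (2 * t))"
      unfolding par using t by (simp add: field_simps)
    finally have e: "exp (- ?A / (2 * t)) * exp (- ?B / (2 * t)) = (exp (- (dist a b)\<^sup>2 / (8 * t)))\<^sup>2 * (exp (- (norm (z - (1/2) *\<^sub>R (a + b)))\<^sup>2 / (2 * t)))\<^sup>2"
      by (simp only: exp_add[symmetric] exp_double[symmetric])
    show ?thesis unfolding gauss_def power_mult_distrib power_divide
      using e by (simp add: power2_eq_square)
  qed
  then show ?thesis using t gauss_nonneg[OF t] by (simp add: real_sqrt_mult[symmetric])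
qed

text \<open>With x and y the square roots of the densities,
  \<open>|x^2 - y^2| = |x - y| * (x + y)\<close>, and a weighted arithmetic-geometric mean
  inequality leaves only integrals of x^2, y^2 and the product of x and y, all explicit. This is the
  Cauchy-Schwarz bound by the Hellinger distance.\<close>

lemma L1_dist_gauss_le:
  assumes t: "t > 0"
  shows "(\<integral>\<^sup>+z. \<bar>gauss t a z - gauss t b z\<bar> \<partial>lborel) \<le> ennreal (dist a b / sqrt t)"
proof (cases "a = b")
  case True then show ?thesis by simp
next
  case False
  define d where "d = dist a b"
  have d: "d > 0" using False by (simp add: d_def)
  \<comment> \<open>The minimiser of \<open>l * (d\<^sup>2 / (8 * t)) + 2 / l\<close>, the bound
    that remains at the end.\<close>
  define l where "l = 4 * sqrt t / d"
  have l: "l > 0" using t d by (simp add: l_def)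
  let ?m = "(1/2) *\<^sub>R (a + b)"
  let ?e = "exp (- d\<^sup>2 / (8 * t))"
  let ?h = "\<lambda>z. (l / 2 + 1 / (2 * l)) * (gauss t a z + gauss t b z) + (- l + 1 / l) * ?e * gauss t ?m z"
  have pt: "\<bar>gauss t a z - gauss t b z\<bar> \<le> ?h z" for z
  proof -
    define x y where "x = sqrt (gauss t a z)" and "y = sqrt (gauss t b z)"
    have xy: "x \<ge> 0" "y \<ge> 0" "gauss t a z = x\<^sup>2" "gauss t b z = y\<^sup>2"
      using gauss_nonneg[OF t] by (auto simp: x_def y_def)
    have m: "x * y = ?e * gauss t ?m z" unfolding x_def y_def d_def by (rule sqrt_gauss_mult[OF t])
    have "0 \<le> (l * \<bar>x - y\<bar> - (x + y))\<^sup>2" by simp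
    then have "2 * l * (\<bar>x - y\<bar> * (x + y)) \<le> l\<^sup>2 * (x - y)\<^sup>2 + (x + y)\<^sup>2"
      by (simp add: power2_diff power_mult_distrib algebra_simps)
    then have "\<bar>x - y\<bar> * (x + y) \<le> (l\<^sup>2 * (x - y)\<^sup>2 + (x + y)\<^sup>2) / (2 * l)"
      using l by (simp add: field_simps)
    also have "\<dots> = (l / 2 + 1 / (2 * l)) * (x\<^sup>2 + y\<^sup>2) + (- l + 1 / l) * (x * y)"
      using l by (simp add: power2_eq_square field_simps)
    finally have "\<bar>x - y\<bar> * (x + y) \<le> \<dots>" .
    moreover have "\<bar>x\<^sup>2 - y\<^sup>2\<bar> = \<bar>x - y\<bar> * (x + y)"
    proof -
      have "x\<^sup>2 - y\<^sup>2 = (x - y) * (x + y)" by (simp add: power2_eq_square algebra_simps)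
      then show ?thesis using xy by (simp add: abs_mult)
    qed
    ultimately show ?thesis by (simp add: xy m)
  qed
  have int: "integrable lborel ?h" using integrable_gauss[OF t] by auto
  have h0: "0 \<le> ?h z" for z using pt[of z] by linarith
  have "(\<integral>\<^sup>+z. \<bar>gauss t a z - gauss t b z\<bar> \<partial>lborel) \<le> (\<integral>\<^sup>+z. ?h z \<partial>lborel)"
    by (intro nn_integral_mono ennreal_leI pt)
  also have "\<dots> = ennreal (LINT z|lborel. ?h z)"
    by (intro nn_integral_eq_integral int) (use h0 in auto)
  also have "(LINT z|lborel. ?h z) = (l / 2 + 1 / (2 * l)) * 2 + (- l + 1 / l) * ?e"
    using integrable_gauss[OF t] by (simp add: integral_gauss[OF t])
  also have "\<dots> = l * (1 - ?e) + (1 + ?e) / l" using l by (simp add: field_simps)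
  also have "\<dots> \<le> l * (d\<^sup>2 / (8 * t)) + 2 / l"
  proof -
    have "1 - ?e \<le> d\<^sup>2 / (8 * t)" using exp_ge_add_one_self[of "- d\<^sup>2 / (8 * t)"] by simp
    moreover have "?e \<le> 1" using t by simp
    ultimately show ?thesis using l by (intro add_mono mult_left_mono divide_right_mono) auto
  qed
  also have "\<dots> = d / sqrt t"
  proof -
    define r where "r = sqrt t"
    then have r: "r = sqrt t" "r > 0" "t = r\<^sup>2" using t by auto
    show ?thesis unfolding l_def r(1)[symmetric] unfolding r(3) using r d by (simp add: field_simps power2_eq_square)
  qed
  finally show ?thesis unfolding d_def by (simp add: ennreal_leI)
qed

lemma borel_measurable_cis[measurable]: "cis \<in> borel_measurable borel"
  unfolding cis_conv_exp by measurable

lemma integral_lborel_times: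
  fixes f g :: "real \<Rightarrow> complex"
  assumes f: "integrable lborel f" and g: "integrable lborel g"
  shows "integrable lborel (\<lambda>z. f (fst z) * g (snd z))" (is "integrable _ ?h")
    and "(LINT z|lborel. f (fst z) * g (snd z)) = (LINT x|lborel. f x) * (LINT y|lborel. g y)"
proof -
  have [measurable]: "f \<in> borel_measurable borel" "g \<in> borel_measurable borel"
    using f g by auto
  have int: "integrable (lborel \<Otimes>\<^sub>M lborel) ?h"
    by (rule lborel_pair.Fubini_integrable) (use f g in \<open>auto simp: norm_mult\<close>)
  then show "integrable lborel ?h" unfolding lborel_prod .
  have "(LINT z|lborel. ?h z) = (LINT z|(lborel \<Otimes>\<^sub>M lborel). ?h z)" unfolding lborel_prod ..
  also have "\<dots> = (LINT x|lborel. LINT y|lborel. ?h (x, y))"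
    by (rule lborel_pair.integral_fst'[symmetric, OF int])
  finally show "(LINT z|lborel. ?h z) = (LINT x|lborel. f x) * (LINT y|lborel. g y)" by simp
qed

lemma char_normal_density:
  assumes s: "0 < \<sigma>"
  shows "(LINT x|lborel. of_real (normal_density m \<sigma> x) * cis (k * x)) = cis (k * m) * of_real (exp (- (\<sigma> * k)\<^sup>2 / 2))"
proof -
  have st: "(LINT x|lborel. of_real (std_normal_density x) * cis (t * x)) = of_real (exp (- t\<^sup>2 / 2))" for t
  proof -
    have "char std_normal_distribution t = (LINT x|lborel. std_normal_density x *\<^sub>R iexp (t * x))"
      unfolding char_def by (subst integral_density) auto
    also have "\<dots> = (LINT x|lborel. of_real (std_normal_density x) * cis (t * x))"
      by (simp add: scaleR_conv_of_real cis_conv_exp)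
    finally show ?thesis by (simp add: char_std_normal_distribution)
  qed
  have "(LINT x|lborel. of_real (normal_density m \<sigma> x) * cis (k * x))
    = \<bar>\<sigma>\<bar> *\<^sub>R (LINT x|lborel. of_real (normal_density m \<sigma> (m + \<sigma> * x)) * cis (k * (m + \<sigma> * x)))"
    using s by (intro lborel_integral_real_affine) auto
  also have "(LINT x|lborel. of_real (normal_density m \<sigma> (m + \<sigma> * x)) * cis (k * (m + \<sigma> * x)))
    = (LINT x|lborel. cis (k * m) / of_real \<sigma> * (of_real (std_normal_density x) * cis ((\<sigma> * k) * x)))"
  proof (rule arg_cong[where f = "integral\<^sup>L lborel"], rule ext)
    fix x
    have "normal_density m \<sigma> (m + \<sigma> * x) = std_normal_density x / \<sigma>"
      using s by (simp add: normal_density_def real_sqrt_mult power_mult_distrib field_simps)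
    moreover have "cis (k * (m + \<sigma> * x)) = cis (k * m) * cis ((\<sigma> * k) * x)"
      by (simp add: cis_mult algebra_simps)
    ultimately show "of_real (normal_density m \<sigma> (m + \<sigma> * x)) * cis (k * (m + \<sigma> * x))
      = cis (k * m) / of_real \<sigma> * (of_real (std_normal_density x) * cis ((\<sigma> * k) * x))"
      by simp
  qed
  also have "\<dots> = cis (k * m) / of_real \<sigma> * of_real (exp (- (\<sigma> * k)\<^sup>2 / 2))"
    by (subst integral_mult_right_zero) (simp only: st)
  finally show ?thesis using s by (simp add: scaleR_conv_of_real)
qed

lemma fourier_gauss_lborel:
  assumes t: "t > 0"
  shows "(LINT z|lborel. of_real (gauss t a z) * cis (z \<bullet> \<xi>)) = cis (a \<bullet> \<xi>) * of_real (exp (- t * (norm \<xi>)\<^sup>2 / 2))"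
proof -
  let ?f = "\<lambda>a k x. of_real (normal_density a (sqrt t) x) * cis (k * x)"
  have f: "integrable lborel (?f a k)" for a k
    by (rule Bochner_Integration.integrable_bound[of _ "normal_density a (sqrt t)"]) (use t in \<open>auto simp: norm_mult\<close>)
  have "(LINT z|lborel. of_real (gauss t a z) * cis (z \<bullet> \<xi>)) = (LINT z|lborel. ?f (fst a) (fst \<xi>) (fst z) * ?f (snd a) (snd \<xi>) (snd z))"
    by (rule arg_cong[where f = "integral\<^sup>L lborel"], rule ext)
      (simp add: gauss_normal_density[OF t] inner_prod_def cis_mult[symmetric] mult_ac)
  also have "\<dots> = (LINT x|lborel. ?f (fst a) (fst \<xi>) x) * (LINT y|lborel. ?f (snd a) (snd \<xi>) y)"
    by (rule integral_lborel_times(2)[OF f f])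
  also have "\<dots> = cis (fst \<xi> * fst a) * cis (snd \<xi> * snd a) * of_real (exp (- (sqrt t * fst \<xi>)\<^sup>2 / 2) * exp (- (sqrt t * snd \<xi>)\<^sup>2 / 2))"
    using t by (subst (1 2) char_normal_density) auto
  also have "cis (fst \<xi> * fst a) * cis (snd \<xi> * snd a) = cis (a \<bullet> \<xi>)"
    by (simp add: cis_mult inner_prod_def mult.commute)
  also have "exp (- (sqrt t * fst \<xi>)\<^sup>2 / 2) * exp (- (sqrt t * snd \<xi>)\<^sup>2 / 2) = exp (- t * (norm \<xi>)\<^sup>2 / 2)"
    using t by (simp add: exp_add[symmetric] norm_prod_square power_mult_distrib field_simps)
  finally show ?thesis .
qed

section \<open>The Gamma distribution\<close>

lemma nn_integral_Gamma_scale: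
  assumes c: "0 < c" and l: "0 < l"
  shows "(\<integral>\<^sup>+u. ennreal (indicator {0<..} u * (u powr (c - 1) * exp (- l * u))) \<partial>lborel) = ennreal (Gamma c * l powr (- c))"
proof -
  have "ennreal (Gamma c) = (\<integral>\<^sup>+t. ennreal (indicator {0..} t * t powr (c - 1) / exp t) \<partial>lborel)"
    by (rule Gamma_conv_nn_integral_real[OF c])
  also have "\<dots> = ennreal \<bar>l\<bar> * (\<integral>\<^sup>+t. ennreal (indicator {0..} (0 + l * t) * (0 + l * t) powr (c - 1) / exp (0 + l * t)) \<partial>lborel)"
    using l by (intro nn_integral_real_affine) auto
  also have "(\<integral>\<^sup>+t. ennreal (indicator {0..} (0 + l * t) * (0 + l * t) powr (c - 1) / exp (0 + l * t)) \<partial>lborel)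
    = (\<integral>\<^sup>+t. ennreal (l powr (c - 1)) * ennreal (indicator {0<..} t * (t powr (c - 1) * exp (- l * t))) \<partial>lborel)"
  proof (intro nn_integral_cong)
    fix t :: real
    show "ennreal (indicator {0..} (0 + l * t) * (0 + l * t) powr (c - 1) / exp (0 + l * t))
      = ennreal (l powr (c - 1)) * ennreal (indicator {0<..} t * (t powr (c - 1) * exp (- l * t)))"
    proof (cases "t > 0")
      case True
      then show ?thesis using l
        by (simp add: ennreal_mult[symmetric] powr_mult exp_minus field_simps)
    next
      case False
      then show ?thesis using l by (cases "t = 0") (auto simp: indicator_def zero_le_mult_iff)
    qed
  qed
  also have "\<dots> = ennreal (l powr (c - 1)) * (\<integral>\<^sup>+t. ennreal (indicator {0<..} t * (t powr (c - 1) * exp (- l * t))) \<partial>lborel)"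
    by (subst nn_integral_cmult) auto
  finally have *: "ennreal (Gamma c) = ennreal l * (ennreal (l powr (c - 1)) * (\<integral>\<^sup>+t. ennreal (indicator {0<..} t * (t powr (c - 1) * exp (- l * t))) \<partial>lborel))"
    using l by simp
  define X where "X = (\<integral>\<^sup>+t. ennreal (indicator {0<..} t * (t powr (c - 1) * exp (- l * t))) \<partial>lborel)"
  have "ennreal (Gamma c) = ennreal (l powr c) * X"
    unfolding * X_def using l by (simp add: mult.assoc[symmetric] ennreal_mult[symmetric] powr_mult_base)
  then have "ennreal (l powr (-c)) * ennreal (Gamma c) = (ennreal (l powr (-c)) * ennreal (l powr c)) * X"
    by (simp add: mult.assoc)
  also have "ennreal (l powr (-c)) * ennreal (l powr c) = 1"
    using l by (simp add: ennreal_mult[symmetric] powr_add[symmetric])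
  finally show ?thesis using c l unfolding X_def[symmetric]
    by (simp add: ennreal_mult[symmetric] mult.commute Gamma_real_pos less_imp_le)
qed

text \<open>The Gamma distribution of shape \<alpha> and scale 1. For \<alpha> = s/2 its Laplace
  transform at the squared norm of \<xi> is the multiplier of the Bessel potential of order
  s.\<close>

definition gamma_measure :: "real \<Rightarrow> real measure" where
  "gamma_measure \<alpha> = density lborel (\<lambda>u. ennreal (indicator {0<..} u * (u powr (\<alpha> - 1) * exp (- u)) / Gamma \<alpha>))"

lemma sets_gamma_measure[simp, measurable_cong]: "sets (gamma_measure \<alpha>) = sets borel"
  and space_gamma_measure[simp]: "space (gamma_measure \<alpha>) = UNIV"
  by (auto simp: gamma_measure_def)

text \<open>One formula for three purposes: \<beta> = 0 gives the total mass and the Laplace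
  transform, a natural number \<beta> the moments, and a negative \<beta> the inverse moment in the
  Hoelder estimate, where \<open>0 < \<alpha> + \<beta>\<close> is convergence at 0.\<close>

lemma nn_integral_gamma_measure_powr_exp:
  assumes a: "0 < \<alpha>" and b: "0 < \<alpha> + \<beta>" and l: "0 < 1 + l"
  shows "(\<integral>\<^sup>+u. ennreal (u powr \<beta> * exp (- l * u)) \<partial>gamma_measure \<alpha>) = ennreal (Gamma (\<alpha> + \<beta>) / Gamma \<alpha> * (1 + l) powr (- (\<alpha> + \<beta>)))"
proof -
  have g: "Gamma \<alpha> > 0" "Gamma (\<alpha> + \<beta>) > 0" using a b by (auto simp: Gamma_real_pos)
  have "(\<integral>\<^sup>+u. ennreal (u powr \<beta> * exp (- l * u)) \<partial>gamma_measure \<alpha>)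
    = (\<integral>\<^sup>+u. ennreal (1 / Gamma \<alpha>) * ennreal (indicator {0<..} u * (u powr ((\<alpha> + \<beta>) - 1) * exp (- (1 + l) * u))) \<partial>lborel)"
    unfolding gamma_measure_def
  proof (subst nn_integral_density, measurable, intro nn_integral_cong)
    fix u :: real
    show "ennreal (indicator {0<..} u * (u powr (\<alpha> - 1) * exp (- u)) / Gamma \<alpha>) * ennreal (u powr \<beta> * exp (- l * u))
      = ennreal (1 / Gamma \<alpha>) * ennreal (indicator {0<..} u * (u powr ((\<alpha> + \<beta>) - 1) * exp (- (1 + l) * u)))"
    proof (cases "u > 0")
      case True
      have "u powr (\<alpha> - 1) * u powr \<beta> = u powr ((\<alpha> + \<beta>) - 1)" "exp (-u) * exp (- l * u) = exp (- (1 + l) * u)"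
        by (auto simp: powr_add[symmetric] exp_add[symmetric] algebra_simps)
      then have "u powr (\<alpha> - 1) * exp (- u) / Gamma \<alpha> * (u powr \<beta> * exp (- l * u))
        = 1 / Gamma \<alpha> * (u powr ((\<alpha> + \<beta>) - 1) * exp (- (1 + l) * u))"
        by (metis (no_types, opaque_lifting) mult.assoc mult.commute times_divide_eq_left mult_1)
      then show ?thesis using True g by (simp add: ennreal_mult[symmetric])
    qed auto
  qed
  also have "\<dots> = ennreal (1 / Gamma \<alpha>) * ennreal (Gamma (\<alpha> + \<beta>) * (1 + l) powr (- (\<alpha> + \<beta>)))"
    by (subst nn_integral_cmult, measurable, subst nn_integral_Gamma_scale) (use b l in auto)
  also have "\<dots> = ennreal (Gamma (\<alpha> + \<beta>) / Gamma \<alpha> * (1 + l) powr (- (\<alpha> + \<beta>)))"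
    using g by (simp add: ennreal_mult[symmetric])
  finally show ?thesis .
qed

lemma AE_gamma_measure_pos: "AE u in gamma_measure \<alpha>. 0 < u"
  unfolding gamma_measure_def by (subst AE_density) (auto simp: indicator_def intro!: AE_I2)

lemma prob_space_gamma_measure: assumes "0 < \<alpha>" shows "prob_space (gamma_measure \<alpha>)"
proof
  have "(\<integral>\<^sup>+u. 1 \<partial>gamma_measure \<alpha>) = (\<integral>\<^sup>+u. ennreal (u powr 0 * exp (- 0 * u)) \<partial>gamma_measure \<alpha>)"
    by (rule nn_integral_cong_AE, rule AE_mp[OF AE_gamma_measure_pos]) auto
  also have "\<dots> = 1" using assms less_imp_neq[OF Gamma_real_pos[OF assms]]
    by (subst nn_integral_gamma_measure_powr_exp) auto
  finally show "emeasure (gamma_measure \<alpha>) (space (gamma_measure \<alpha>)) = 1" by simp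
qed

lemma integral_gamma_measure_exp:
  assumes a: "0 < \<alpha>" and l: "0 \<le> l"
  shows "(LINT u|gamma_measure \<alpha>. exp (- l * u)) = (1 + l) powr (- \<alpha>)"
proof -
  have "(\<integral>\<^sup>+u. ennreal (exp (- l * u)) \<partial>gamma_measure \<alpha>) = (\<integral>\<^sup>+u. ennreal (u powr 0 * exp (- l * u)) \<partial>gamma_measure \<alpha>)"
    by (rule nn_integral_cong_AE, rule AE_mp[OF AE_gamma_measure_pos]) auto
  also have "\<dots> = ennreal ((1 + l) powr (- \<alpha>))"
    using assms less_imp_neq[OF Gamma_real_pos[OF a]] by (subst nn_integral_gamma_measure_powr_exp) auto
  finally show ?thesis by (intro integral_eq_nn_integral[THEN trans]) auto
qed

lemma integrable_gamma_measure_power: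
  assumes a: "0 < \<alpha>" and v: "0 \<le> v"
  shows "integrable (gamma_measure \<alpha>) (\<lambda>u. (v + 2 * u) ^ N)"
proof -
  have "integrable (gamma_measure \<alpha>) (\<lambda>u. u ^ k)" for k
  proof (rule integrableI_bounded)
    have "(\<integral>\<^sup>+u. ennreal (norm (u ^ k)) \<partial>gamma_measure \<alpha>) = (\<integral>\<^sup>+u. ennreal (u powr (real k) * exp (- 0 * u)) \<partial>gamma_measure \<alpha>)"
      by (rule nn_integral_cong_AE, rule AE_mp[OF AE_gamma_measure_pos]) (auto simp: powr_realpow)
    also have "\<dots> < \<infinity>" using a by (subst nn_integral_gamma_measure_powr_exp) auto
    finally show "(\<integral>\<^sup>+u. ennreal (norm (u ^ k)) \<partial>gamma_measure \<alpha>) < \<infinity>" .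
  qed auto
  then show ?thesis
    by (subst binomial_ring) (auto simp: power_mult_distrib intro!: Bochner_Integration.integrable_sum)
qed

section \<open>The Bessel potential of a Gaussian\<close>

text \<open>The Gamma integral writes the multiplier of the Bessel potential as a mixture of Gaussians,
  so that the potential of order \<open>2 * \<alpha>\<close> of \<open>gauss v a\<close> is a mixture of Gaussians too. The absolute
  value makes every variance positive and matters on a null set only.\<close>

definition bessel_kernel :: "real \<Rightarrow> real \<Rightarrow> real \<times> real \<Rightarrow> real \<times> real \<Rightarrow> real" where
  "bessel_kernel \<alpha> v a z = (LINT u|gamma_measure \<alpha>. gauss (v + 2 * \<bar>u\<bar>) a z)"

lemma borel_measurable_bessel_kernel:
  assumes "0 < \<alpha>" shows "bessel_kernel \<alpha> v a \<in> borel_measurable borel"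
proof -
  interpret prob_space "gamma_measure \<alpha>" by (rule prob_space_gamma_measure[OF assms])
  show ?thesis unfolding bessel_kernel_def[abs_def] by measurable
qed

lemma integrable_gamma_measure_gauss:
  assumes "0 < \<alpha>" and v: "0 < v"
  shows "integrable (gamma_measure \<alpha>) (\<lambda>u. gauss (v + 2 * \<bar>u\<bar>) a z)"
proof -
  interpret prob_space "gamma_measure \<alpha>" by (rule prob_space_gamma_measure[OF assms(1)])
  show ?thesis
  proof (rule integrable_const_bound[where B = "1 / (2 * pi * v)"])
    show "AE u in gamma_measure \<alpha>. norm (gauss (v + 2 * \<bar>u\<bar>) a z) \<le> 1 / (2 * pi * v)"
    proof (intro AE_I2)
      fix u :: real
      have "gauss (v + 2 * \<bar>u\<bar>) a z \<le> 1 / (2 * pi * (v + 2 * \<bar>u\<bar>))" using v by (intro gauss_le) auto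
      also have "\<dots> \<le> 1 / (2 * pi * v)" using v by (intro divide_left_mono mult_left_mono) auto
      finally show "norm (gauss (v + 2 * \<bar>u\<bar>) a z) \<le> 1 / (2 * pi * v)"
        using v gauss_nonneg[of "v + 2 * \<bar>u\<bar>" a z] by simp
    qed
  qed measurable
qed

lemma integrable_pair_gauss:
  fixes k :: "real \<times> real \<Rightarrow> complex"
  assumes a: "0 < \<alpha>" and v: "0 < v" and [measurable]: "k \<in> borel_measurable borel" and k: "\<And>z. cmod (k z) \<le> 1"
  shows "integrable (gamma_measure \<alpha> \<Otimes>\<^sub>M lborel) (\<lambda>(u, z). of_real (gauss (v + 2 * \<bar>u\<bar>) a z) * k z)"
proof -
  interpret prob_space "gamma_measure \<alpha>" by (rule prob_space_gamma_measure[OF a])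
  interpret pair_sigma_finite "gamma_measure \<alpha>" "lborel :: (real \<times> real) measure" ..
  have pos: "v + 2 * \<bar>u\<bar> > 0" for u :: real using v by linarith
  have i: "integrable lborel (\<lambda>z. complex_of_real (gauss (v + 2 * \<bar>u\<bar>) a z) * k z)" for u
    by (rule Bochner_Integration.integrable_bound[OF integrable_gauss[OF pos, of u a]])
      (use k in \<open>auto simp: norm_mult intro!: mult_left_le AE_I2\<close>)
  show ?thesis
  proof (rule Fubini_integrable)
    show "AE x in gamma_measure \<alpha>. integrable lborel (\<lambda>y. case (x, y) of (u, z) \<Rightarrow> complex_of_real (gauss (v + 2 * \<bar>u\<bar>) a z) * k z)"
      using i by simp
    show "integrable (gamma_measure \<alpha>) (\<lambda>x. LINT y|lborel. norm (case (x, y) of (u, z) \<Rightarrow> complex_of_real (gauss (v + 2 * \<bar>u\<bar>) a z) * k z))"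
    proof (rule integrable_const_bound[where B = 1])
      have "(LINT y|lborel. norm (complex_of_real (gauss (v + 2 * \<bar>u\<bar>) a y) * k y)) \<le> 1" for u
      proof -
        have "(LINT y|lborel. norm (complex_of_real (gauss (v + 2 * \<bar>u\<bar>) a y) * k y)) \<le> (LINT y|lborel. gauss (v + 2 * \<bar>u\<bar>) a y)"
          using i integrable_gauss[OF pos] k gauss_nonneg[OF pos]
          by (intro integral_mono integrable_norm) (simp_all add: norm_mult mult_left_le)
        then show ?thesis by (simp add: integral_gauss[OF pos])
      qed
      then show "AE x in gamma_measure \<alpha>. norm (LINT y|lborel. norm (case (x, y) of (u, z) \<Rightarrow> complex_of_real (gauss (v + 2 * \<bar>u\<bar>) a z) * k z)) \<le> 1"
        by (auto intro!: AE_I2)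
    qed measurable
  qed measurable
qed

lemma integral_bessel_kernel_times:
  fixes k :: "real \<times> real \<Rightarrow> complex"
  assumes a: "0 < \<alpha>" and v: "0 < v" and [measurable]: "k \<in> borel_measurable borel" and k: "\<And>z. cmod (k z) \<le> 1"
  shows "(LINT z|lborel. of_real (bessel_kernel \<alpha> v a z) * k z) = (LINT u|gamma_measure \<alpha>. LINT z|lborel. of_real (gauss (v + 2 * \<bar>u\<bar>) a z) * k z)"
proof -
  interpret prob_space "gamma_measure \<alpha>" by (rule prob_space_gamma_measure[OF a])
  interpret pair_sigma_finite "gamma_measure \<alpha>" "lborel :: (real \<times> real) measure" ..
  have "(LINT u|gamma_measure \<alpha>. LINT z|lborel. of_real (gauss (v + 2 * \<bar>u\<bar>) a z) * k z)
     = (LINT z|lborel. LINT u|gamma_measure \<alpha>. of_real (gauss (v + 2 * \<bar>u\<bar>) a z) * k z)"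
    by (rule Fubini_integral[symmetric, OF integrable_pair_gauss[OF assms]])
  also have "\<dots> = (LINT z|lborel. of_real (bessel_kernel \<alpha> v a z) * k z)"
    unfolding bessel_kernel_def by (simp add: integral_mult_left_zero)
  finally show ?thesis ..
qed

text \<open>Up to the phase, a Gaussian of variance \<open>v + 2 * u\<close> has the transform
  \<open>exp (- v * |\<xi>|^2 / 2) * exp (- u * |\<xi>|^2)\<close>; this is why the kernel carries
  the factor 2. Averaging over u leaves the Laplace transform of the Gamma distribution.\<close>

lemma fourier_bessel_kernel:
  assumes a: "0 < \<alpha>" and v: "0 < v"
  shows "fourier (\<lambda>z. of_real (bessel_kernel \<alpha> v a z)) \<xi>
    = cis (- (a \<bullet> \<xi>)) * of_real (exp (- v * (norm \<xi>)\<^sup>2 / 2) * (1 + (norm \<xi>)\<^sup>2) powr (- \<alpha>))"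
proof -
  interpret prob_space "gamma_measure \<alpha>" by (rule prob_space_gamma_measure[OF a])
  have [measurable]: "bessel_kernel \<alpha> v a \<in> borel_measurable borel" by (rule borel_measurable_bessel_kernel[OF a])
  have pos: "v + 2 * \<bar>u\<bar> > 0" for u :: real using v by linarith
  have "fourier (\<lambda>z. of_real (bessel_kernel \<alpha> v a z)) \<xi> = (LINT z|lborel. of_real (bessel_kernel \<alpha> v a z) * cis (- (z \<bullet> \<xi>)))"
    unfolding fourier_def by (rule integral_completion) measurable
  also have "\<dots> = (LINT u|gamma_measure \<alpha>. LINT z|lborel. of_real (gauss (v + 2 * \<bar>u\<bar>) a z) * cis (- (z \<bullet> \<xi>)))"
    by (rule integral_bessel_kernel_times[OF a v]) auto
  also have "\<dots> = (LINT u|gamma_measure \<alpha>. cis (- (a \<bullet> \<xi>)) * of_real (exp (- v * (norm \<xi>)\<^sup>2 / 2)) * of_real (exp (- ((norm \<xi>)\<^sup>2) * u)))"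
  proof (rule integral_cong_AE)
    have "(LINT z|lborel. of_real (gauss (v + 2 * \<bar>u\<bar>) a z) * cis (- (z \<bullet> \<xi>)))
      = cis (- (a \<bullet> \<xi>)) * of_real (exp (- v * (norm \<xi>)\<^sup>2 / 2)) * of_real (exp (- ((norm \<xi>)\<^sup>2) * u))" if u: "u > 0" for u
    proof -
      have "(LINT z|lborel. of_real (gauss (v + 2 * \<bar>u\<bar>) a z) * cis (- (z \<bullet> \<xi>)))
        = cis (a \<bullet> (- \<xi>)) * of_real (exp (- (v + 2 * \<bar>u\<bar>) * (norm (- \<xi>))\<^sup>2 / 2))"
        using fourier_gauss_lborel[OF pos, of u a "- \<xi>"] by simp
      also have "exp (- (v + 2 * \<bar>u\<bar>) * (norm (- \<xi>))\<^sup>2 / 2) = exp (- v * (norm \<xi>)\<^sup>2 / 2) * exp (- ((norm \<xi>)\<^sup>2) * u)"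
        using u by (simp add: exp_add[symmetric] field_simps)
      finally show ?thesis by simp
    qed
    then show "AE u in gamma_measure \<alpha>. (LINT z|lborel. of_real (gauss (v + 2 * \<bar>u\<bar>) a z) * cis (- (z \<bullet> \<xi>)))
      = cis (- (a \<bullet> \<xi>)) * of_real (exp (- v * (norm \<xi>)\<^sup>2 / 2)) * of_real (exp (- ((norm \<xi>)\<^sup>2) * u))"
      by - (rule AE_mp[OF AE_gamma_measure_pos AE_I2], auto)
  qed measurable
  also have "\<dots> = cis (- (a \<bullet> \<xi>)) * of_real (exp (- v * (norm \<xi>)\<^sup>2 / 2)) * of_real ((1 + (norm \<xi>)\<^sup>2) powr (- \<alpha>))"
    by (simp only: integral_mult_right_zero integral_complex_of_real integral_gamma_measure_exp[OF a zero_le_power2])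
  finally show ?thesis by simp
qed

text \<open>The multiplier cancels the one in the transform of the kernel. What is left in the
  frequency variable is again a Gaussian, of variance \<open>1 / v\<close>, so the inverse transform
  follows from the same explicit formula and no inversion theorem is involved.\<close>

lemma bessel_op_bessel_kernel:
  assumes s: "0 < s" and v: "0 < v"
  shows "bessel_op s (\<lambda>z. of_real (bessel_kernel (s / 2) v a z)) z = of_real (gauss v a z)"
proof -
  have "bessel_op s (\<lambda>z. of_real (bessel_kernel (s / 2) v a z)) z
    = (LINT \<xi>|lebesgue. (of_real (2 * pi / v)) * (of_real (gauss (1 / v) 0 \<xi>) * cis (\<xi> \<bullet> (z - a)))) / of_real ((2 * pi)\<^sup>2)"
    unfolding bessel_op_def inverse_fourier_def
  proof (rule arg_cong[where f = "\<lambda>i. i / of_real ((2 * pi)\<^sup>2)"], rule arg_cong[where f = "integral\<^sup>L lebesgue"], rule ext)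
    fix \<xi> :: "real \<times> real"
    have pos: "1 + (norm \<xi>)\<^sup>2 > 0" by (simp add: add_pos_nonneg)
    have "complex_of_real ((1 + (norm \<xi>)\<^sup>2) powr (s / 2)) * fourier (\<lambda>z. complex_of_real (bessel_kernel (s / 2) v a z)) \<xi> * cis (z \<bullet> \<xi>)
      = of_real ((1 + (norm \<xi>)\<^sup>2) powr (s / 2) * (1 + (norm \<xi>)\<^sup>2) powr (- (s / 2))) * of_real (exp (- v * (norm \<xi>)\<^sup>2 / 2)) * (cis (- (a \<bullet> \<xi>)) * cis (z \<bullet> \<xi>))"
      using s v by (subst fourier_bessel_kernel) auto
    also have "(1 + (norm \<xi>)\<^sup>2) powr (s / 2) * (1 + (norm \<xi>)\<^sup>2) powr (- (s / 2)) = 1"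
      unfolding powr_add[symmetric] using pos by simp
    also have "exp (- v * (norm \<xi>)\<^sup>2 / 2) = 2 * pi / v * gauss (1 / v) 0 \<xi>"
      using v by (simp add: gauss_def field_simps)
    also have "cis (- (a \<bullet> \<xi>)) * cis (z \<bullet> \<xi>) = cis (\<xi> \<bullet> (z - a))"
      by (simp add: cis_mult inner_diff_right inner_commute)
    finally show "complex_of_real ((1 + (norm \<xi>)\<^sup>2) powr (s / 2)) * fourier (\<lambda>z. complex_of_real (bessel_kernel (s / 2) v a z)) \<xi> * cis (z \<bullet> \<xi>)
      = (of_real (2 * pi / v)) * (of_real (gauss (1 / v) 0 \<xi>) * cis (\<xi> \<bullet> (z - a)))" by simp
  qed
  also have "(LINT \<xi>|lebesgue. (of_real (2 * pi / v)) * (of_real (gauss (1 / v) 0 \<xi>) * cis (\<xi> \<bullet> (z - a))))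
    = (LINT \<xi>|lborel. (complex_of_real (2 * pi / v)) * (of_real (gauss (1 / v) 0 \<xi>) * cis (\<xi> \<bullet> (z - a))))"
    by (rule integral_completion) measurable
  also have "\<dots> = of_real (2 * pi / v) * (cis (0 \<bullet> (z - a)) * of_real (exp (- (1 / v) * (norm (z - a))\<^sup>2 / 2)))"
    using v by (subst integral_mult_right_zero, subst fourier_gauss_lborel) auto
  also have "\<dots> / of_real ((2 * pi)\<^sup>2) = of_real (2 * pi / v * exp (- (1 / v) * (norm (z - a))\<^sup>2 / 2) / (2 * pi)\<^sup>2)" by simp
  also have "2 * pi / v * exp (- (1 / v) * (norm (z - a))\<^sup>2 / 2) / (2 * pi)\<^sup>2 = gauss v a z"
    using v by (simp add: gauss_def power2_eq_square field_simps)
  finally show ?thesis .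
qed

section \<open>Membership of the kernel in the Schwartz class\<close>

text \<open>Taylor's formula in one variable along the segment from z to z + h. The second
  derivative there is at most \<open>B * (|fst h| + |snd h|)^2\<close>, hence at most
  \<open>2 * B * (norm h)\<^sup>2\<close>, and the 2 cancels the 1/2 in the remainder.\<close>

lemma taylor2_bound:
  fixes D :: "nat \<Rightarrow> nat \<Rightarrow> real \<times> real \<Rightarrow> real"
  assumes D: "\<And>i j z. (D i j has_derivative (\<lambda>h. fst h * D (Suc i) j z + snd h * D i (Suc j) z)) (at z)"
    and b: "\<And>z. \<bar>D (Suc (Suc i)) j z\<bar> \<le> B" "\<And>z. \<bar>D (Suc i) (Suc j) z\<bar> \<le> B" "\<And>z. \<bar>D i (Suc (Suc j)) z\<bar> \<le> B"
  shows "\<bar>D i j (z + h) - D i j z - (fst h * D (Suc i) j z + snd h * D i (Suc j) z)\<bar> \<le> B * (norm h)\<^sup>2"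
proof -
  define \<phi> where "\<phi> k l s = D k l (z + s *\<^sub>R h)" for k l s
  have der: "(\<phi> k l has_real_derivative fst h * \<phi> (Suc k) l s + snd h * \<phi> k (Suc l) s) (at s)" for k l s
  proof -
    have "((\<lambda>s. z + s *\<^sub>R h) has_derivative (\<lambda>r. r *\<^sub>R h)) (at s)"
      by (auto intro!: derivative_eq_intros)
    from has_derivative_compose[OF this D[of k l "z + s *\<^sub>R h"]]
    have "(\<phi> k l has_derivative (\<lambda>r. fst (r *\<^sub>R h) * D (Suc k) l (z + s *\<^sub>R h) + snd (r *\<^sub>R h) * D k (Suc l) (z + s *\<^sub>R h))) (at s)"
      unfolding \<phi>_def[abs_def] .
    then show ?thesis unfolding has_field_derivative_def \<phi>_def
      by (rule has_derivative_eq_rhs) (auto simp: algebra_simps)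
  qed
  define f1 f2 where "f1 s = fst h * \<phi> (Suc i) j s + snd h * \<phi> i (Suc j) s"
    and "f2 s = fst h * (fst h * \<phi> (Suc (Suc i)) j s + snd h * \<phi> (Suc i) (Suc j) s) + snd h * (fst h * \<phi> (Suc i) (Suc j) s + snd h * \<phi> i (Suc (Suc j)) s)" for s
  define d where "d m = (if m = 0 then \<phi> i j else if m = 1 then f1 else f2)" for m :: nat
  have "\<exists>t>0. t < 1 \<and> \<phi> i j 1 = (\<Sum>m<2. d m 0 / fact m * 1 ^ m) + d 2 t / fact 2 * 1 ^ 2"
  proof (rule Maclaurin)
    have 1: "(f1 has_real_derivative f2 s) (at s)" for s unfolding f1_def[abs_def] f2_def
      by (auto intro!: derivative_eq_intros der)
    show "\<forall>m t. m < 2 \<and> 0 \<le> t \<and> t \<le> 1 \<longrightarrow> (d m has_real_derivative d (Suc m) t) (at t)"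
    proof (intro allI impI)
      fix m :: nat and t :: real assume "m < 2 \<and> 0 \<le> t \<and> t \<le> 1"
      then have "m = 0 \<or> m = 1" by auto
      then show "(d m has_real_derivative d (Suc m) t) (at t)"
        using der[of i j t] 1[of t] by (auto simp: d_def f1_def)
    qed
  qed (auto simp: d_def)
  then obtain t where t: "\<phi> i j 1 = \<phi> i j 0 + f1 0 + f2 t / 2"
    by (auto simp: d_def numeral_2_eq_2)
  have "\<bar>f2 t\<bar> \<le> B * (\<bar>fst h\<bar> + \<bar>snd h\<bar>)\<^sup>2"
  proof -
    have bb: "\<bar>\<phi> (Suc (Suc i)) j t\<bar> \<le> B" "\<bar>\<phi> (Suc i) (Suc j) t\<bar> \<le> B" "\<bar>\<phi> i (Suc (Suc j)) t\<bar> \<le> B"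
      unfolding \<phi>_def using b by auto
    have "\<bar>f2 t\<bar> \<le> \<bar>fst h\<bar> * (\<bar>fst h\<bar> * \<bar>\<phi> (Suc (Suc i)) j t\<bar> + \<bar>snd h\<bar> * \<bar>\<phi> (Suc i) (Suc j) t\<bar>) + \<bar>snd h\<bar> * (\<bar>fst h\<bar> * \<bar>\<phi> (Suc i) (Suc j) t\<bar> + \<bar>snd h\<bar> * \<bar>\<phi> i (Suc (Suc j)) t\<bar>)"
      unfolding f2_def abs_mult[symmetric]
      by (intro order_trans[OF abs_triangle_ineq] add_mono order_trans[OF eq_refl[OF abs_mult]] mult_left_mono) (auto simp: abs_mult intro!: order_trans[OF abs_triangle_ineq])
    also have "\<dots> \<le> \<bar>fst h\<bar> * (\<bar>fst h\<bar> * B + \<bar>snd h\<bar> * B) + \<bar>snd h\<bar> * (\<bar>fst h\<bar> * B + \<bar>snd h\<bar> * B)"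
      by (intro add_mono mult_left_mono bb) auto
    also have "\<dots> = B * (\<bar>fst h\<bar> + \<bar>snd h\<bar>)\<^sup>2" by (simp add: power2_eq_square algebra_simps)
    finally show ?thesis .
  qed
  also have "\<dots> \<le> B * (2 * (norm h)\<^sup>2)"
  proof (rule mult_left_mono)
    have "0 \<le> (\<bar>fst h\<bar> - \<bar>snd h\<bar>)\<^sup>2" by simp
    then show "(\<bar>fst h\<bar> + \<bar>snd h\<bar>)\<^sup>2 \<le> 2 * (norm h)\<^sup>2"
      unfolding norm_prod_square by (simp add: power2_eq_square algebra_simps)
    show "0 \<le> B" using b(1)[of z] by linarith
  qed
  finally have "\<bar>f2 t\<bar> / 2 \<le> B * (norm h)\<^sup>2" by simp
  moreover have "D i j (z + h) - D i j z - (fst h * D (Suc i) j z + snd h * D i (Suc j) z) = f2 t / 2"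
    using t unfolding f1_def by (simp add: \<phi>_def)
  ultimately show ?thesis by simp
qed

text \<open>Differentiation under the integral sign needs no dominated convergence here: the second order
  Taylor remainder is integrable in the parameter and quadratic in the increment.\<close>

lemma schwartz_integral:
  fixes D :: "'u \<Rightarrow> nat \<Rightarrow> nat \<Rightarrow> real \<times> real \<Rightarrow> real"
  assumes meas: "\<And>i j z. (\<lambda>u. D u i j z) \<in> borel_measurable M"
    and D: "\<And>u i j z. (D u i j has_derivative (\<lambda>h. fst h * D u (Suc i) j z + snd h * D u i (Suc j) z)) (at z)"
    and decay: "\<And>i j N. \<exists>B. integrable M B \<and> (\<forall>u z. (1 + norm z) ^ N * \<bar>D u i j z\<bar> \<le> B u)"
  shows "schwartz (\<lambda>z. of_real (LINT u|M. D u 0 0 z))"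
proof -
  define E where "E i j z = (LINT u|M. D u i j z)" for i j z
  have int: "integrable M (\<lambda>u. D u i j z)" for i j z
  proof -
    obtain B where "integrable M B" "\<forall>u z. (1 + norm z) ^ 0 * \<bar>D u i j z\<bar> \<le> B u" using decay by blast
    then have "integrable M B" "\<And>u. norm (D u i j z) \<le> norm (B u)" by (auto intro: order_trans[OF _ abs_ge_self] simp del: split_paired_All)
    then show ?thesis by (intro Bochner_Integration.integrable_bound[OF _ meas]) auto
  qed
  have bnd: "\<exists>K. \<forall>z. (1 + norm z) ^ N * \<bar>E i j z\<bar> \<le> K" for i j N
  proof -
    obtain B where B: "integrable M B" "\<forall>u z. (1 + norm z) ^ N * \<bar>D u i j z\<bar> \<le> B u" using decay by blast
    have "(1 + norm z) ^ N * \<bar>E i j z\<bar> \<le> (LINT u|M. B u)" for z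
    proof -
      have "(1 + norm z) ^ N * \<bar>E i j z\<bar> \<le> (1 + norm z) ^ N * (LINT u|M. \<bar>D u i j z\<bar>)"
        unfolding E_def by (intro mult_left_mono integral_abs_bound) auto
      also have "\<dots> = (LINT u|M. (1 + norm z) ^ N * \<bar>D u i j z\<bar>)" by simp
      also have "\<dots> \<le> (LINT u|M. B u)"
        using B int by (intro integral_mono) (auto simp del: split_paired_All)
      finally show ?thesis .
    qed
    then show ?thesis by blast
  qed
  have der: "(E i j has_derivative (\<lambda>h. fst h * E (Suc i) j z + snd h * E i (Suc j) z)) (at z)" for i j z
  proof -
    obtain B1 where B1: "integrable M B1" "\<forall>u z. (1 + norm z) ^ 0 * \<bar>D u (Suc (Suc i)) j z\<bar> \<le> B1 u" using decay by blast
    obtain B2 where B2: "integrable M B2" "\<forall>u z. (1 + norm z) ^ 0 * \<bar>D u (Suc i) (Suc j) z\<bar> \<le> B2 u" using decay by blast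
    obtain B3 where B3: "integrable M B3" "\<forall>u z. (1 + norm z) ^ 0 * \<bar>D u i (Suc (Suc j)) z\<bar> \<le> B3 u" using decay by blast
    define B where "B u = \<bar>B1 u\<bar> + \<bar>B2 u\<bar> + \<bar>B3 u\<bar>" for u
    define K where "K = (LINT u|M. B u)"
    have B: "integrable M B" unfolding B_def using B1 B2 B3 by auto
    have K0: "K \<ge> 0" unfolding K_def B_def by (rule integral_nonneg_AE) auto
    let ?L = "\<lambda>h. fst h * E (Suc i) j z + snd h * E i (Suc j) z"
    have rem: "\<bar>E i j (z + h) - E i j z - ?L h\<bar> \<le> K * (norm h)\<^sup>2" for h
    proof -
      let ?r = "\<lambda>u. D u i j (z + h) - D u i j z - (fst h * D u (Suc i) j z + snd h * D u i (Suc j) z)"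
      have r: "integrable M ?r" using int by auto
      have "E i j (z + h) - E i j z - ?L h = (LINT u|M. ?r u)"
        unfolding E_def using int by simp
      also have "\<bar>\<dots>\<bar> \<le> (LINT u|M. \<bar>?r u\<bar>)" by (rule integral_abs_bound)
      also have "\<dots> \<le> (LINT u|M. B u * (norm h)\<^sup>2)"
      proof (rule integral_mono)
        fix u
        show "\<bar>?r u\<bar> \<le> B u * (norm h)\<^sup>2"
        proof (rule taylor2_bound[where D = "D u", OF D])
          fix z :: "real \<times> real"
          show "\<bar>D u (Suc (Suc i)) j z\<bar> \<le> B u" using B1(2)[rule_format, of z u] by (simp add: B_def)
          show "\<bar>D u (Suc i) (Suc j) z\<bar> \<le> B u" using B2(2)[rule_format, of z u] by (simp add: B_def)
          show "\<bar>D u i (Suc (Suc j)) z\<bar> \<le> B u" using B3(2)[rule_format, of z u] by (simp add: B_def)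
        qed
      qed (use r B in auto)
      also have "\<dots> = K * (norm h)\<^sup>2" by (simp add: K_def)
      finally show ?thesis .
    qed
    show ?thesis unfolding has_derivative_at
    proof
      have "linear ?L" by (intro linearI) (auto simp: algebra_simps)
      then show "bounded_linear ?L" by (simp add: linear_conv_bounded_linear)
      show "(\<lambda>h. norm (E i j (z + h) - E i j z - ?L h) / norm h) \<midarrow>0\<rightarrow> 0"
      proof (rule Lim_null_comparison)
        show "\<forall>\<^sub>F h in at 0. norm (norm (E i j (z + h) - E i j z - ?L h) / norm h) \<le> K * norm h"
        proof (intro eventually_at_filter[THEN iffD2] always_eventually allI impI)
          fix h :: "real \<times> real" assume "h \<noteq> 0"
          then have "norm (E i j (z + h) - E i j z - ?L h) / norm h \<le> K * (norm h)\<^sup>2 / norm h"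
            using rem[of h] by (intro divide_right_mono) auto
          then show "norm (norm (E i j (z + h) - E i j z - ?L h) / norm h) \<le> K * norm h"
            using \<open>h \<noteq> 0\<close> by (simp add: power2_eq_square)
        qed
        show "((\<lambda>h. K * norm h) \<longlongrightarrow> 0) (at (0 :: real \<times> real))"
          by (intro tendsto_eq_intros) auto
      qed
    qed
  qed
  show ?thesis unfolding schwartz_def
  proof (intro exI[of _ "\<lambda>i j z. complex_of_real (E i j z)"] conjI allI)
    show "(\<lambda>z. complex_of_real (E 0 0 z)) = (\<lambda>z. complex_of_real (LINT u|M. D u 0 0 z))"
      by (simp add: E_def)
    fix i j z
    have "((\<lambda>z. complex_of_real (E i j z)) has_derivative (\<lambda>h. complex_of_real (fst h * E (Suc i) j z + snd h * E i (Suc j) z))) (at z)"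
      by (rule has_derivative_of_real[OF der])
    then show "((\<lambda>z. complex_of_real (E i j z)) has_derivative (\<lambda>h. fst h *\<^sub>R complex_of_real (E (Suc i) j z) + snd h *\<^sub>R complex_of_real (E i (Suc j) z))) (at z)"
      by (rule has_derivative_eq_rhs) (auto simp: scaleR_conv_of_real)
    fix N
    obtain K where "\<forall>z. (1 + norm z) ^ N * \<bar>E i j z\<bar> \<le> K" using bnd by blast
    then show "bounded (range (\<lambda>z. (1 + norm z) ^ N *\<^sub>R complex_of_real (E i j z)))"
      by (intro boundedI[where B = K]) (auto simp: abs_mult)
  qed
qed

text \<open>\<open>hermite c i x * exp (- c * x\<^sup>2 / 2)\<close> is the derivative of order \<open>i\<close> of
  \<open>exp (- c * x\<^sup>2 / 2)\<close>.\<close>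

fun hermite :: "real \<Rightarrow> nat \<Rightarrow> real \<Rightarrow> real" where
  "hermite c 0 x = 1"
| "hermite c (Suc 0) x = - c * x"
| "hermite c (Suc (Suc i)) x = - c * (x * hermite c (Suc i) x + real (Suc i) * hermite c i x)"

text \<open>At i = 0 the truncated index \<open>i - 1\<close> does no harm, because its coefficient
  \<open>real i\<close> vanishes.\<close>

lemma hermite_Suc: "hermite c (Suc i) x = - c * (x * hermite c i x + real i * hermite c (i - 1) x)"
  by (cases i) auto

text \<open>The Appell property of Hermite polynomials. With it, the product rule for
  \<open>hermite c i x * exp (- c * x\<^sup>2 / 2)\<close> reproduces the recursion that raises the
  index by one.\<close>

lemma has_derivative_hermite:
  "(hermite c i has_real_derivative - c * real i * hermite c (i - 1) x) (at x)"
proof (induction i rule: less_induct)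
  case (less i)
  consider "i = 0" | "i = 1" | j where "i = Suc (Suc j)" by (metis One_nat_def not0_implies_Suc)
  then show ?case
  proof cases
    case 1 then have "hermite c i = (\<lambda>x. 1)" by auto
    with 1 show ?thesis by simp
  next
    case 2 then have e: "hermite c i = (\<lambda>x. - c * x)" by auto
    show ?thesis unfolding e using 2 by (auto intro!: derivative_eq_intros)
  next
    case (3 j)
    have e: "hermite c i = (\<lambda>x. - c * (x * hermite c (Suc j) x + real (Suc j) * hermite c j x))" using 3 by auto
    have "(hermite c (Suc j) has_real_derivative - c * real (Suc j) * hermite c j x) (at x)"
      "(hermite c j has_real_derivative - c * real j * hermite c (j - 1) x) (at x)"
      using less[of "Suc j"] less[of j] 3 by auto
    then have "(hermite c i has_real_derivative - c * (1 * hermite c (Suc j) x + x * (- c * real (Suc j) * hermite c j x) + real (Suc j) * (- c * real j * hermite c (j - 1) x))) (at x)"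
      unfolding e by (auto intro!: derivative_eq_intros)
    moreover have "x * (- c * real (Suc j) * hermite c j x) + real (Suc j) * (- c * real j * hermite c (j - 1) x) = real (Suc j) * hermite c (Suc j) x"
      unfolding hermite_Suc by (simp add: algebra_simps)
    ultimately have "(hermite c i has_real_derivative - c * (1 * hermite c (Suc j) x + real (Suc j) * hermite c (Suc j) x)) (at x)"
      by (simp only: add.assoc)
    then show ?thesis using 3 by (simp add: algebra_simps del: hermite.simps)
  qed
qed

text \<open>Uniformity in c is the point: c will be the reciprocal of a variance that is at least v
  and otherwise arbitrary, so it ranges over (0, 1/v].\<close>

lemma hermite_bound:
  assumes "0 \<le> C"
  shows "\<exists>A\<ge>0. \<forall>c x. 0 \<le> c \<longrightarrow> c \<le> C \<longrightarrow> \<bar>hermite c i x\<bar> \<le> A * (1 + \<bar>x\<bar>) ^ i"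
proof (induction i rule: less_induct)
  case (less i)
  show ?case
  proof (cases i)
    case 0 then show ?thesis by (intro exI[of _ 1]) auto
  next
    case (Suc j)
    obtain A where A: "A \<ge> 0" "\<And>c x. 0 \<le> c \<Longrightarrow> c \<le> C \<Longrightarrow> \<bar>hermite c j x\<bar> \<le> A * (1 + \<bar>x\<bar>) ^ j"
      using less[of j] Suc by auto
    obtain A' where A': "A' \<ge> 0" "\<And>c x. 0 \<le> c \<Longrightarrow> c \<le> C \<Longrightarrow> \<bar>hermite c (j - 1) x\<bar> \<le> A' * (1 + \<bar>x\<bar>) ^ (j - 1)"
      using less[of "j - 1"] Suc by (metis Suc_pred' diff_le_self le_imp_less_Suc)
    show ?thesis
    proof (intro exI[of _ "C * (A + real j * A')"] conjI allI impI)
      show "0 \<le> C * (A + real j * A')" using assms A A' by auto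
      fix c x :: real assume c: "0 \<le> c" "c \<le> C"
      have "\<bar>hermite c i x\<bar> = c * \<bar>x * hermite c j x + real j * hermite c (j - 1) x\<bar>"
        unfolding Suc hermite_Suc[of c j] using c by (simp add: abs_mult)
      also have "\<dots> \<le> C * (A * (1 + \<bar>x\<bar>) ^ i + real j * (A' * (1 + \<bar>x\<bar>) ^ i))"
      proof (intro mult_mono c)
        have "\<bar>x * hermite c j x + real j * hermite c (j - 1) x\<bar> \<le> \<bar>x\<bar> * \<bar>hermite c j x\<bar> + real j * \<bar>hermite c (j - 1) x\<bar>"
          by (rule order_trans[OF abs_triangle_ineq]) (simp add: abs_mult)
        also have "\<dots> \<le> (1 + \<bar>x\<bar>) * (A * (1 + \<bar>x\<bar>) ^ j) + real j * (A' * (1 + \<bar>x\<bar>) ^ i)"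
        proof (intro add_mono mult_mono order_refl)
          show "\<bar>hermite c j x\<bar> \<le> A * (1 + \<bar>x\<bar>) ^ j" using A c by auto
          have "\<bar>hermite c (j - 1) x\<bar> \<le> A' * (1 + \<bar>x\<bar>) ^ (j - 1)" using A' c by auto
          also have "\<dots> \<le> A' * (1 + \<bar>x\<bar>) ^ i" using A' Suc by (intro mult_left_mono power_increasing) auto
          finally show "\<bar>hermite c (j - 1) x\<bar> \<le> A' * (1 + \<bar>x\<bar>) ^ i" .
        qed auto
        finally show "\<bar>x * hermite c j x + real j * hermite c (j - 1) x\<bar> \<le> A * (1 + \<bar>x\<bar>) ^ i + real j * (A' * (1 + \<bar>x\<bar>) ^ i)"
          by (simp add: Suc mult_ac)
      qed (use assms in auto)
      finally show "\<bar>hermite c i x\<bar> \<le> C * (A + real j * A') * (1 + \<bar>x\<bar>) ^ i" by (simp add: algebra_simps)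
    qed
  qed
qed

definition gauss_deriv :: "nat \<Rightarrow> real \<Rightarrow> real \<Rightarrow> real" where
  "gauss_deriv i t x = hermite (1 / t) i x * exp (- x\<^sup>2 / (2 * t))"

lemma has_derivative_gauss_deriv:
  assumes "t \<noteq> 0"
  shows "(gauss_deriv i t has_real_derivative gauss_deriv (Suc i) t x) (at x)"
proof -
  have "((\<lambda>x. exp (- x\<^sup>2 / (2 * t))) has_real_derivative - (1 / t) * x * exp (- x\<^sup>2 / (2 * t))) (at x)"
    using assms by (auto intro!: derivative_eq_intros simp: field_simps power2_eq_square)
  from DERIV_mult[OF has_derivative_hermite[of "1 / t" i x] this]
  show ?thesis unfolding gauss_deriv_def[abs_def] hermite_Suc
    by (rule DERIV_cong) (simp add: algebra_simps)
qed

text \<open>A single term of the exponential series, \<open>y ^ N / fact N \<le> exp y\<close> with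
  \<open>y = x\<^sup>2 / (2 * t)\<close>, beats the power of x. The price is polynomial growth in t,
  which the moments of the Gamma distribution absorb.\<close>

lemma polynomial_times_gaussian_le:
  fixes x t :: real
  assumes t: "0 < t"
  shows "(1 + \<bar>x\<bar>) ^ N * exp (- x\<^sup>2 / (2 * t)) \<le> 4 ^ N * (1 + fact N * 2 ^ N) * (1 + t) ^ N"
proof -
  let ?e = "exp (- x\<^sup>2 / (2 * t))"
  have "(1 + \<bar>x\<bar>) \<le> 2 * (1 + x\<^sup>2)"
  proof -
    have "0 \<le> (\<bar>x\<bar> - 1)\<^sup>2" by simp
    then have "2 * \<bar>x\<bar> \<le> x\<^sup>2 + 1" by (simp add: power2_diff)
    moreover have "0 \<le> x\<^sup>2" by simp
    ultimately have "\<bar>x\<bar> \<le> 1 + 2 * x\<^sup>2" by argo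
    then show ?thesis by simp
  qed
  then have "(1 + \<bar>x\<bar>) ^ N \<le> (2 * (1 + x\<^sup>2)) ^ N" by (intro power_mono) auto
  also have "\<dots> \<le> 2 ^ N * (2 ^ N * (1 + (x\<^sup>2) ^ N))"
  proof -
    have "(1 + x\<^sup>2) ^ N \<le> (2 * max 1 (x\<^sup>2)) ^ N" by (intro power_mono) auto
    also have "\<dots> = 2 ^ N * max 1 (x\<^sup>2) ^ N" by (simp add: power_mult_distrib)
    also have "max 1 (x\<^sup>2) ^ N \<le> 1 + (x\<^sup>2) ^ N" by (simp add: max_def)
    finally have "(1 + x\<^sup>2) ^ N \<le> 2 ^ N * (1 + (x\<^sup>2) ^ N)" by simp
    then show ?thesis unfolding power_mult_distrib by (rule mult_left_mono) simp
  qed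
  finally have 1: "(1 + \<bar>x\<bar>) ^ N \<le> 4 ^ N * (1 + (x\<^sup>2) ^ N)"
    by (simp add: power_mult_distrib[symmetric] mult.assoc[symmetric])
  have 2: "(x\<^sup>2) ^ N * ?e \<le> fact N * 2 ^ N * t ^ N"
  proof -
    have "(x\<^sup>2 / (2 * t)) ^ N / fact N \<le> exp (x\<^sup>2 / (2 * t))"
    proof -
      define y where "y = x\<^sup>2 / (2 * t)"
      have y: "y \<ge> 0" using t by (simp add: y_def)
      have s: "(\<lambda>n. y ^ n / fact n) sums exp y" using exp_converges[of y] by (simp add: divide_inverse mult.commute)
      have "(\<Sum>n\<in>{N}. y ^ n / fact n) \<le> (\<Sum>n. y ^ n / fact n)"
        using y by (intro sum_le_suminf sums_summable[OF s]) auto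
      then show ?thesis using sums_unique[OF s] by (simp add: y_def)
    qed
    then show ?thesis using t by (simp add: exp_minus field_simps power_divide power_mult_distrib)
  qed
  have "(1 + \<bar>x\<bar>) ^ N * ?e \<le> 4 ^ N * (1 + (x\<^sup>2) ^ N) * ?e" by (rule mult_right_mono[OF 1]) auto
  also have "\<dots> = 4 ^ N * (?e + (x\<^sup>2) ^ N * ?e)" by (simp add: algebra_simps)
  also have "\<dots> \<le> 4 ^ N * (1 + fact N * 2 ^ N * t ^ N)" using t by (intro mult_left_mono add_mono 2) auto
  also have "\<dots> \<le> 4 ^ N * ((1 + t) ^ N + fact N * 2 ^ N * (1 + t) ^ N)"
    using t by (intro mult_left_mono add_mono power_mono one_le_power) auto
  finally show ?thesis by (simp add: algebra_simps)
qed

lemma gauss_deriv_decay: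
  assumes v: "0 < v"
  shows "\<exists>B\<ge>0. \<forall>t x. v \<le> t \<longrightarrow> (1 + \<bar>x\<bar>) ^ N * \<bar>gauss_deriv i t x\<bar> \<le> B * (1 + t) ^ (N + i)"
proof -
  obtain A where A: "A \<ge> 0" "\<And>c x. 0 \<le> c \<Longrightarrow> c \<le> 1 / v \<Longrightarrow> \<bar>hermite c i x\<bar> \<le> A * (1 + \<bar>x\<bar>) ^ i"
    using hermite_bound[of "1 / v" i] v by auto
  let ?K = "4 ^ (N + i) * (1 + fact (N + i) * 2 ^ (N + i)) :: real"
  show ?thesis
  proof (intro exI[of _ "A * ?K"] conjI allI impI)
    show "0 \<le> A * ?K" using A by auto
    fix t x :: real assume t: "v \<le> t"
    have "\<bar>hermite (1 / t) i x\<bar> \<le> A * (1 + \<bar>x\<bar>) ^ i" using A(2)[of "1 / t" x] v t by (simp add: frac_le)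
    then have "(1 + \<bar>x\<bar>) ^ N * \<bar>gauss_deriv i t x\<bar> \<le> (1 + \<bar>x\<bar>) ^ N * (A * (1 + \<bar>x\<bar>) ^ i * exp (- x\<^sup>2 / (2 * t)))"
      unfolding gauss_deriv_def abs_mult by (intro mult_left_mono mult_mono) auto
    also have "\<dots> = A * ((1 + \<bar>x\<bar>) ^ (N + i) * exp (- x\<^sup>2 / (2 * t)))" by (simp add: power_add)
    also have "\<dots> \<le> A * (?K * (1 + t) ^ (N + i))"
      using v t A by (intro mult_left_mono polynomial_times_gaussian_le) auto
    finally show "(1 + \<bar>x\<bar>) ^ N * \<bar>gauss_deriv i t x\<bar> \<le> A * ?K * (1 + t) ^ (N + i)" by simp
  qed
qed

text \<open>All variances in the mixture are at least v, which keeps every derivative bounded near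
  a; for s \<le> 2 the Bessel kernel itself, the case v = 0, is unbounded there. For large variances
  the bounds grow polynomially in u, and the Gamma distribution has all moments.\<close>

lemma schwartz_bessel_kernel:
  assumes a: "0 < \<alpha>" and v: "0 < v"
  shows "schwartz (\<lambda>z. of_real (bessel_kernel \<alpha> v a z))"
proof -
  interpret prob_space "gamma_measure \<alpha>" by (rule prob_space_gamma_measure[OF a])
  let ?t = "\<lambda>u. v + 2 * \<bar>u\<bar>"
  define D where "D u i j z = gauss_deriv i (?t u) (fst z - fst a) * gauss_deriv j (?t u) (snd z - snd a) / (2 * pi * ?t u)"
    for u :: real and i j and z :: "real \<times> real"
  have D0: "D u 0 0 z = gauss (?t u) a z" for u z
    unfolding D_def gauss_deriv_def gauss_def norm_prod_square
    by (simp add: exp_add[symmetric] add_divide_distrib diff_divide_distrib)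
  have pos: "?t u > 0" for u :: real using v by linarith
  have "schwartz (\<lambda>z. of_real (LINT u|gamma_measure \<alpha>. D u 0 0 z))"
  proof (rule schwartz_integral[of D])
    fix i j and z :: "real \<times> real"
    have [measurable]: "(\<lambda>u. hermite (1 / ?t u) i x) \<in> borel_measurable borel" for i x
      by (induction i rule: induct_nat_012) auto
    show "(\<lambda>u. D u i j z) \<in> borel_measurable (gamma_measure \<alpha>)"
      unfolding D_def gauss_deriv_def by measurable
  next
    fix u :: real and i j and z :: "real \<times> real"
    have 1: "((\<lambda>z. gauss_deriv i (?t u) (fst z - fst a)) has_derivative (\<lambda>h. fst h * gauss_deriv (Suc i) (?t u) (fst z - fst a))) (at z)" for i
    proof -
      have "((\<lambda>z. fst z - fst a) has_derivative fst) (at z)" by (auto intro!: derivative_eq_intros)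
      from DERIV_compose_FDERIV[OF has_derivative_gauss_deriv this, OF less_imp_neq[OF pos, symmetric]]
      show ?thesis by simp
    qed
    have 2: "((\<lambda>z. gauss_deriv i (?t u) (snd z - snd a)) has_derivative (\<lambda>h. snd h * gauss_deriv (Suc i) (?t u) (snd z - snd a))) (at z)" for i
    proof -
      have "((\<lambda>z. snd z - snd a) has_derivative snd) (at z)" by (auto intro!: derivative_eq_intros)
      from DERIV_compose_FDERIV[OF has_derivative_gauss_deriv this, OF less_imp_neq[OF pos, symmetric]]
      show ?thesis by simp
    qed
    have "((\<lambda>z. gauss_deriv i (?t u) (fst z - fst a) * gauss_deriv j (?t u) (snd z - snd a) * (1 / (2 * pi * ?t u))) has_derivative
      (\<lambda>h. (gauss_deriv i (?t u) (fst z - fst a) * (snd h * gauss_deriv (Suc j) (?t u) (snd z - snd a)) + (fst h * gauss_deriv (Suc i) (?t u) (fst z - fst a)) * gauss_deriv j (?t u) (snd z - snd a)) * (1 / (2 * pi * ?t u)))) (at z)"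
      by (rule has_derivative_mult_left[OF has_derivative_mult[OF 1 2]])
    then show "(D u i j has_derivative (\<lambda>h. fst h * D u (Suc i) j z + snd h * D u i (Suc j) z)) (at z)"
      unfolding D_def[abs_def] times_divide_eq_right mult_1_right
      by (rule has_derivative_eq_rhs) (auto simp: add_divide_distrib distrib_right mult_ac)
  next
    fix i j N
    obtain B where B: "B \<ge> 0" "\<And>t x. v \<le> t \<Longrightarrow> (1 + \<bar>x\<bar>) ^ N * \<bar>gauss_deriv i t x\<bar> \<le> B * (1 + t) ^ (N + i)"
      using gauss_deriv_decay[OF v] by blast
    obtain B' where B': "B' \<ge> 0" "\<And>t x. v \<le> t \<Longrightarrow> (1 + \<bar>x\<bar>) ^ N * \<bar>gauss_deriv j t x\<bar> \<le> B' * (1 + t) ^ (N + j)"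
      using gauss_deriv_decay[OF v] by blast
    let ?n = "(N + i) + (N + j)"
    let ?B = "\<lambda>u. (1 + norm a) ^ N * (B * B') / (2 * pi * v) * ((1 + v) + 2 * \<bar>u\<bar>) ^ ?n"
    have "integrable (gamma_measure \<alpha>) ?B"
    proof (intro integrable_mult_right)
      have "integrable (gamma_measure \<alpha>) (\<lambda>u. ((1 + v) + 2 * u) ^ ?n)"
        using v by (intro integrable_gamma_measure_power a) auto
      then show "integrable (gamma_measure \<alpha>) (\<lambda>u. ((1 + v) + 2 * \<bar>u\<bar>) ^ ?n)"
        by (rule integrable_cong_AE_imp) (auto intro!: AE_mp[OF AE_gamma_measure_pos[of \<alpha>] AE_I2])
    qed
    moreover have "(1 + norm z) ^ N * \<bar>D u i j z\<bar> \<le> ?B u" for u z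
    proof -
      let ?x = "fst z - fst a" and ?y = "snd z - snd a"
      have t: "v \<le> ?t u" by simp
      \<comment> \<open>Splits the weight into one factor for each variable, so that the
        one-dimensional decay can be applied to each.\<close>
      have "1 + norm z \<le> (1 + norm a) * ((1 + \<bar>?x\<bar>) * (1 + \<bar>?y\<bar>))"
      proof -
        have "norm z \<le> norm a + norm (z - a)" using norm_triangle_ineq[of a "z - a"] by simp
        also have "norm (z - a) \<le> \<bar>?x\<bar> + \<bar>?y\<bar>"
          by (cases z, cases a) (auto simp: norm_Pair intro: sqrt_sum_squares_le_sum_abs)
        finally have "1 + norm z \<le> 1 + norm a + (\<bar>?x\<bar> + \<bar>?y\<bar>)" by simp
        also have "\<dots> \<le> (1 + norm a) * (1 + (\<bar>?x\<bar> + \<bar>?y\<bar>))" by (simp add: algebra_simps)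
        also have "\<dots> \<le> (1 + norm a) * ((1 + \<bar>?x\<bar>) * (1 + \<bar>?y\<bar>))"
          by (intro mult_left_mono) (auto simp: algebra_simps)
        finally show ?thesis .
      qed
      then have "(1 + norm z) ^ N \<le> ((1 + norm a) * ((1 + \<bar>?x\<bar>) * (1 + \<bar>?y\<bar>))) ^ N" by (intro power_mono) auto
      then have "(1 + norm z) ^ N * \<bar>D u i j z\<bar> \<le> ((1 + norm a) * ((1 + \<bar>?x\<bar>) * (1 + \<bar>?y\<bar>))) ^ N * \<bar>D u i j z\<bar>"
        by (intro mult_right_mono) auto
      also have "\<dots> = (1 + norm a) ^ N * (((1 + \<bar>?x\<bar>) ^ N * \<bar>gauss_deriv i (?t u) ?x\<bar>) * ((1 + \<bar>?y\<bar>) ^ N * \<bar>gauss_deriv j (?t u) ?y\<bar>)) / (2 * pi * ?t u)"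
        unfolding D_def using pos[of u] by (simp add: abs_mult power_mult_distrib)
      also have "\<dots> \<le> (1 + norm a) ^ N * ((B * (1 + ?t u) ^ (N + i)) * (B' * (1 + ?t u) ^ (N + j))) / (2 * pi * v)"
        using v B B' t by (intro frac_le mult_left_mono mult_mono B(2) B'(2)) auto
      also have "\<dots> = ?B u" by (simp add: power_add add.assoc)
      finally show ?thesis .
    qed
    ultimately show "\<exists>B. integrable (gamma_measure \<alpha>) B \<and> (\<forall>u z. (1 + norm z) ^ N * \<bar>D u i j z\<bar> \<le> B u)"
      by blast
  qed
  then show ?thesis unfolding D0 bessel_kernel_def .
qed

text \<open>The one place where the definition of \<open>has_bessel_derivative\<close> is opened.
  Read as an identity between functions of a, it says that the Gaussian regularisation of F is the
  regularised Bessel potential of f.\<close>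

lemma integral_bessel_derivative_gauss:
  assumes s: "0 < s" and v: "0 < v" and f: "has_bessel_derivative s F f"
  shows "(LINT z|lebesgue. f z * of_real (bessel_kernel (s / 2) v a z)) = (LINT z|lebesgue. F z * of_real (gauss v a z))"
  using f schwartz_bessel_kernel[of "s / 2" v a] s v unfolding has_bessel_derivative_def
  by (simp add: bessel_op_bessel_kernel)

section \<open>Bounded functions belong to product BMO\<close>

text \<open>The integral of the squared distance from G to its projection P is nonnegative. Finite
  families are enough, because an infinite sum of nonnegative terms is the supremum of its finite
  partial sums.\<close>

lemma Bessel_inequality:
  fixes e :: "'i \<Rightarrow> 'a \<Rightarrow> real" and G :: "'a \<Rightarrow> complex"
  assumes S: "finite S"
    and G2: "integrable M (\<lambda>x. (cmod (G x))\<^sup>2)"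
    and Ge: "\<And>i. i \<in> S \<Longrightarrow> integrable M (\<lambda>x. G x * of_real (e i x))"
    and ee: "\<And>i j. i \<in> S \<Longrightarrow> j \<in> S \<Longrightarrow> integrable M (\<lambda>x. e i x * e j x)"
    and orth: "\<And>i j. i \<in> S \<Longrightarrow> j \<in> S \<Longrightarrow> (LINT x|M. e i x * e j x) = (if i = j then 1 else 0)"
  shows "(\<Sum>i\<in>S. (cmod (LINT x|M. G x * of_real (e i x)))\<^sup>2) \<le> (LINT x|M. (cmod (G x))\<^sup>2)"
proof -
  define c where "c i = (LINT x|M. G x * of_real (e i x))" for i
  define P where "P x = (\<Sum>i\<in>S. c i * of_real (e i x))" for x
  have expand: "(cmod (G x - P x))\<^sup>2 = (cmod (G x))\<^sup>2 - 2 * (\<Sum>i\<in>S. Re (cnj (c i) * (G x * of_real (e i x))))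
     + (\<Sum>i\<in>S. \<Sum>j\<in>S. Re (c i * cnj (c j)) * (e i x * e j x))" for x
  proof -
    have 1: "(cmod (G x - P x))\<^sup>2 = (cmod (G x))\<^sup>2 - 2 * Re (G x * cnj (P x)) + Re (P x * cnj (P x))"
      unfolding cmod_power2 by (simp add: power2_eq_square algebra_simps)
    have 2: "G x * cnj (P x) = (\<Sum>i\<in>S. cnj (c i) * (G x * of_real (e i x)))"
      unfolding P_def by (simp add: sum_distrib_left mult_ac)
    have 3: "P x * cnj (P x) = (\<Sum>i\<in>S. \<Sum>j\<in>S. (c i * cnj (c j)) * of_real (e i x * e j x))"
      unfolding P_def by (simp add: sum_product mult_ac)
    have 4: "Re (z * of_real r) = Re z * r" for z r by simp
    show ?thesis unfolding 1 2 3 Re_sum 4 ..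
  qed
  have i1: "integrable M (\<lambda>x. Re (cnj (c i) * (G x * of_real (e i x))))" if "i \<in> S" for i
    using Ge[OF that] by (intro integrable_Re integrable_mult_right) auto
  have i2: "integrable M (\<lambda>x. Re (c i * cnj (c j)) * (e i x * e j x))" if "i \<in> S" "j \<in> S" for i j
    using ee[OF that] by (intro integrable_mult_right) auto
  have "0 \<le> (LINT x|M. (cmod (G x - P x))\<^sup>2)" by (rule integral_nonneg_AE) auto
  also have "\<dots> = (LINT x|M. (cmod (G x))\<^sup>2) - 2 * (\<Sum>i\<in>S. LINT x|M. Re (cnj (c i) * (G x * of_real (e i x))))
     + (\<Sum>i\<in>S. \<Sum>j\<in>S. LINT x|M. Re (c i * cnj (c j)) * (e i x * e j x))"
    unfolding expand using G2 i1 i2 by (simp add: Bochner_Integration.integral_sum Bochner_Integration.integrable_sum)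
  also have "(\<Sum>i\<in>S. LINT x|M. Re (cnj (c i) * (G x * of_real (e i x)))) = (\<Sum>i\<in>S. (cmod (c i))\<^sup>2)"
  proof (intro sum.cong refl)
    fix i assume i: "i \<in> S"
    have "(LINT x|M. Re (cnj (c i) * (G x * of_real (e i x)))) = Re (LINT x|M. cnj (c i) * (G x * of_real (e i x)))"
      using Ge[OF i] by (intro integral_Re integrable_mult_right) auto
    also have "\<dots> = Re (cnj (c i) * c i)" by (simp add: c_def)
    also have "\<dots> = (cmod (c i))\<^sup>2" by (simp add: cmod_power2) (simp add: power2_eq_square)
    finally show "(LINT x|M. Re (cnj (c i) * (G x * of_real (e i x)))) = (cmod (c i))\<^sup>2" .
  qed
  also have "(\<Sum>i\<in>S. \<Sum>j\<in>S. LINT x|M. Re (c i * cnj (c j)) * (e i x * e j x)) = (\<Sum>i\<in>S. (cmod (c i))\<^sup>2)"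
  proof (intro sum.cong refl)
    fix i assume i: "i \<in> S"
    have "(\<Sum>j\<in>S. LINT x|M. Re (c i * cnj (c j)) * (e i x * e j x)) = (\<Sum>j\<in>S. if i = j then Re (c i * cnj (c j)) else 0)"
      using i by (intro sum.cong refl) (simp add: orth)
    also have "\<dots> = Re (c i * cnj (c i))" using S i by simp
    also have "\<dots> = (cmod (c i))\<^sup>2" by (simp add: cmod_power2) (simp add: power2_eq_square)
    finally show "(\<Sum>j\<in>S. LINT x|M. Re (c i * cnj (c j)) * (e i x * e j x)) = (cmod (c i))\<^sup>2" .
  qed
  finally show ?thesis unfolding c_def by simp
qed

section \<open>Orthonormality of Haar systems on nested grids\<close>

lemma borel_measurable_haar[measurable]: "haar I \<in> borel_measurable borel"
  unfolding haar_def[abs_def] Let_def by measurable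

lemma abs_haar_le:
  assumes "a < b" shows "\<bar>haar {a..<b} x\<bar> \<le> indicator {a..<b} x / sqrt (b - a)"
  using assms unfolding haar_atLeastLessThan[OF assms] by (auto simp: indicator_def field_simps)

lemma abs_haar_le_sup:
  assumes "a < b" shows "\<bar>haar {a..<b} x\<bar> \<le> 1 / sqrt (b - a)"
  by (rule order_trans[OF abs_haar_le[OF assms]]) (use assms in \<open>auto simp: indicator_def\<close>)

lemma haar_halves:
  assumes "0 < p"
  shows "haar {a..<a + 2 * p} x = (indicator {a..<a + p} x - indicator {a + p..<a + 2 * p} x) / sqrt (2 * p)"
proof -
  have "(a + (a + 2 * p)) / 2 = a + p" by (simp add: field_simps)
  moreover have "a < a + 2 * p" using assms by simp
  ultimately show ?thesis by (simp only: haar_atLeastLessThan add_diff_cancel_left')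
qed

lemma haar_square:
  assumes "a < b" shows "(haar {a..<b} x)\<^sup>2 = indicator {a..<b} x / (b - a)"
  using assms unfolding haar_atLeastLessThan[OF assms] by (auto simp: indicator_def power_divide)

lemma integrable_haar: assumes "a < b" shows "integrable lborel (haar {a..<b})"
  and integral_haar: "(LINT x|lborel. haar {a..<b} x) = 0"
proof -
  have 1: "integrable lborel (indicator {c..<d} :: real \<Rightarrow> real)" for c d :: real
    by (rule integrable_real_indicator) (cases "c \<le> d"; simp)+
  have e: "haar {a..<b} = (\<lambda>x. (indicator {a ..< (a + b) / 2} x - indicator {(a + b) / 2 ..< b} x) / sqrt (b - a))"
    using haar_atLeastLessThan[OF assms] by auto
  show "integrable lborel (haar {a..<b})" unfolding e by (intro integrable_divide Bochner_Integration.integrable_diff 1)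
  have "(LINT x|lborel. haar {a..<b} x) = ((LINT x|lborel. indicator {a ..< (a + b) / 2} x) - (LINT x|lborel. indicator {(a + b) / 2 ..< b} x)) / sqrt (b - a)"
    unfolding e by (subst integral_divide_zero, subst Bochner_Integration.integral_diff[OF 1 1]) simp
  then show "(LINT x|lborel. haar {a..<b} x) = 0" using assms by (simp add: field_simps)
qed

text \<open>The condition on the shifts says that every interval of the grid is a half of another one.\<close>

definition grid_interval :: "(int \<Rightarrow> real) \<Rightarrow> int \<Rightarrow> int \<Rightarrow> real set" where
  "grid_interval \<sigma> k j = {\<sigma> k + 2 powi k * of_int j ..< \<sigma> k + 2 powi k * of_int j + 2 powi k}"

definition nested_shift :: "(int \<Rightarrow> real) \<Rightarrow> bool" where
  "nested_shift \<sigma> \<longleftrightarrow> (\<forall>k. \<exists>j. \<sigma> (k + 1) = \<sigma> k + 2 powi k * of_int j)"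

lemma power_int_2_Suc: "(2::real) powi (k + 1) = 2 * 2 powi k" "(2::real) powi (1 + k) = 2 * 2 powi k"
  by (simp_all add: power_int_add_1' add.commute[of 1 k])

lemma nested_shift_0: "nested_shift (\<lambda>_. 0)"
  unfolding nested_shift_def by (auto intro: exI[of _ 0])

text \<open>The thirds cancel between consecutive scales: from k to k + 1 the shift grows by exactly
  \<open>2 powi k\<close> if k is nonnegative and even, and stays the same otherwise.\<close>

lemma nested_shift_grid_shift: "nested_shift (grid_shift \<delta>0)"
  unfolding nested_shift_def
proof
  fix k :: int
  consider "k < 0" | "k = 0" | "k > 0" "even k" | "k > 0" "odd k" by linarith
  then show "\<exists>j. grid_shift \<delta>0 (k + 1) = grid_shift \<delta>0 k + 2 powi k * of_int j"
  proof cases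
    case 1 then show ?thesis by (intro exI[of _ 0]) (simp add: grid_shift_def)
  next
    case 2 then show ?thesis by (intro exI[of _ 1]) (simp add: grid_shift_def)
  next
    case 3 then show ?thesis by (intro exI[of _ 1]) (simp add: grid_shift_def power_int_2_Suc field_simps)
  next
    case 4 then show ?thesis by (intro exI[of _ 0]) (simp add: grid_shift_def power_int_2_Suc field_simps)
  qed
qed

lemma dyadic_interval_eq: "dyadic_interval k j = grid_interval (\<lambda>_. 0) k j"
  by (simp add: dyadic_interval_def grid_interval_def algebra_simps)

lemma dyadic_grid_eq: "dyadic_grid = {grid_interval (\<lambda>_. 0) k j |k j. True}"
  by (simp add: dyadic_grid_def dyadic_interval_eq)

lemma shifted_grid_eq: "shifted_grid \<delta>0 = {grid_interval (grid_shift \<delta>0) k j |k j. True}"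
proof -
  have "(+) (grid_shift \<delta>0 k) ` dyadic_interval k j = grid_interval (grid_shift \<delta>0) k j" for k j
    by (simp add: dyadic_interval_eq grid_interval_def image_add_atLeastLessThan algebra_simps)
  then show ?thesis by (simp add: shifted_grid_def)
qed

lemma grid_interval_disjoint:
  assumes "x \<in> grid_interval \<sigma> k i" "x \<in> grid_interval \<sigma> k j" shows "i = j"
proof -
  have p: "(2::real) powi k > 0" by simp
  have "2 powi k * real_of_int i < 2 powi k * (real_of_int j + 1)" "2 powi k * real_of_int j < 2 powi k * (real_of_int i + 1)"
    using assms unfolding grid_interval_def by (auto simp: distrib_left)
  then have "real_of_int i < of_int j + 1" "real_of_int j < of_int i + 1"
    using p by (simp_all only: mult_less_cancel_left_pos)
  then show ?thesis by linarith
qed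

lemma grid_interval_subset_parent:
  assumes "nested_shift \<sigma>"
  shows "\<exists>m. grid_interval \<sigma> k i \<subseteq> grid_interval \<sigma> (k + int n) m"
proof (induction n)
  case 0 then show ?case by auto
next
  case (Suc n)
  then obtain m where m: "grid_interval \<sigma> k i \<subseteq> grid_interval \<sigma> (k + int n) m" by auto
  let ?k = "k + int n"
  obtain j where j: "\<sigma> (?k + 1) = \<sigma> ?k + 2 powi ?k * of_int j" using assms unfolding nested_shift_def by blast
  \<comment> \<open>The index of the parent: after removal of the relative shift j, the children of
    q are \<open>2 * q\<close> and \<open>2 * q + 1\<close>.\<close>
  define q where "q = (m - j) div 2"
  have q: "m - j = 2 * q \<or> m - j = 2 * q + 1" unfolding q_def by presburger
  have "grid_interval \<sigma> ?k m \<subseteq> grid_interval \<sigma> (?k + 1) q"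
  proof -
    have p: "(2::real) powi ?k > 0" by simp
    have "real_of_int m = of_int j + 2 * of_int q \<or> real_of_int m = of_int j + 2 * of_int q + 1" using q by (auto simp: algebra_simps)
    then show ?thesis using p unfolding grid_interval_def power_int_2_Suc j
      by (auto simp: algebra_simps)
  qed
  moreover have "k + int (Suc n) = ?k + 1" by simp
  ultimately show ?case using m by (metis order_trans)
qed

text \<open>The halves of an interval belong to the grid one scale below. Hence a Haar function is
  constant on every interval of smaller scale, which is the source of orthogonality between
  scales.\<close>

lemma haar_grid_interval:
  assumes "nested_shift \<sigma>"
  shows "\<exists>q. \<forall>x. haar (grid_interval \<sigma> (k + 1) j) x =
    (indicator (grid_interval \<sigma> k q) x - indicator (grid_interval \<sigma> k (q + 1)) x) / sqrt (2 powi (k + 1))"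
proof -
  obtain i where i: "\<sigma> (k + 1) = \<sigma> k + 2 powi k * of_int i" using assms unfolding nested_shift_def by blast
  let ?a = "\<sigma> (k + 1) + 2 powi (k + 1) * real_of_int j" and ?p = "(2::real) powi k"
  have p: "?p > 0" by simp
  have "haar (grid_interval \<sigma> (k + 1) j) x = (indicator {?a ..< ?a + ?p} x - indicator {?a + ?p ..< ?a + 2 * ?p} x) / sqrt (2 * ?p)" for x
    using haar_halves[OF p, of ?a x] unfolding grid_interval_def power_int_2_Suc by simp
  moreover have "{?a ..< ?a + ?p} = grid_interval \<sigma> k (i + 2 * j)" "{?a + ?p ..< ?a + 2 * ?p} = grid_interval \<sigma> k (i + 2 * j + 1)"
    unfolding grid_interval_def i power_int_2_Suc by (auto simp: algebra_simps)
  ultimately show ?thesis by (intro exI[of _ "i + 2 * j"]) (simp add: power_int_2_Suc)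
qed

text \<open>The smaller interval lies in a single interval of scale l - 1, on which the larger Haar
  function is constant, and the smaller Haar function has integral 0.\<close>

lemma haar_grid_orthogonal_aux:
  assumes n: "nested_shift \<sigma>" and kl: "k < l"
  shows "(LINT x|lborel. haar (grid_interval \<sigma> k i) x * haar (grid_interval \<sigma> l j) x) = 0"
proof -
  have l: "l = (k + int (nat (l - 1 - k))) + 1" using kl by simp
  define l' where "l' = k + int (nat (l - 1 - k))"
  obtain m where m: "grid_interval \<sigma> k i \<subseteq> grid_interval \<sigma> l' m"
    using grid_interval_subset_parent[OF n] unfolding l'_def by blast
  obtain q where q: "\<And>x. haar (grid_interval \<sigma> l j) x = (indicator (grid_interval \<sigma> l' q) x - indicator (grid_interval \<sigma> l' (q + 1)) x) / sqrt (2 powi l)"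
    using haar_grid_interval[OF n, of l' j] l unfolding l'_def[symmetric] by auto
  \<comment> \<open>The value of the larger Haar function on the ancestor m: signed if m is one of
    the two halves, and 0 if it is neither.\<close>
  define c where "c = (of_bool (m = q) - of_bool (m = q + 1)) / sqrt (2 powi l)"
  have "haar (grid_interval \<sigma> k i) x * haar (grid_interval \<sigma> l j) x = c * haar (grid_interval \<sigma> k i) x" for x
  proof (cases "x \<in> grid_interval \<sigma> k i")
    case True
    then have "x \<in> grid_interval \<sigma> l' r \<longleftrightarrow> m = r" for r using m grid_interval_disjoint[of x \<sigma> l' m r] by auto
    then show ?thesis unfolding q c_def by (simp add: indicator_def)
  next
    case False
    then have "haar (grid_interval \<sigma> k i) x = 0"
      using abs_haar_le[of "\<sigma> k + 2 powi k * of_int i" "\<sigma> k + 2 powi k * of_int i + 2 powi k" x] unfolding grid_interval_def by auto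
    then show ?thesis by simp
  qed
  moreover have "(LINT x|lborel. haar (grid_interval \<sigma> k i) x) = 0"
    unfolding grid_interval_def by (rule integral_haar) simp
  ultimately show ?thesis by (simp only: integral_mult_right_zero mult_zero_right)
qed

text \<open>Haar functions are indexed by sets, not by scale and position. Injectivity lets a case
  distinction on the indices decide whether two intervals are equal.\<close>

lemma grid_interval_inject:
  assumes "grid_interval \<sigma> k i = grid_interval \<sigma> l j" shows "k = l \<and> i = j"
proof -
  have "Sup (grid_interval \<sigma> k i) - Inf (grid_interval \<sigma> k i) = 2 powi k" for k i by (simp add: grid_interval_def)
  then have "(2::real) powi k = 2 powi l" using assms by metis
  then have kl: "k = l" 
    using power_int_strict_increasing[of k l "2::real"] power_int_strict_increasing[of l k "2::real"] by (metis less_irrefl linorder_neqE one_less_numeral_iff semiring_norm(76))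
  have "Inf (grid_interval \<sigma> k i) \<in> grid_interval \<sigma> k i" by (simp add: grid_interval_def)
  then show ?thesis using kl assms grid_interval_disjoint by metis
qed

lemma haar_grid_orthonormal:
  assumes n: "nested_shift \<sigma>" and I: "I = grid_interval \<sigma> k i" and J: "J = grid_interval \<sigma> l j"
  shows "integrable lborel (\<lambda>x. haar I x * haar J x)"
    and "(LINT x|lborel. haar I x * haar J x) = (if I = J then 1 else 0)"
proof -
  have p: "\<sigma> k + 2 powi k * real_of_int i < \<sigma> k + 2 powi k * real_of_int i + 2 powi k" for k i by simp
  show "integrable lborel (\<lambda>x. haar I x * haar J x)"
  proof (rule Bochner_Integration.integrable_bound)
    show "integrable lborel (\<lambda>x. 1 / sqrt (2 powi l) * haar I x)"
      unfolding I grid_interval_def by (intro integrable_mult_right integrable_haar p)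
    have J1: "\<bar>haar J x\<bar> \<le> 1 / sqrt (2 powi l)" for x
      using abs_haar_le_sup[OF p, of l j x] unfolding J grid_interval_def by simp
    have "\<bar>haar I x\<bar> * \<bar>haar J x\<bar> \<le> \<bar>haar I x\<bar> * (1 / sqrt (2 powi l))" for x
      by (intro mult_left_mono J1) simp
    then show "AE x in lborel. norm (haar I x * haar J x) \<le> norm (1 / sqrt (2 powi l) * haar I x)"
      by (auto simp: abs_mult mult.commute intro!: AE_I2)
  qed measurable
  consider "k < l" | "l < k" | "k = l" "i = j" | "k = l" "i \<noteq> j" by linarith
  then show "(LINT x|lborel. haar I x * haar J x) = (if I = J then 1 else 0)"
  proof cases
    case 1
    then have "I \<noteq> J" unfolding I J using grid_interval_inject by blast
    then show ?thesis using haar_grid_orthogonal_aux[OF n 1] unfolding I J by simp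
  next
    case 2
    then have "I \<noteq> J" unfolding I J using grid_interval_inject by blast
    then show ?thesis using haar_grid_orthogonal_aux[OF n 2] unfolding I J by (simp add: mult.commute)
  next
    case 3
    then have "I = J" unfolding I J by simp
    have "haar I x * haar I x = indicator I x / 2 powi k" for x
      using haar_square[OF p, of k i x] unfolding I grid_interval_def by (simp add: power2_eq_square)
    then have "(LINT x|lborel. haar I x * haar I x) = (LINT x|lborel. indicator I x) / 2 powi k" by simp
    also have "\<dots> = 1" unfolding I grid_interval_def by simp
    finally show ?thesis using \<open>I = J\<close> by simp
  next
    case 4
    then have "I \<noteq> J" unfolding I J using grid_interval_inject by blast
    have "haar I x * haar J x = 0" for x
    proof (cases "x \<in> I")
      case True
      then have "x \<notin> J" using 4 grid_interval_disjoint unfolding I J by blast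
      then show ?thesis using abs_haar_le[OF p, of l j x] unfolding J grid_interval_def by auto
    next
      case False then show ?thesis using abs_haar_le[OF p, of k i x] unfolding I grid_interval_def by auto
    qed
    then have "(\<lambda>x. haar I x * haar J x) = (\<lambda>x. 0)" by blast
    then show ?thesis using \<open>I \<noteq> J\<close> by (simp only: Bochner_Integration.integral_zero if_False)
  qed
qed

lemma integral_lborel_times_real:
  fixes f g :: "real \<Rightarrow> real"
  assumes f: "integrable lborel f" and g: "integrable lborel g"
  shows "integrable lborel (\<lambda>z. f (fst z) * g (snd z))"
    and "(LINT z|lborel. f (fst z) * g (snd z)) = (LINT x|lborel. f x) * (LINT y|lborel. g y)"
proof -
  have c: "integrable lborel (\<lambda>x. complex_of_real (f x))" "integrable lborel (\<lambda>x. complex_of_real (g x))"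
    using f g by auto
  have "integrable lborel (\<lambda>z. complex_of_real (f (fst z) * g (snd z)))"
    using integral_lborel_times(1)[OF c] by simp
  then show "integrable lborel (\<lambda>z. f (fst z) * g (snd z))" using integrable_Re by fastforce
  have "complex_of_real (LINT z|lborel. f (fst z) * g (snd z)) = of_real ((LINT x|lborel. f x) * (LINT y|lborel. g y))"
    using integral_lborel_times(2)[OF c] by (simp flip: of_real_mult add: integral_complex_of_real)
  then show "(LINT z|lborel. f (fst z) * g (snd z)) = (LINT x|lborel. f x) * (LINT y|lborel. g y)" by (simp only: of_real_eq_iff)
qed

text \<open>A bounded F need not be square integrable, but the rectangles lie in \<Omega>, so F may
  be replaced by its restriction G to \<Omega> without changing any coefficient. The squared norm of
  G is at most T^2 times the measure of \<Omega>.\<close>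

lemma sum_haar_coeff_le:
  assumes \<sigma>: "nested_shift \<sigma>" and \<tau>: "nested_shift \<tau>" and F: "F \<in> borel_measurable lebesgue"
    and T: "AE z in lebesgue. cmod (F z) \<le> T" and T0: "0 \<le> T"
    and \<Omega>: "\<Omega> \<in> sets lebesgue" "emeasure lebesgue \<Omega> < \<infinity>"
    and S: "finite S" and SA: "\<And>I J. (I, J) \<in> S \<Longrightarrow> (\<exists>k i. I = grid_interval \<sigma> k i) \<and> (\<exists>l j. J = grid_interval \<tau> l j) \<and> I \<times> J \<subseteq> \<Omega>"
  shows "(\<Sum>(I, J)\<in>S. (cmod (haar_coeff F I J))\<^sup>2) \<le> T\<^sup>2 * measure lebesgue \<Omega>"
proof -
  define e where "e q z = haar (fst q) (fst z) * haar (snd q) (snd z)" for q :: "real set \<times> real set" and z :: "real \<times> real"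
  define G where "G z = indicator \<Omega> z *\<^sub>R F z" for z
  have [measurable]: "F \<in> borel_measurable lebesgue" "\<Omega> \<in> sets lebesgue" by fact+
  have em: "e q \<in> borel_measurable borel" for q
  proof -
    have "(\<lambda>z :: real \<times> real. haar I (fst z)) \<in> borel_measurable borel" "(\<lambda>z :: real \<times> real. haar I (snd z)) \<in> borel_measurable borel" for I
      by (rule measurable_compose[OF borel_measurable_continuous_onI borel_measurable_haar], intro continuous_intros)+
    then show ?thesis unfolding e_def[abs_def] by (intro borel_measurable_times)
  qed
  have em'[measurable]: "e q \<in> borel_measurable lebesgue" for q using em[of q] by (intro measurable_completion) simp
  have ind: "integrable lebesgue (\<lambda>z. c * indicator \<Omega> z :: real)" for c
    using \<Omega> by (intro integrable_mult_right integrable_real_indicator) auto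
  have GT: "AE z in lebesgue. (cmod (G z))\<^sup>2 \<le> T\<^sup>2 * indicator \<Omega> z"
    using T by eventually_elim (auto simp: G_def indicator_def intro: power_mono)
  have G2: "integrable lebesgue (\<lambda>z. (cmod (G z))\<^sup>2)"
    by (rule Bochner_Integration.integrable_bound[OF ind[of "T\<^sup>2"]]) (use GT in \<open>auto simp: G_def\<close>)
  have bnd: "\<exists>K. \<forall>z. \<bar>e q z\<bar> \<le> K" if mem: "q \<in> S" for q
  proof -
    obtain I J where q: "q = (I, J)" by force
    obtain k i l j where IJ: "I = grid_interval \<sigma> k i" "J = grid_interval \<tau> l j" using SA[of I J] mem q by blast
    have "\<bar>haar (grid_interval \<rho> k i) x\<bar> \<le> 1 / sqrt (2 powi k)" for \<rho> k i x
      using abs_haar_le_sup[of "\<rho> k + 2 powi k * of_int i" "\<rho> k + 2 powi k * of_int i + 2 powi k" x]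
      unfolding grid_interval_def by simp
    then have "\<bar>e q z\<bar> \<le> 1 / sqrt (2 powi k) * (1 / sqrt (2 powi l))" for z
      unfolding e_def q fst_conv snd_conv IJ abs_mult by (intro mult_mono) auto
    then show ?thesis by blast
  qed
  have Ge: "integrable lebesgue (\<lambda>z. G z * of_real (e q z))" if q: "q \<in> S" for q
  proof -
    obtain K where K: "\<And>z. \<bar>e q z\<bar> \<le> K" using bnd[OF q] by blast
    show ?thesis
    proof (rule Bochner_Integration.integrable_bound[OF ind[of "T * K"]])
      show "AE z in lebesgue. norm (G z * of_real (e q z)) \<le> norm (T * K * indicator \<Omega> z)"
        using T
      proof eventually_elim
        fix z assume "cmod (F z) \<le> T"
        then have "cmod (F z) * \<bar>e q z\<bar> \<le> T * K" using K[of z] T0 by (intro mult_mono) auto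
        then show "norm (G z * of_real (e q z)) \<le> norm (T * K * indicator \<Omega> z)"
          by (auto simp: G_def norm_mult indicator_def intro: order_trans[OF _ abs_ge_self])
      qed
    qed (unfold G_def, measurable)
  qed
  have eq: "haar_coeff F (fst q) (snd q) = (LINT z|lebesgue. G z * of_real (e q z))" if q: "q \<in> S" for q
  proof -
    obtain I J where qq: "q = (I, J)" by force
    obtain k i l j where IJ: "I = grid_interval \<sigma> k i" "J = grid_interval \<tau> l j" "I \<times> J \<subseteq> \<Omega>" using SA[of I J] q qq by blast
    have 0: "haar (grid_interval \<rho> k i) x = 0" if "x \<notin> grid_interval \<rho> k i" for \<rho> k i x
      using that abs_haar_le[of "\<rho> k + 2 powi k * of_int i" "\<rho> k + 2 powi k * of_int i + 2 powi k" x]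
      unfolding grid_interval_def by auto
    have "F z * of_real (e q z) = G z * of_real (e q z)" for z
    proof (cases "z \<in> I \<times> J")
      case True then show ?thesis using IJ by (auto simp: G_def)
    next
      case False
      then have "e q z = 0" using 0 unfolding e_def qq IJ by (cases z) auto
      then show ?thesis by simp
    qed
    then show ?thesis unfolding haar_coeff_def e_def[symmetric] by (simp only:)
  qed
  have pr: "integrable lebesgue (\<lambda>z. e q z * e r z) \<and> (LINT z|lebesgue. e q z * e r z) = (if q = r then 1 else 0)" if mem: "q \<in> S" "r \<in> S" for q r
  proof -
    obtain I J I' J' where qq: "q = (I, J)" "r = (I', J')" by force
    obtain k i l j where IJ: "I = grid_interval \<sigma> k i" "J = grid_interval \<tau> l j" using SA[of I J] mem qq by blast
    obtain k' i' l' j' where IJ': "I' = grid_interval \<sigma> k' i'" "J' = grid_interval \<tau> l' j'" using SA[of I' J'] mem qq by blast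
    note h = haar_grid_orthonormal[OF \<sigma> IJ(1) IJ'(1)] haar_grid_orthonormal[OF \<tau> IJ(2) IJ'(2)]
    have ee: "e q z * e r z = (haar I (fst z) * haar I' (fst z)) * (haar J (snd z) * haar J' (snd z))" for z
      unfolding e_def qq by simp
    have "integrable lborel (\<lambda>z. e q z * e r z)" "(LINT z|lborel. e q z * e r z) = (if q = r then 1 else 0)"
      unfolding ee using integral_lborel_times_real[OF h(1) h(3)] h(2,4) by (auto simp: qq)
    moreover have "(\<lambda>z. e q z * e r z) \<in> borel_measurable lborel" using em[of q] em[of r] by simp
    ultimately show ?thesis using integral_completion integrable_completion by metis
  qed
  have "(\<Sum>(I, J)\<in>S. (cmod (haar_coeff F I J))\<^sup>2) = (\<Sum>q\<in>S. (cmod (LINT z|lebesgue. G z * of_real (e q z)))\<^sup>2)"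
    by (intro sum.cong refl) (use eq in auto)
  also have "\<dots> \<le> (LINT z|lebesgue. (cmod (G z))\<^sup>2)"
    by (rule Bessel_inequality[OF S G2 Ge]) (use pr in auto)
  also have "\<dots> \<le> (LINT z|lebesgue. T\<^sup>2 * indicator \<Omega> z)"
    by (rule integral_mono_AE[OF G2 ind GT])
  finally show ?thesis by simp
qed

lemma ennsqrt_le: assumes "0 \<le> T" "x \<le> ennreal (T\<^sup>2)" shows "ennsqrt x \<le> ennreal T"
proof -
  have "x \<noteq> \<infinity>" using assms(2) by (auto simp: top_unique)
  have "enn2real x \<le> T\<^sup>2" using assms by (simp add: enn2real_leI)
  then have "sqrt (enn2real x) \<le> T" using assms(1) real_le_lsqrt by auto
  then show ?thesis using \<open>x \<noteq> \<infinity>\<close> by (simp add: ennsqrt_def ennreal_leI)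
qed

lemma bmo_norm_le:
  assumes F: "F \<in> borel_measurable lebesgue" and T: "AE z in lebesgue. cmod (F z) \<le> T" and T0: "0 \<le> T"
  shows "bmo_norm \<delta>0 F \<le> ennreal T"
proof -
  \<comment> \<open>Both grids come from nested shifts, so one argument covers the four pairs of
    grids.\<close>
  have *: "bmo_grid_norm {grid_interval \<sigma> k j |k j. True} {grid_interval \<tau> k j |k j. True} F \<le> ennreal T"
    if \<sigma>: "nested_shift \<sigma>" and \<tau>: "nested_shift \<tau>" for \<sigma> \<tau>
    unfolding bmo_grid_norm_def
  proof (rule SUP_least)
    fix \<Omega> :: "(real \<times> real) set" assume "\<Omega> \<in> {\<Omega>. open \<Omega> \<and> \<Omega> \<noteq> {} \<and> emeasure lebesgue \<Omega> < \<infinity>}"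
    then have \<Omega>: "\<Omega> \<in> sets lebesgue" "emeasure lebesgue \<Omega> < \<infinity>" by auto
    let ?X = "{(I, J). I \<in> {grid_interval \<sigma> k j |k j. True} \<and> J \<in> {grid_interval \<tau> k j |k j. True} \<and> I \<times> J \<subseteq> \<Omega>}"
    have "(\<Sum>\<^sub>\<infinity>(I, J)\<in>?X. ennreal ((cmod (haar_coeff F I J))\<^sup>2)) \<le> ennreal (T\<^sup>2 * measure lebesgue \<Omega>)"
    proof (rule infsum_le_finite_sums)
      fix S assume S: "finite S" "S \<subseteq> ?X"
      have "(\<Sum>(I, J)\<in>S. ennreal ((cmod (haar_coeff F I J))\<^sup>2)) = ennreal (\<Sum>(I, J)\<in>S. (cmod (haar_coeff F I J))\<^sup>2)"
        by (simp add: case_prod_beta sum_ennreal)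
      also have "\<dots> \<le> ennreal (T\<^sup>2 * measure lebesgue \<Omega>)"
        by (intro ennreal_leI sum_haar_coeff_le[OF \<sigma> \<tau> F T T0 \<Omega> S(1)]) (use S(2) in auto)
      finally show "(\<Sum>(I, J)\<in>S. ennreal ((cmod (haar_coeff F I J))\<^sup>2)) \<le> ennreal (T\<^sup>2 * measure lebesgue \<Omega>)" .
    qed (rule nonneg_summable_on_complete, simp)
    also have "\<dots> = ennreal (T\<^sup>2) * emeasure lebesgue \<Omega>"
      using \<Omega> by (simp add: ennreal_mult emeasure_eq_ennreal_measure)
    finally have "(\<Sum>\<^sub>\<infinity>(I, J)\<in>?X. ennreal ((cmod (haar_coeff F I J))\<^sup>2)) / emeasure lebesgue \<Omega> \<le> ennreal (T\<^sup>2) * emeasure lebesgue \<Omega> / emeasure lebesgue \<Omega>"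
      by (rule divide_right_mono_ennreal)
    also have "\<dots> \<le> ennreal (T\<^sup>2)"
    \<comment> \<open>For measure 0 the left-hand side is \<open>0 / 0\<close>, which is 0 in
      \<open>ennreal\<close>.\<close>
    proof (cases "emeasure lebesgue \<Omega> = 0")
      case False then show ?thesis using \<Omega> by (simp add: ennreal_mult_divide_eq)
    qed simp
    finally show "ennsqrt ((\<Sum>\<^sub>\<infinity>(I, J)\<in>?X. ennreal ((cmod (haar_coeff F I J))\<^sup>2)) / emeasure lebesgue \<Omega>) \<le> ennreal T"
      by (rule ennsqrt_le[OF T0])
  qed
  show ?thesis unfolding bmo_norm_def
    by (rule SUP_least) (auto simp: dyadic_grid_eq shifted_grid_eq intro!: *[simplified] nested_shift_0 nested_shift_grid_shift)
qed

section \<open>Telescoping averages over dyadic rectangles\<close>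

text \<open>The inequality \<open>|F| \<le> 1 + |F|^2\<close> turns local square integrability into
  local integrability.\<close>

lemma integrable_L2_loc_times:
  assumes F: "F \<in> L2_loc" and [measurable]: "k \<in> borel_measurable borel"
    and k: "\<And>z. \<bar>k z\<bar> \<le> C * indicator (cbox a b) z"
  shows "integrable lebesgue (\<lambda>z. F z * of_real (k z))"
proof -
  have [measurable]: "F \<in> borel_measurable lebesgue" using F by (simp add: L2_loc_def)
  have km[measurable]: "k \<in> borel_measurable lebesgue" by (intro measurable_completion) simp
  have i1: "integrable lebesgue (\<lambda>z. indicator (cbox a b) z *\<^sub>R (cmod (F z))\<^sup>2)"
    using F compact_cbox[of a b] unfolding L2_loc_def set_integrable_def by blast
  have i2: "integrable lebesgue (\<lambda>z. indicator (cbox a b) z :: real)"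
    by (intro integrable_real_indicator) (auto simp: emeasure_completion emeasure_lborel_cbox_eq)
  have "integrable lebesgue (\<lambda>z. C * (indicator (cbox a b) z + indicator (cbox a b) z *\<^sub>R (cmod (F z))\<^sup>2))"
    using i1 i2 by (intro integrable_mult_right Bochner_Integration.integrable_add)
  then show ?thesis
  proof (rule Bochner_Integration.integrable_bound)
    have "norm (F z * of_real (k z)) \<le> norm (C * (indicator (cbox a b) z + indicator (cbox a b) z *\<^sub>R (cmod (F z))\<^sup>2))" for z
    proof -
      have C: "C * indicator (cbox a b) z \<ge> 0" using k[of z] abs_ge_zero order_trans by blast
      have "0 \<le> (cmod (F z) - 1)\<^sup>2" by simp
      then have "2 * cmod (F z) \<le> 1 + (cmod (F z))\<^sup>2" by (simp add: power2_diff)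
      then have le: "cmod (F z) \<le> 1 + (cmod (F z))\<^sup>2" using norm_ge_zero[of "F z"] by linarith
      have "norm (F z * of_real (k z)) = cmod (F z) * \<bar>k z\<bar>" by (simp add: norm_mult)
      also have "\<dots> \<le> (1 + (cmod (F z))\<^sup>2) * (C * indicator (cbox a b) z)"
        by (intro mult_mono le k) auto
      also have "\<dots> = C * (indicator (cbox a b) z + indicator (cbox a b) z *\<^sub>R (cmod (F z))\<^sup>2)" by (simp add: algebra_simps)
      finally show ?thesis by (auto intro: order_trans[OF _ abs_ge_self])
    qed
    then show "AE z in lebesgue. norm (F z * of_real (k z)) \<le> norm (C * (indicator (cbox a b) z + indicator (cbox a b) z *\<^sub>R (cmod (F z))\<^sup>2))"
      by (intro AE_I2)
  qed measurable
qed

text \<open>The kernel of the conditional expectation with respect to the dyadic intervals of length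
  \<open>2 powi k\<close>.\<close>

definition cell_weight :: "int \<Rightarrow> real \<Rightarrow> real \<Rightarrow> real" where
  "cell_weight k x y = indicator (dyadic_interval k \<lfloor>x / 2 powi k\<rfloor>) y / 2 powi k"

text \<open>Written with a product of weights, and not as an average over a set, so that differences
  of scales factor into one difference per variable.\<close>

definition rect_avg :: "(real \<times> real \<Rightarrow> complex) \<Rightarrow> int \<Rightarrow> int \<Rightarrow> real \<times> real \<Rightarrow> complex" where
  "rect_avg F k l z = (LINT w|lebesgue. F w * of_real (cell_weight k (fst z) (fst w) * cell_weight l (snd z) (snd w)))"

lemma dyadic_interval_eq_ivl: "dyadic_interval k j = {2 powi k * of_int j ..< 2 powi k * of_int j + 2 powi k}"
  by (simp add: dyadic_interval_def algebra_simps)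

lemma mem_dyadic_cell: "x \<in> dyadic_interval k \<lfloor>x / 2 powi k\<rfloor>"
proof -
  have p: "(2::real) powi k > 0" by simp
  have "of_int \<lfloor>x / 2 powi k\<rfloor> * 2 powi k \<le> x" "x < (of_int \<lfloor>x / 2 powi k\<rfloor> + 1) * 2 powi k"
    unfolding pos_le_divide_eq[OF p, symmetric] pos_divide_less_eq[OF p, symmetric] by linarith+
  then show ?thesis unfolding dyadic_interval_def by (simp add: mult.commute)
qed

text \<open>The martingale difference between consecutive scales is the projection onto the Haar
  functions of scale k + 1. Its kernel is the product of the values at x and y of the Haar function
  of the cell of x, so \<sigma> is the value at x; its modulus is all that is recorded.\<close>

lemma cell_weight_diff:
  "\<exists>\<sigma>. \<bar>\<sigma>\<bar> = 1 / sqrt (2 powi (k + 1)) \<and> (\<forall>y. cell_weight k x y - cell_weight (k + 1) x y = \<sigma> * haar (dyadic_interval (k + 1) \<lfloor>x / 2 powi (k + 1)\<rfloor>) y)"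
proof -
  define p where "p = (2::real) powi k"
  have p: "p > 0" by (simp add: p_def)
  define m where "m = \<lfloor>x / p\<rfloor>"
  define q where "q = m div 2"
  have m: "of_int m \<le> x / p" "x / p < of_int m + 1" unfolding m_def by linarith+
  have mq: "m = 2 * q \<or> m = 2 * q + 1" unfolding q_def by presburger
  have "\<lfloor>x / (2 * p)\<rfloor> = q"
  proof (rule floor_unique)
    have "x / (2 * p) = x / p / 2" by simp
    moreover have "2 * real_of_int q \<le> of_int m" "real_of_int m \<le> 2 * of_int q + 1" using mq by auto
    ultimately show "of_int q \<le> x / (2 * p)" "x / (2 * p) < of_int q + 1" using m by auto
  qed
  then have q: "\<lfloor>x / 2 powi (k + 1)\<rfloor> = q" by (simp add: power_int_2_Suc p_def)
  define a where "a = 2 * p * of_int q"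
  have cell: "dyadic_interval (k + 1) \<lfloor>x / 2 powi (k + 1)\<rfloor> = {a..<a + 2 * p}"
    by (simp only: q dyadic_interval_eq_ivl) (simp add: power_int_2_Suc a_def p_def)
  have split: "(indicator {a..<a + 2 * p} y :: real) = indicator {a..<a + p} y + indicator {a + p..<a + 2 * p} y" for y
    using p by (auto simp: indicator_def)
  have s: "sqrt (2 * p) * sqrt (2 * p) = 2 * p" using p by simp
  have w: "cell_weight (k + 1) x y = (indicator {a..<a + p} y + indicator {a + p..<a + 2 * p} y) / (2 * p)" for y
    unfolding cell_weight_def cell split by (simp add: power_int_2_Suc p_def)
  have h: "1 / sqrt (2 * p) * haar {a..<a + 2 * p} y = (indicator {a..<a + p} y - indicator {a + p..<a + 2 * p} y) / (2 * p)" for y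
    unfolding haar_halves[OF p] using s by simp
  have P: "2 powi (k + 1) = 2 * p" by (simp add: power_int_2_Suc p_def)
  from mq show ?thesis
  proof
    assume "m = 2 * q"
    then have "dyadic_interval k \<lfloor>x / 2 powi k\<rfloor> = {a..<a + p}"
      by (simp only: p_def[symmetric] m_def[symmetric] dyadic_interval_eq_ivl) (simp add: a_def algebra_simps)
    then have "cell_weight k x y = indicator {a..<a + p} y / p" for y by (simp add: cell_weight_def p_def)
    then have "cell_weight k x y - cell_weight (k + 1) x y = 1 / sqrt (2 * p) * haar {a..<a + 2 * p} y" for y
      unfolding h w using p by (simp add: field_simps)
    then show ?thesis unfolding cell unfolding P using p by (intro exI[of _ "1 / sqrt (2 * p)"]) auto
  next
    assume "m = 2 * q + 1"
    then have "dyadic_interval k \<lfloor>x / 2 powi k\<rfloor> = {a + p..<a + 2 * p}"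
      by (simp only: p_def[symmetric] m_def[symmetric] dyadic_interval_eq_ivl) (simp add: a_def algebra_simps)
    then have "cell_weight k x y = indicator {a + p..<a + 2 * p} y / p" for y by (simp add: cell_weight_def p_def)
    then have "cell_weight k x y - cell_weight (k + 1) x y = - (1 / sqrt (2 * p) * haar {a..<a + 2 * p} y)" for y
      unfolding h w using p by (simp add: field_simps)
    then show ?thesis unfolding cell unfolding P using p by (intro exI[of _ "- (1 / sqrt (2 * p))"]) auto
  qed
qed

lemma ennsqrt_leD: assumes "ennsqrt x \<le> ennreal B" "0 \<le> B" shows "x \<le> ennreal (B\<^sup>2)"
proof -
  have x: "x \<noteq> \<infinity>" using assms(1) by (auto simp: ennsqrt_def top_unique)
  then have "sqrt (enn2real x) \<le> B" using assms by (simp add: ennsqrt_def)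
  then have "enn2real x \<le> B\<^sup>2" by (rule sqrt_le_D)
  then have "ennreal (enn2real x) \<le> ennreal (B\<^sup>2)" by (rule ennreal_leI)
  moreover have "ennreal (enn2real x) = x" using x by (simp add: less_top)
  ultimately show ?thesis by (simp only:)
qed

text \<open>A coefficient is one term of the sum belonging to a suitable open set. The rectangle is
  half-open, so \<Omega> is an open rectangle with doubled sides that contains it; the measure grows
  by a factor 4, which becomes the factor 2 after the square root.\<close>

lemma cmod_haar_coeff_le:
  assumes B: "bmo_grid_norm dyadic_grid dyadic_grid F \<le> ennreal B" "0 \<le> B"
  shows "cmod (haar_coeff F (dyadic_interval k i) (dyadic_interval l j)) \<le> 2 * B * (sqrt (2 powi k) * sqrt (2 powi l))"
proof -
  define p r where "p = (2::real) powi k" and "r = (2::real) powi l"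
  have p: "p > 0" "r > 0" by (auto simp: p_def r_def)
  define a b where "a = p * of_int i" and "b = r * of_int j"
  have I: "dyadic_interval k i = {a..<a + p}" and J: "dyadic_interval l j = {b..<b + r}"
    unfolding dyadic_interval_eq_ivl p_def r_def a_def b_def by auto
  define \<Omega> where "\<Omega> = {a - p<..<a + p} \<times> {b - r<..<b + r}"
  have meas: "emeasure lebesgue \<Omega> = ennreal (4 * p * r)"
  proof -
    have "\<Omega> \<in> sets lborel" by (simp add: \<Omega>_def borel_open open_Times)
    then have "emeasure lebesgue \<Omega> = emeasure (lborel \<Otimes>\<^sub>M lborel) \<Omega>"
      unfolding lborel_prod by (simp add: emeasure_completion)
    also have "\<dots> = ennreal (2 * p) * ennreal (2 * r)"
      unfolding \<Omega>_def using p by (subst lborel.emeasure_pair_measure_Times) auto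
    finally show ?thesis using p by (simp add: ennreal_mult[symmetric] mult_ac)
  qed
  let ?X = "{(I, J). I \<in> dyadic_grid \<and> J \<in> dyadic_grid \<and> I \<times> J \<subseteq> \<Omega>}"
  let ?c = "haar_coeff F {a..<a + p} {b..<b + r}"
  have "{a..<a + p} \<in> dyadic_grid" "{b..<b + r} \<in> dyadic_grid"
    unfolding I[symmetric] J[symmetric] dyadic_grid_def by blast+
  moreover have "{a..<a + p} \<times> {b..<b + r} \<subseteq> \<Omega>" using p by (auto simp: \<Omega>_def)
  ultimately have mem: "({a..<a + p}, {b..<b + r}) \<in> ?X" by blast
  have "ennsqrt ((\<Sum>\<^sub>\<infinity>(I, J)\<in>?X. ennreal ((cmod (haar_coeff F I J))\<^sup>2)) / emeasure lebesgue \<Omega>) \<le> bmo_grid_norm dyadic_grid dyadic_grid F"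
    unfolding bmo_grid_norm_def
  proof (rule SUP_upper)
    have "(a, b) \<in> \<Omega>" using p by (simp add: \<Omega>_def)
    then show "\<Omega> \<in> {\<Omega>. open \<Omega> \<and> \<Omega> \<noteq> {} \<and> emeasure lebesgue \<Omega> < \<infinity>}"
      using meas by (auto simp: \<Omega>_def open_Times)
  qed
  then have "(\<Sum>\<^sub>\<infinity>(I, J)\<in>?X. ennreal ((cmod (haar_coeff F I J))\<^sup>2)) / emeasure lebesgue \<Omega> \<le> ennreal (B\<^sup>2)"
    using B by (intro ennsqrt_leD) auto
  then have "(\<Sum>\<^sub>\<infinity>(I, J)\<in>?X. ennreal ((cmod (haar_coeff F I J))\<^sup>2)) / emeasure lebesgue \<Omega> * emeasure lebesgue \<Omega> \<le> ennreal (B\<^sup>2) * ennreal (4 * p * r)"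
    unfolding meas by (rule mult_right_mono) simp
  moreover have "x / emeasure lebesgue \<Omega> * emeasure lebesgue \<Omega> = x" for x
    using p unfolding meas by (intro ennreal_divide_times[THEN trans] ennreal_mult_divide_eq) auto
  ultimately have "(\<Sum>\<^sub>\<infinity>(I, J)\<in>?X. ennreal ((cmod (haar_coeff F I J))\<^sup>2)) \<le> ennreal (B\<^sup>2 * (4 * p * r))"
    using p by (simp add: ennreal_mult)
  moreover have "ennreal ((cmod ?c)\<^sup>2) \<le> (\<Sum>\<^sub>\<infinity>(I, J)\<in>?X. ennreal ((cmod (haar_coeff F I J))\<^sup>2))"
    using infsum_mono_neutral[of "\<lambda>(I, J). ennreal ((cmod (haar_coeff F I J))\<^sup>2)" "{({a..<a + p}, {b..<b + r})}" "\<lambda>(I, J). ennreal ((cmod (haar_coeff F I J))\<^sup>2)" ?X]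
      mem nonneg_summable_on_complete[of ?X "\<lambda>(I, J). ennreal ((cmod (haar_coeff F I J))\<^sup>2)"]
    by auto
  ultimately have "ennreal ((cmod ?c)\<^sup>2) \<le> ennreal (B\<^sup>2 * (4 * p * r))" by (rule order_trans[rotated])
  then have "(cmod ?c)\<^sup>2 \<le> (2 * B * (sqrt p * sqrt r))\<^sup>2"
    using p B(2) by (subst (asm) ennreal_le_iff) (auto simp: power_mult_distrib)
  then have "cmod ?c \<le> 2 * B * (sqrt p * sqrt r)"
    using B(2) p by (intro power2_le_imp_le[of "cmod ?c"]) auto
  then show ?thesis unfolding I J unfolding p_def r_def .
qed

lemma integrable_rect_avg:
  assumes F: "F \<in> L2_loc"
  shows "integrable lebesgue (\<lambda>w. F w * of_real (cell_weight k x (fst w) * cell_weight l y (snd w)))"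
proof (rule integrable_L2_loc_times[OF F])
  have 1: "cell_weight k x \<in> borel_measurable borel" for k x
    unfolding cell_weight_def[abs_def] dyadic_interval_def by measurable
  have "(\<lambda>w :: real \<times> real. cell_weight k x (fst w)) \<in> borel_measurable borel"
    "(\<lambda>w :: real \<times> real. cell_weight k x (snd w)) \<in> borel_measurable borel" for k x
    by (rule measurable_compose[OF borel_measurable_continuous_onI 1], intro continuous_intros)+
  then show "(\<lambda>w. cell_weight k x (fst w) * cell_weight l y (snd w)) \<in> borel_measurable borel"
    by (intro borel_measurable_times)
  let ?I = "\<lambda>k x. {2 powi k * real_of_int \<lfloor>x / 2 powi k\<rfloor> .. 2 powi k * real_of_int \<lfloor>x / 2 powi k\<rfloor> + 2 powi k}"
  fix z :: "real \<times> real"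
  have "\<bar>cell_weight k x (fst z) * cell_weight l y (snd z)\<bar> \<le> 1 / (2 powi k * 2 powi l) * (indicator (?I k x) (fst z) * indicator (?I l y) (snd z))"
    unfolding cell_weight_def dyadic_interval_eq_ivl by (auto simp: indicator_def)
  also have "indicator (?I k x) (fst z) * indicator (?I l y) (snd z) = (indicator (?I k x \<times> ?I l y) z :: real)"
    by (cases z) (auto simp: indicator_def)
  also have "?I k x \<times> ?I l y = cbox (2 powi k * real_of_int \<lfloor>x / 2 powi k\<rfloor>, 2 powi l * real_of_int \<lfloor>y / 2 powi l\<rfloor>) (2 powi k * real_of_int \<lfloor>x / 2 powi k\<rfloor> + 2 powi k, 2 powi l * real_of_int \<lfloor>y / 2 powi l\<rfloor> + 2 powi l)"
    by (simp add: cbox_Pair_eq)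
  finally show "\<bar>cell_weight k x (fst z) * cell_weight l y (snd z)\<bar> \<le> 1 / (2 powi k * 2 powi l) * indicator (cbox (2 powi k * real_of_int \<lfloor>x / 2 powi k\<rfloor>, 2 powi l * real_of_int \<lfloor>y / 2 powi l\<rfloor>) (2 powi k * real_of_int \<lfloor>x / 2 powi k\<rfloor> + 2 powi k, 2 powi l * real_of_int \<lfloor>y / 2 powi l\<rfloor> + 2 powi l)) z" .
qed

text \<open>The mixed difference is a tensor product of two martingale differences, hence one Haar
  coefficient times a factor of modulus \<open>|I|^(-1/2) * |J|^(-1/2)\<close>, which cancels the
  square roots in \<open>cmod_haar_coeff_le\<close>. A difference in one variable alone is not of
  this form.\<close>

lemma rect_avg_double_diff:
  assumes F: "F \<in> L2_loc" and B: "bmo_grid_norm dyadic_grid dyadic_grid F \<le> ennreal B" "0 \<le> B"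
  shows "cmod (rect_avg F k l z - rect_avg F (k + 1) l z - rect_avg F k (l + 1) z + rect_avg F (k + 1) (l + 1) z) \<le> 2 * B"
proof -
  obtain x y where z: "z = (x, y)" by force
  obtain s where s: "\<bar>s\<bar> = 1 / sqrt (2 powi (k + 1))" "\<And>w. cell_weight k x w - cell_weight (k + 1) x w = s * haar (dyadic_interval (k + 1) \<lfloor>x / 2 powi (k + 1)\<rfloor>) w"
    using cell_weight_diff[of k x] by blast
  obtain t where t: "\<bar>t\<bar> = 1 / sqrt (2 powi (l + 1))" "\<And>w. cell_weight l y w - cell_weight (l + 1) y w = t * haar (dyadic_interval (l + 1) \<lfloor>y / 2 powi (l + 1)\<rfloor>) w"
    using cell_weight_diff[of l y] by blast
  let ?I = "dyadic_interval (k + 1) \<lfloor>x / 2 powi (k + 1)\<rfloor>" and ?J = "dyadic_interval (l + 1) \<lfloor>y / 2 powi (l + 1)\<rfloor>"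
  let ?w = "\<lambda>k l w. F w * complex_of_real (cell_weight k x (fst w) * cell_weight l y (snd w))"
  have "rect_avg F k l z - rect_avg F (k + 1) l z - rect_avg F k (l + 1) z + rect_avg F (k + 1) (l + 1) z
    = (LINT w|lebesgue. ?w k l w - ?w (k + 1) l w - ?w k (l + 1) w + ?w (k + 1) (l + 1) w)"
    unfolding rect_avg_def z fst_conv snd_conv using integrable_rect_avg[OF F]
    by (simp only: Bochner_Integration.integral_add Bochner_Integration.integral_diff Bochner_Integration.integrable_add Bochner_Integration.integrable_diff)
  also have "\<dots> = (LINT w|lebesgue. of_real (s * t) * (F w * of_real (haar ?I (fst w) * haar ?J (snd w))))"
  proof (rule arg_cong[where f = "integral\<^sup>L lebesgue"], rule ext)
    fix w
    have "?w k l w - ?w (k + 1) l w - ?w k (l + 1) w + ?w (k + 1) (l + 1) w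
      = F w * of_real ((cell_weight k x (fst w) - cell_weight (k + 1) x (fst w)) * (cell_weight l y (snd w) - cell_weight (l + 1) y (snd w)))"
      by (simp add: algebra_simps)
    then show "?w k l w - ?w (k + 1) l w - ?w k (l + 1) w + ?w (k + 1) (l + 1) w = of_real (s * t) * (F w * of_real (haar ?I (fst w) * haar ?J (snd w)))"
      unfolding s t by simp
  qed
  also have "\<dots> = of_real (s * t) * haar_coeff F ?I ?J"
    unfolding haar_coeff_def by (rule integral_mult_right_zero)
  also have "cmod \<dots> = \<bar>s\<bar> * \<bar>t\<bar> * cmod (haar_coeff F ?I ?J)" by (simp add: norm_mult abs_mult)
  also have "\<dots> \<le> \<bar>s\<bar> * \<bar>t\<bar> * (2 * B * (sqrt (2 powi (k + 1)) * sqrt (2 powi (l + 1))))"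
    by (intro mult_left_mono cmod_haar_coeff_le B) auto
  also have "\<dots> = 2 * B"
  proof -
    have "sqrt (2 powi (k + 1)) > 0" "sqrt (2 powi (l + 1)) > 0" by auto
    then show ?thesis unfolding s t by (simp add: field_simps)
  qed
  finally show ?thesis .
qed

lemma double_telescope:
  fixes g :: "nat \<Rightarrow> nat \<Rightarrow> complex"
  assumes "\<And>i j. cmod (g i j - g (Suc i) j - g i (Suc j) + g (Suc i) (Suc j)) \<le> K"
  shows "cmod (g 0 0 - g N 0 - g 0 N + g N N) \<le> (real N)\<^sup>2 * K"
proof -
  have "(\<Sum>i<N. \<Sum>j<N. g i j - g (Suc i) j - g i (Suc j) + g (Suc i) (Suc j))
    = (\<Sum>i<N. \<Sum>j<N. (g i j - g (Suc i) j) - (g i (Suc j) - g (Suc i) (Suc j)))" by (simp add: algebra_simps)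
  also have "\<dots> = (\<Sum>i<N. (g i 0 - g (Suc i) 0) - (g i N - g (Suc i) N))"
    by (intro sum.cong refl) (rule sum_lessThan_telescope')
  also have "\<dots> = (\<Sum>i<N. (g i 0 - g i N) - (g (Suc i) 0 - g (Suc i) N))" by (simp add: algebra_simps)
  also have "\<dots> = (g 0 0 - g 0 N) - (g N 0 - g N N)" by (rule sum_lessThan_telescope')
  finally have "g 0 0 - g N 0 - g 0 N + g N N = (\<Sum>i<N. \<Sum>j<N. g i j - g (Suc i) j - g i (Suc j) + g (Suc i) (Suc j))"
    by (simp add: algebra_simps)
  also have "cmod \<dots> \<le> (\<Sum>i<N. \<Sum>j<N. K)"
    by (intro order_trans[OF norm_sum] sum_mono assms)
  finally show ?thesis by (simp add: power2_eq_square)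
qed

text \<open>Mixed differences over N scales in each variable add up to the alternating sum over four
  corners. The three corners other than the small square stay on the right, to be estimated through
  f.\<close>

lemma rect_avg_telescope:
  assumes F: "F \<in> L2_loc" and B: "bmo_grid_norm dyadic_grid dyadic_grid F \<le> ennreal B" "0 \<le> B"
  shows "cmod (rect_avg F k k z) \<le> 2 * (real N)\<^sup>2 * B + cmod (rect_avg F (k + int N) k z) + cmod (rect_avg F k (k + int N) z) + cmod (rect_avg F (k + int N) (k + int N) z)"
proof -
  let ?g = "\<lambda>i j. rect_avg F (k + int i) (k + int j) z"
  have "cmod (?g 0 0 - ?g N 0 - ?g 0 N + ?g N N) \<le> (real N)\<^sup>2 * (2 * B)"
  proof (rule double_telescope)
    fix i j
    show "cmod (?g i j - ?g (Suc i) j - ?g i (Suc j) + ?g (Suc i) (Suc j)) \<le> 2 * B"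
      using rect_avg_double_diff[OF F B, of "k + int i" "k + int j" z] by (simp add: add_ac)
  qed
  moreover have "cmod (?g 0 0) \<le> cmod (?g 0 0 - ?g N 0 - ?g 0 N + ?g N N) + cmod (?g N 0) + cmod (?g 0 N) + cmod (?g N N)"
  proof -
    have "?g 0 0 = (?g 0 0 - ?g N 0 - ?g 0 N + ?g N N) + ?g N 0 + ?g 0 N + - ?g N N" by simp
    then show ?thesis by (metis norm_minus_cancel norm_triangle_mono norm_triangle_ineq order_refl)
  qed
  ultimately show ?thesis by (simp add: mult.commute mult.left_commute)
qed

section \<open>Pointwise bounds from averages over boxes\<close>

text \<open>A one-sided form of Lebesgue differentiation. Let \<nu>1 have the positive part of g as
  density and \<nu>2 the negative part plus T. The hypothesis says \<nu>1 \<le> \<nu>2 on small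
  boxes. Nonoverlapping covers extend this to bounded open sets, and outer regularity to the part of
  a box where g \<ge> T + h. There \<nu>2 is T times Lebesgue measure and \<nu>1 at least T + h
  times, so this part is null.\<close>

lemma AE_le_of_small_boxes:
  fixes g :: "'a::euclidean_space \<Rightarrow> real"
  assumes g[measurable]: "g \<in> borel_measurable borel"
    and int: "\<And>a b. set_integrable lborel (cbox a b) g"
    and r: "0 < r" and T: "0 \<le> T"
    and box: "\<And>c d. box c d \<noteq> {} \<Longrightarrow> dist c d < r \<Longrightarrow> (LINT z:cbox c d|lborel. g z) \<le> T * measure lborel (cbox c d)"
  shows "AE z in lborel. g z \<le> T"
proof -
  define \<nu>1 where "\<nu>1 = density lborel (\<lambda>z. ennreal (max (g z) 0))"
  define \<nu>2 where "\<nu>2 = density lborel (\<lambda>z. ennreal (max (- g z) 0 + T))"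
  have sets[simp]: "sets \<nu>1 = sets borel" "sets \<nu>2 = sets borel" by (auto simp: \<nu>1_def \<nu>2_def)
  have null1: "N \<in> null_sets \<nu>1" if "N \<in> null_sets lborel" for N
    using that absolutely_continuousI_density[of "\<lambda>z. ennreal (max (g z) 0)" lborel]
    unfolding \<nu>1_def absolutely_continuous_def by auto
  have le_box: "emeasure \<nu>1 (cbox c d) \<le> emeasure \<nu>2 (cbox c d)" if "box c d \<noteq> {}" "dist c d < r" for c d
  proof -
    have i: "integrable lborel (\<lambda>z. indicator (cbox c d) z * g z)" using int[of c d] by (simp add: set_integrable_def)
    have i1: "integrable lborel (\<lambda>z. indicator (cbox c d) z * max (g z) 0)"
      by (rule Bochner_Integration.integrable_bound[OF i]) (auto simp: abs_mult indicator_def)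
    have i0: "integrable lborel (\<lambda>z. T * indicator (cbox c d) z)"
      by (intro integrable_mult_right integrable_real_indicator) (auto simp: emeasure_lborel_cbox_eq)
    have i2': "integrable lborel (\<lambda>z. indicator (cbox c d) z * max (- g z) 0)"
      by (rule Bochner_Integration.integrable_bound[OF i]) (auto simp: abs_mult indicator_def)
    then have i2: "integrable lborel (\<lambda>z. indicator (cbox c d) z * max (- g z) 0 + T * indicator (cbox c d) z)"
      using i0 by auto
    have "emeasure \<nu>1 (cbox c d) = (\<integral>\<^sup>+z. ennreal (indicator (cbox c d) z * max (g z) 0) \<partial>lborel)"
      unfolding \<nu>1_def by (subst emeasure_density) (auto intro!: nn_integral_cong simp: indicator_def)
    also have "\<dots> = ennreal (LINT z|lborel. indicator (cbox c d) z * max (g z) 0)"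
      by (rule nn_integral_eq_integral[OF i1]) auto
    also have "\<dots> \<le> ennreal (LINT z|lborel. indicator (cbox c d) z * max (- g z) 0 + T * indicator (cbox c d) z)"
    proof (rule ennreal_leI)
      have "(LINT z|lborel. indicator (cbox c d) z * max (g z) 0) - (LINT z|lborel. indicator (cbox c d) z * max (- g z) 0)
        = (LINT z|lborel. indicator (cbox c d) z * max (g z) 0 - indicator (cbox c d) z * max (- g z) 0)"
        using i1 i2' by simp
      also have "\<dots> = (LINT z:cbox c d|lborel. g z)"
        unfolding set_lebesgue_integral_def by (intro Bochner_Integration.integral_cong) (auto simp: indicator_def)
      also have "\<dots> \<le> T * measure lborel (cbox c d)" by (rule box[OF that])
      finally show "(LINT z|lborel. indicator (cbox c d) z * max (g z) 0) \<le> (LINT z|lborel. indicator (cbox c d) z * max (- g z) 0 + T * indicator (cbox c d) z)"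
        using i2' i0 by simp
    qed
    also have "\<dots> = (\<integral>\<^sup>+z. ennreal (indicator (cbox c d) z * max (- g z) 0 + T * indicator (cbox c d) z) \<partial>lborel)"
      by (rule nn_integral_eq_integral[OF i2, symmetric]) (use T in auto)
    also have "\<dots> = emeasure \<nu>2 (cbox c d)"
      unfolding \<nu>2_def by (subst emeasure_density) (auto intro!: nn_integral_cong simp: indicator_def)
    finally show ?thesis .
  qed
  have le_open: "emeasure \<nu>1 U \<le> emeasure \<nu>2 U" if U: "open U" and Uab: "U \<subseteq> cbox a b" "box a b \<noteq> {}" for U a b
  proof -
    \<comment> \<open>The covering lemma picks its tags in U, so the value off U is arbitrary. Each
      box of the cover lies in U and in a ball of radius r/3, so its corners are less than r
      apart.\<close>
    define \<gamma> where "\<gamma> x = (if x \<in> U then U \<inter> ball x (r / 3) else ball x 1)" for x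
    have "gauge \<gamma>" using U r by (auto simp: gauge_def \<gamma>_def)
    obtain \<D> where D: "countable \<D>" "\<And>K. K \<in> \<D> \<Longrightarrow> interior K \<noteq> {} \<and> (\<exists>c d. K = cbox c d)"
      "pairwise (\<lambda>A B. interior A \<inter> interior B = {}) \<D>"
      "\<And>K. K \<in> \<D> \<Longrightarrow> \<exists>x \<in> U \<inter> K. K \<subseteq> \<gamma> x" "U \<subseteq> \<Union>\<D>"
      by (rule covering_lemma[OF Uab \<open>gauge \<gamma>\<close>]) blast
    have box: "\<exists>c d. K = cbox c d \<and> box c d \<noteq> {} \<and> dist c d < r" and KU: "K \<subseteq> U" if K: "K \<in> \<D>" for K
    proof -
      obtain c d where cd: "K = cbox c d" using D(2)[OF K] by blast
      then have ne: "box c d \<noteq> {}" using D(2)[OF K] by simp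
      then have mem: "c \<in> K" "d \<in> K" unfolding cd using box_subset_cbox[of c d] by (auto simp: mem_box box_eq_empty)
      obtain x where x: "x \<in> U" "K \<subseteq> \<gamma> x" using D(4)[OF K] by blast
      then have sub: "K \<subseteq> U" "K \<subseteq> ball x (r / 3)" by (auto simp: \<gamma>_def)
      then have "dist x c < r / 3" "dist x d < r / 3" using mem by auto
      then have "dist c d < r" using dist_triangle3[of c d x] r by linarith
      then show "\<exists>c d. K = cbox c d \<and> box c d \<noteq> {} \<and> dist c d < r" using cd ne by blast
      show "K \<subseteq> U" by fact
    qed
    \<comment> \<open>The boxes may share boundary points. Measures are therefore summed over the
      disjoint interiors, and the boundaries are discarded as null sets.\<close>
    let ?I = "\<Union>K\<in>\<D>. interior K" and ?F = "\<Union>K\<in>\<D>. K - interior K"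
    have fr: "K - interior K \<in> null_sets lborel" if K: "K \<in> \<D>" for K
    proof -
      obtain c d where cd: "K = cbox c d" using D(2)[OF K] by blast
      have "K - interior K \<in> null_sets lebesgue"
        using negligible_frontier_interval[of c d] by (simp add: cd negligible_iff_null_sets)
      moreover have "K - interior K \<in> sets lborel" unfolding cd by simp
      ultimately show ?thesis by (simp add: null_sets_def)
    qed
    have Fnull: "?F \<in> null_sets lborel" by (rule null_sets_UN'[OF D(1) fr])
    have "?I \<union> ?F = (\<Union>K\<in>\<D>. interior K \<union> (K - interior K))" by auto
    also have "\<dots> = \<Union>\<D>"
    proof -
      have "interior K \<union> (K - interior K) = K" for K :: "'a set" using interior_subset[of K] by auto
      then show ?thesis by simp
    qed
    also have "\<dots> = U" using D(5) KU by blast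
    finally have UIF: "U = ?I \<union> ?F" ..
    have disj: "disjoint_family_on interior \<D>" using D(3) by (auto simp: disjoint_family_on_def pairwise_def)
    have Imeas: "?I \<in> sets borel" by (intro borel_open open_UN) auto
    have "emeasure \<nu>1 U \<le> emeasure \<nu>1 ?I + emeasure \<nu>1 ?F"
      unfolding UIF using Imeas Fnull by (intro emeasure_subadditive) (auto simp: null_sets_def)
    also have "emeasure \<nu>1 ?F = 0" using null1[OF Fnull] by (auto simp: null_sets_def)
    also have "emeasure \<nu>1 ?I + 0 = (\<integral>\<^sup>+K. emeasure \<nu>1 (interior K) \<partial>count_space \<D>)"
      by (simp, rule emeasure_UN_countable) (use D(1) disj in \<open>auto intro!: borel_open\<close>)
    also have "\<dots> \<le> (\<integral>\<^sup>+K. emeasure \<nu>2 (interior K) \<partial>count_space \<D>)"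
    proof (intro nn_integral_mono)
      fix K assume "K \<in> space (count_space \<D>)"
      then have K: "K \<in> \<D>" by simp
      obtain c d where cd: "K = cbox c d" "box c d \<noteq> {}" "dist c d < r" using box[OF K] by blast
      have "emeasure \<nu>1 (interior K) \<le> emeasure \<nu>1 K"
        by (rule emeasure_mono[OF interior_subset]) (simp add: cd(1))
      also have "\<dots> \<le> emeasure \<nu>2 K" unfolding cd(1) by (rule le_box[OF cd(2,3)])
      also have "\<dots> = emeasure \<nu>2 (interior K)"
      proof -
        have "K - interior K \<in> null_sets \<nu>2"
          using fr[OF K] absolutely_continuousI_density[of "\<lambda>z. ennreal (max (- g z) 0 + T)" lborel]
          unfolding \<nu>2_def absolutely_continuous_def by auto
        then have "emeasure \<nu>2 (interior K \<union> (K - interior K)) = emeasure \<nu>2 (interior K)"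
          by (intro emeasure_Un_null_set) (auto simp: borel_open)
        moreover have "interior K \<union> (K - interior K) = K" using interior_subset[of K] by auto
        ultimately show ?thesis by simp
      qed
      finally show "emeasure \<nu>1 (interior K) \<le> emeasure \<nu>2 (interior K)" .
    qed
    also have "\<dots> = emeasure \<nu>2 ?I"
      by (rule emeasure_UN_countable[symmetric]) (use D(1) disj in \<open>auto intro!: borel_open\<close>)
    also have "\<dots> \<le> emeasure \<nu>2 U" by (rule emeasure_mono) (use UIF U in \<open>auto intro!: borel_open\<close>)
    finally show ?thesis .
  qed
  have null: "{z \<in> box a b. g z \<ge> T + h} \<in> null_sets lborel" (is "?E \<in> _") if h: "h > 0" and ab: "box a b \<noteq> {}" for a b h
  proof -
    \<comment> \<open>Outer regularity is applied to a finite measure, so \<nu>2 is cut off outside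
      the box.\<close>
    define M where "M = density lborel (\<lambda>z. indicator (cbox a b) z * ennreal (max (- g z) 0 + T))"
    have E: "?E \<in> sets borel" by measurable
    have M2: "emeasure M A = emeasure \<nu>2 (A \<inter> cbox a b)" if [measurable]: "A \<in> sets borel" for A
      unfolding M_def \<nu>2_def by (subst (1 2) emeasure_density) (auto intro!: nn_integral_cong simp: indicator_def)
    have fin: "emeasure M (space M) \<noteq> \<infinity>"
    proof -
      have "integrable lborel (\<lambda>z. indicator (cbox a b) z * g z)" using int[of a b] by (simp add: set_integrable_def)
      then have "integrable lborel (\<lambda>z. \<bar>indicator (cbox a b) z * g z\<bar> + T * indicator (cbox a b) z)"
        by (intro Bochner_Integration.integrable_add integrable_abs integrable_mult_right integrable_real_indicator) (auto simp: emeasure_lborel_cbox_eq)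
      then have "(\<integral>\<^sup>+z. ennreal (\<bar>indicator (cbox a b) z * g z\<bar> + T * indicator (cbox a b) z) \<partial>lborel) \<noteq> \<infinity>"
        using T by (subst nn_integral_eq_integral) auto
      moreover have "emeasure M (space M) \<le> (\<integral>\<^sup>+z. ennreal (\<bar>indicator (cbox a b) z * g z\<bar> + T * indicator (cbox a b) z) \<partial>lborel)"
        unfolding M_def by (subst emeasure_density) (auto intro!: nn_integral_mono ennreal_leI simp: indicator_def)
      ultimately show ?thesis by (auto simp: top_unique)
    qed
    have "emeasure \<nu>1 ?E \<le> emeasure M U" if "?E \<subseteq> U" "open U" for U
    proof -
      have "emeasure \<nu>1 ?E \<le> emeasure \<nu>1 (U \<inter> box a b)" using that by (intro emeasure_mono) (auto intro!: borel_open)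
      also have "\<dots> \<le> emeasure \<nu>2 (U \<inter> box a b)"
        using that box_subset_cbox[of a b] by (intro le_open[OF _ _ ab]) auto
      also have "\<dots> \<le> emeasure \<nu>2 (U \<inter> cbox a b)"
        using that box_subset_cbox[of a b] by (intro emeasure_mono) (auto intro: borel_open)
      also have "\<dots> = emeasure M U" using that by (intro M2[symmetric]) auto
      finally show ?thesis .
    qed
    then have "emeasure \<nu>1 ?E \<le> (INF U\<in>{U. ?E \<subseteq> U \<and> open U}. emeasure M U)" by (auto intro!: INF_greatest)
    also have "\<dots> = emeasure M ?E"
      by (rule outer_regular[symmetric, OF _ fin E]) (simp add: M_def)
    also have "\<dots> = emeasure \<nu>2 (?E \<inter> cbox a b)" by (rule M2[OF E])
    also have "?E \<inter> cbox a b = ?E" using box_subset_cbox[of a b] by auto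
    finally have le: "emeasure \<nu>1 ?E \<le> emeasure \<nu>2 ?E" .
    have "emeasure \<nu>2 ?E = (\<integral>\<^sup>+z. ennreal T * indicator ?E z \<partial>lborel)"
      unfolding \<nu>2_def using E T h by (subst emeasure_density) (auto intro!: nn_integral_cong simp: indicator_def ennreal_neg)
    then have e2: "emeasure \<nu>2 ?E = ennreal T * emeasure lborel ?E"
      using E by (simp add: nn_integral_cmult_indicator)
    have "(\<integral>\<^sup>+z. ennreal (T + h) * indicator ?E z \<partial>lborel) \<le> emeasure \<nu>1 ?E"
      unfolding \<nu>1_def using E T h by (subst emeasure_density) (auto intro!: nn_integral_mono ennreal_leI simp: indicator_def simp del: ennreal_plus)
    then have e1: "ennreal (T + h) * emeasure lborel ?E \<le> emeasure \<nu>1 ?E"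
      using E by (simp add: nn_integral_cmult_indicator)
    have "emeasure lborel ?E \<le> emeasure lborel (cbox a b)" using box_subset_cbox[of a b] by (intro emeasure_mono) auto
    also have "\<dots> < \<infinity>" by (simp add: emeasure_lborel_cbox_eq)
    finally obtain m where m: "emeasure lborel ?E = ennreal m" "0 \<le> m" by (cases "emeasure lborel ?E") auto
    have "ennreal ((T + h) * m) \<le> ennreal (T * m)"
      using order_trans[OF e1 order_trans[OF le eq_refl[OF e2]]] T h m by (simp add: ennreal_mult)
    then have "(T + h) * m \<le> T * m" using T m by (subst (asm) ennreal_le_iff) auto
    then have "m = 0" using h m by (simp add: distrib_right mult_le_0_iff)
    then show ?thesis using m E by (simp add: null_sets_def)
  qed
  let ?B = "\<lambda>n. box (- (real (Suc n) *\<^sub>R One)) (real (Suc n) *\<^sub>R One :: 'a)"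
  have "(\<Union>n. \<Union>m. {z \<in> ?B n. g z \<ge> T + 1 / real (Suc m)}) \<in> null_sets lborel"
    by (intro null_sets_UN null) (auto simp: box_eq_empty)
  moreover have "{z. \<not> g z \<le> T} \<subseteq> (\<Union>n. \<Union>m. {z \<in> ?B n. g z \<ge> T + 1 / real (Suc m)})"
  proof
    fix z assume "z \<in> {z. \<not> g z \<le> T}"
    then have "0 < g z - T" by auto
    then obtain m where m: "inverse (real (Suc m)) < g z - T" using reals_Archimedean by blast
    obtain n where n: "norm z < real n" using reals_Archimedean2 by blast
    have "z \<in> ?B n" unfolding mem_box
    proof (intro ballI conjI)
      fix i :: 'a assume i: "i \<in> Basis"
      have "\<bar>z \<bullet> i\<bar> < real (Suc n)" using Basis_le_norm[OF i, of z] n by simp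
      then show "- (real (Suc n) *\<^sub>R One) \<bullet> i < z \<bullet> i" "z \<bullet> i < real (Suc n) *\<^sub>R One \<bullet> i"
        using i by (auto simp: inner_sum_left_Basis)
    qed
    moreover have "g z \<ge> T + 1 / real (Suc m)" using m by (simp add: inverse_eq_divide)
    ultimately show "z \<in> (\<Union>n. \<Union>m. {z \<in> ?B n. g z \<ge> T + 1 / real (Suc m)})" by blast
  qed
  ultimately show ?thesis by (auto intro: AE_I')
qed

section \<open>Borel representatives and composition with rotations\<close>

lemma completion_ex_borel_measurable_complex:
  fixes F :: "'a \<Rightarrow> complex"
  assumes "F \<in> borel_measurable (completion M)"
  shows "\<exists>F'\<in>borel_measurable M. AE z in M. F z = F' z"
proof -
  have [measurable]: "F \<in> borel_measurable (completion M)" by fact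
  obtain u where u: "u \<in> borel_measurable M" "AE z in M. Re (F z) = u z"
    using completion_ex_borel_measurable_real[of "\<lambda>z. Re (F z)" M] by auto
  obtain v where v: "v \<in> borel_measurable M" "AE z in M. Im (F z) = v z"
    using completion_ex_borel_measurable_real[of "\<lambda>z. Im (F z)" M] by auto
  have "(\<lambda>z. Complex (u z) (v z)) \<in> borel_measurable M"
    unfolding Complex_eq by (intro borel_measurable_add borel_measurable_times borel_measurable_const measurable_compose[OF u(1)] measurable_compose[OF v(1)] borel_measurable_of_real)
  moreover have "AE z in M. F z = Complex (u z) (v z)"
    using u(2) v(2) by eventually_elim (simp add: complex_eq_iff)
  ultimately show ?thesis by (intro bexI[of _ "\<lambda>z. Complex (u z) (v z)"])
qed

text \<open>Lebesgue measure is complete, so the values of g on N may be arbitrary.\<close>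

lemma measurable_lebesgue_AE_cong:
  fixes f g :: "'a::euclidean_space \<Rightarrow> 'b::topological_space"
  assumes f: "f \<in> borel_measurable lebesgue" and N: "negligible N" and fg: "\<And>z. z \<notin> N \<Longrightarrow> f z = g z"
  shows "g \<in> borel_measurable lebesgue"
proof (rule measurableI)
  fix A :: "'b set" assume A: "A \<in> sets borel"
  have "g -` A \<inter> space lebesgue = (f -` A \<inter> space lebesgue - N) \<union> (g -` A \<inter> N)" using fg by auto
  moreover have "f -` A \<inter> space lebesgue \<in> sets lebesgue" by (rule measurable_sets[OF f A])
  moreover have "N \<in> sets lebesgue" "g -` A \<inter> N \<in> sets lebesgue"
    using N negligible_subset[OF N, of "g -` A \<inter> N"] by (auto intro: negligible_imp_sets)
  ultimately show "g -` A \<inter> space lebesgue \<in> sets lebesgue" by (metis sets.Diff sets.Un)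
qed auto

lemma rotation_inverse: "rotation (- \<theta>) (rotation \<theta> z) = z" "rotation \<theta> (rotation (- \<theta>) z) = z"
proof -
  have "cos \<theta> * cos \<theta> + sin \<theta> * sin \<theta> = 1" using sin_cos_squared_add3[of \<theta>] by simp
  then have 1: "x * (cos \<theta> * cos \<theta>) + x * (sin \<theta> * sin \<theta>) = x" for x
    unfolding distrib_left[symmetric] by simp
  obtain x y where z: "z = (x, y)" by force
  show "rotation (- \<theta>) (rotation \<theta> z) = z" "rotation \<theta> (rotation (- \<theta>) z) = z"
    unfolding z rotation_def by (simp_all add: algebra_simps 1)
qed

lemma linear_rotation: "linear (rotation \<theta>)"
  by (intro linearI) (simp_all add: rotation_def case_prod_beta algebra_simps)

lemma negligible_vimage_rotation:
  assumes "negligible N" shows "negligible (rotation \<theta> -` N)"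
proof -
  have "rotation \<theta> -` N = rotation (- \<theta>) ` N"
  proof (intro equalityI subsetI)
    fix x assume "x \<in> rotation \<theta> -` N"
    then show "x \<in> rotation (- \<theta>) ` N" by (intro image_eqI[of _ _ "rotation \<theta> x"]) (simp_all add: rotation_inverse)
  next
    fix x assume "x \<in> rotation (- \<theta>) ` N"
    then show "x \<in> rotation \<theta> -` N" by (auto simp: rotation_inverse)
  qed
  then show ?thesis using assms
    by (simp add: negligible_differentiable_image_negligible linear_imp_differentiable_on[OF linear_rotation])
qed

text \<open>Composing a Lebesgue measurable function with a continuous map can destroy
  measurability. A Borel representative composes well, and the set where it differs from F pulls
  back to a negligible set, being the image of one under the inverse rotation.\<close>

lemma rotation_measurable_bounded:
  assumes F: "F \<in> borel_measurable lebesgue" and T: "AE z in lebesgue. cmod (F z) \<le> T"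
  shows "F \<circ> rotation \<theta> \<in> borel_measurable lebesgue" "AE z in lebesgue. cmod ((F \<circ> rotation \<theta>) z) \<le> T"
proof -
  obtain F' where F': "F' \<in> borel_measurable lborel" "AE z in lborel. F z = F' z"
    using completion_ex_borel_measurable_complex[OF F] by blast
  define N where "N = {z. F z \<noteq> F' z}"
  have negl: "negligible {z. \<not> P z}" if ae: "AE z in lebesgue. P z" for P :: "real \<times> real \<Rightarrow> bool"
  proof -
    obtain A where "A \<in> null_sets lebesgue" "{z. \<not> P z} \<subseteq> A" using ae unfolding eventually_ae_filter by auto
    then show ?thesis using negligible_subset by (auto simp: negligible_iff_null_sets)
  qed
  have N: "negligible N" unfolding N_def by (rule negl[OF AE_completion[OF F'(2)]])
  have cont: "continuous_on UNIV (rotation \<theta>)" by (intro linear_continuous_on linear_conv_bounded_linear[THEN iffD1] linear_rotation)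
  have "F' \<circ> rotation \<theta> \<in> borel_measurable borel"
    using measurable_comp[OF borel_measurable_continuous_onI[OF cont], of F' borel] F'(1) by simp
  then have "F' \<circ> rotation \<theta> \<in> borel_measurable lebesgue" by (intro measurable_completion) simp
  then show "F \<circ> rotation \<theta> \<in> borel_measurable lebesgue"
    by (rule measurable_lebesgue_AE_cong[OF _ negligible_vimage_rotation[OF N, of \<theta>]]) (auto simp: N_def)
  from negligible_vimage_rotation[OF negl[OF T], of \<theta>]
  show "AE z in lebesgue. cmod ((F \<circ> rotation \<theta>) z) \<le> T" 
    by (intro AE_I'[of "rotation \<theta> -` {z. \<not> cmod (F z) \<le> T}"]) (auto simp: negligible_iff_null_sets)
qed

section \<open>Averages of Bessel potentials\<close>

text \<open>Half of the exponent pays for the small factor; the other half is kept as a Gaussian of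
  twice the variance, whose normalisation accounts for the 2 in front.\<close>

lemma gauss_tail_le:
  assumes v: "0 < v" and r: "0 \<le> r" "r \<le> norm (z - a)"
  shows "gauss v a z \<le> 2 * exp (- r\<^sup>2 / (4 * v)) * gauss (2 * v) a z"
proof -
  have "r\<^sup>2 \<le> (norm (z - a))\<^sup>2" using r by (intro power_mono) auto
  then have "- (norm (z - a))\<^sup>2 / (2 * v) \<le> - r\<^sup>2 / (4 * v) + - (norm (z - a))\<^sup>2 / (4 * v)"
    using v by (simp add: field_simps)
  then have "exp (- (norm (z - a))\<^sup>2 / (2 * v)) \<le> exp (- r\<^sup>2 / (4 * v)) * exp (- (norm (z - a))\<^sup>2 / (4 * v))"
    unfolding exp_add[symmetric] by simp
  then show ?thesis using v unfolding gauss_def by (simp add: field_simps)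
qed

text \<open>The heat flow at time \<open>v / 2\<close> of the indicator function of \<open>R\<close>.\<close>

definition heat :: "real \<Rightarrow> (real \<times> real) set \<Rightarrow> real \<times> real \<Rightarrow> real" where
  "heat v R z = (LINT a|lborel. indicator R a * gauss v a z)"

lemma integrable_indicator_gauss:
  assumes "0 < v" "R \<in> sets borel"
  shows "integrable lborel (\<lambda>a. indicator R a * gauss v a z)"
proof (rule Bochner_Integration.integrable_bound[OF integrable_gauss[OF assms(1), of z]])
  show "AE a in lborel. norm (indicator R a * gauss v a z) \<le> norm (gauss v z a)"
    by (intro AE_I2) (auto simp: indicator_def gauss_commute[of v z])
qed (use assms in measurable)

lemma borel_measurable_heat[measurable]: assumes [measurable]: "R \<in> sets borel" shows "heat v R \<in> borel_measurable borel"
  unfolding heat_def[abs_def] by measurable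

lemma heat_nonneg: "0 < v \<Longrightarrow> 0 \<le> heat v R z"
  unfolding heat_def by (intro Bochner_Integration.integral_nonneg) (auto intro!: mult_nonneg_nonneg gauss_nonneg)

lemma heat_le_1: assumes v: "0 < v" and R: "R \<in> sets borel" shows "heat v R z \<le> 1"
proof -
  have "heat v R z \<le> (LINT a|lborel. gauss v z a)"
    unfolding heat_def
    by (intro integral_mono integrable_indicator_gauss integrable_gauss v R) (auto simp: indicator_def gauss_commute[of v z] gauss_nonneg[OF v])
  then show ?thesis by (simp add: integral_gauss[OF v])
qed

lemma ennreal_heat:
  assumes v: "0 < v" and R: "R \<in> sets borel"
  shows "ennreal (heat v R z) = (\<integral>\<^sup>+a. indicator R a * ennreal (gauss v a z) \<partial>lborel)"
proof -
  have "ennreal (heat v R z) = (\<integral>\<^sup>+a. ennreal (indicator R a * gauss v a z) \<partial>lborel)"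
    unfolding heat_def by (intro nn_integral_eq_integral[symmetric] integrable_indicator_gauss v R) (auto intro!: mult_nonneg_nonneg gauss_nonneg[OF v])
  also have "\<dots> = (\<integral>\<^sup>+a. indicator R a * ennreal (gauss v a z) \<partial>lborel)"
    by (intro nn_integral_cong) (auto simp: indicator_def)
  finally show ?thesis .
qed

lemma nn_integral_heat:
  assumes v: "0 < v" and R[measurable]: "R \<in> sets borel"
  shows "(\<integral>\<^sup>+z. heat v R z \<partial>lborel) = emeasure lborel R"
proof -
  have "(\<integral>\<^sup>+z. heat v R z \<partial>lborel) = (\<integral>\<^sup>+z. \<integral>\<^sup>+a. indicator R a * ennreal (gauss v a z) \<partial>lborel \<partial>lborel)"
    by (simp only: ennreal_heat[OF v R])
  also have "\<dots> = (\<integral>\<^sup>+a. \<integral>\<^sup>+z. indicator R a * ennreal (gauss v a z) \<partial>lborel \<partial>lborel)"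
    by (rule lborel_pair.Fubini') measurable
  also have "\<dots> = (\<integral>\<^sup>+a. indicator R a \<partial>lborel)"
    using nn_integral_gauss[OF v] by (simp add: nn_integral_cmult)
  finally show ?thesis by simp
qed

text \<open>The dominating function for the limit v to 0. A Gaussian is suitable because its product
  with a function in L^p is integrable. Within twice the radius of R the bound
  \<open>heat_le_1\<close> suffices; farther out, every point of R is at distance at least
  \<open>norm z / 2\<close> from z.\<close>

lemma heat_dominated:
  assumes R[measurable]: "R \<in> sets borel" and "bounded R"
  shows "\<exists>M. \<forall>v z. 0 < v \<longrightarrow> v \<le> 1 \<longrightarrow> heat v R z \<le> M * gauss 8 0 z"
proof -
  obtain \<rho> where \<rho>: "\<rho> > 0" "\<And>a. a \<in> R \<Longrightarrow> norm a \<le> \<rho>" using \<open>bounded R\<close> by (auto simp: bounded_pos)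
  have Rfin: "emeasure lborel R < \<infinity>" using \<open>bounded R\<close> by (rule emeasure_bounded_finite)
  define m where "m = measure lborel R"
  have m0: "m \<ge> 0" by (simp add: m_def)
  define M where "M = 16 * pi * (exp (\<rho>\<^sup>2 / 4) + m * (4 / \<rho>\<^sup>2))"
  have e16: "exp (- (norm z)\<^sup>2 / 16) = 16 * pi * gauss 8 0 z" for z by (simp add: gauss_def)
  have g0: "gauss 8 0 z \<ge> 0" for z by (rule gauss_nonneg) simp
  have "heat v R z \<le> M * gauss 8 0 z" if v: "0 < v" "v \<le> 1" for v z
  proof (cases "norm z < 2 * \<rho>")
    case True
    have "heat v R z \<le> 1" by (rule heat_le_1[OF v(1) R])
    also have "1 \<le> exp (\<rho>\<^sup>2 / 4) * exp (- (norm z)\<^sup>2 / 16)"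
    proof -
      have "(norm z)\<^sup>2 \<le> (2 * \<rho>)\<^sup>2" using True by (intro power_mono) auto
      then show ?thesis unfolding exp_add[symmetric] by (simp add: power_mult_distrib)
    qed
    also have "\<dots> = 16 * pi * exp (\<rho>\<^sup>2 / 4) * gauss 8 0 z" unfolding e16 by simp
    also have "\<dots> \<le> M * gauss 8 0 z" unfolding M_def using \<rho> m0 by (intro mult_right_mono g0) simp
    finally show ?thesis .
  next
    case False
    then have z: "norm z \<ge> 2 * \<rho>" by simp
    then have zp: "norm z > 0" using \<rho> by linarith
    let ?b = "(4 / \<rho>\<^sup>2) * exp (- (norm z)\<^sup>2 / 16)"
    have "gauss v a z \<le> ?b" if "a \<in> R" for a
    proof -
      have "norm z \<le> norm (z - a) + norm a" by (metis diff_add_cancel norm_triangle_ineq)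
      then have "norm z / 2 \<le> norm (z - a)" using \<rho>(2)[OF that] z by linarith
      then have "(norm z / 2)\<^sup>2 \<le> (norm (z - a))\<^sup>2" by (intro power_mono) auto
      then have zz: "(norm z)\<^sup>2 \<le> 4 * (norm (z - a))\<^sup>2" by (simp add: power_divide)
      \<comment> \<open>In terms of y, the singular factor \<open>1 / v\<close> is absorbed:
        \<open>exp (- (2 * y)) / v = 16 / (norm z)\<^sup>2 * (y * exp (- (2 * y)))\<close>. Since v
        \<le> 1, y is at least \<open>(norm z)\<^sup>2 / 16\<close>, the exponent of a Gaussian of
        variance 8.\<close>
      define y where "y = (norm z)\<^sup>2 / (16 * v)"
      have y: "y \<ge> (norm z)\<^sup>2 / 16" "y > 0" using v zp by (auto simp: y_def field_simps)
      have "gauss v a z \<le> exp (- (2 * y)) / (2 * pi * v)"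
        unfolding gauss_def y_def using zz v by (intro divide_right_mono) (auto simp: field_simps)
      also have "\<dots> \<le> exp (- (2 * y)) / v"
        using v pi_ge_two by (intro divide_left_mono) auto
      also have "\<dots> = 16 / (norm z)\<^sup>2 * (y * exp (- (2 * y)))" using v zp by (simp add: y_def)
      also have "\<dots> \<le> 4 / \<rho>\<^sup>2 * (y * exp (- (2 * y)))"
      proof (rule mult_right_mono)
        have "(2 * \<rho>)\<^sup>2 \<le> (norm z)\<^sup>2" using z \<rho> by (intro power_mono) auto
        then have "16 / (norm z)\<^sup>2 \<le> 16 / (2 * \<rho>)\<^sup>2" using \<rho>(1) zp by (intro divide_left_mono) auto
        then show "16 / (norm z)\<^sup>2 \<le> 4 / \<rho>\<^sup>2" by (simp add: power_mult_distrib)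
      qed (use y in auto)
      also have "\<dots> \<le> 4 / \<rho>\<^sup>2 * exp (- (norm z)\<^sup>2 / 16)"
      proof (rule mult_left_mono)
        have "y \<le> exp y" using exp_ge_add_one_self[of y] by linarith
        then have "y * exp (- (2 * y)) \<le> exp y * exp (- (2 * y))" by (intro mult_right_mono) auto
        also have "\<dots> = exp (- y)" by (simp flip: exp_add)
        also have "\<dots> \<le> exp (- (norm z)\<^sup>2 / 16)" using y by simp
        finally show "y * exp (- (2 * y)) \<le> exp (- (norm z)\<^sup>2 / 16)" .
      qed simp
      finally show ?thesis .
    qed
    then have le: "indicator R a * gauss v a z \<le> indicator R a * ?b" for a by (auto simp: indicator_def)
    have "heat v R z \<le> (LINT a|lborel. indicator R a * ?b)"
      unfolding heat_def using Rfin by (intro integral_mono le integrable_indicator_gauss v R integrable_mult_left integrable_real_indicator) auto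
    also have "\<dots> = m * ?b" by (simp add: m_def)
    also have "\<dots> = 16 * pi * (m * (4 / \<rho>\<^sup>2)) * gauss 8 0 z" unfolding e16 by simp
    also have "\<dots> \<le> M * gauss 8 0 z" unfolding M_def by (intro mult_right_mono mult_left_mono g0) auto
    finally show ?thesis .
  qed
  then show ?thesis by blast
qed

text \<open>The tail bound is integrated over a, and \<open>x \<le> exp x\<close> turns its
  exponentially small factor into a multiple of v.\<close>

lemma gauss_concentrates:
  assumes v: "0 < v" and r: "0 < r" and A: "A \<in> sets borel" and far: "\<And>a. a \<in> A \<Longrightarrow> r \<le> norm (z - a)"
  shows "heat v A z \<le> 8 / r\<^sup>2 * v"
proof -
  have "heat v A z \<le> (LINT a|lborel. 2 * exp (- r\<^sup>2 / (4 * v)) * gauss (2 * v) z a)"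
    unfolding heat_def
  proof (intro integral_mono integrable_indicator_gauss v A integrable_mult_right integrable_gauss)
    fix a
    show "indicator A a * gauss v a z \<le> 2 * exp (- r\<^sup>2 / (4 * v)) * gauss (2 * v) z a"
      using gauss_tail_le[OF v less_imp_le[OF r] far, of a] r v gauss_nonneg[of "2 * v" z a]
      by (auto simp: indicator_def gauss_commute[of _ z])
  qed (use v in auto)
  also have "\<dots> = 2 * exp (- r\<^sup>2 / (4 * v))" using v by (simp add: integral_gauss)
  also have "\<dots> \<le> 2 * (4 * v / r\<^sup>2)"
  proof (rule mult_left_mono)
    have "r\<^sup>2 / (4 * v) \<le> exp (r\<^sup>2 / (4 * v))" using exp_ge_add_one_self[of "r\<^sup>2 / (4 * v)"] by linarith
    then have "1 / exp (r\<^sup>2 / (4 * v)) \<le> 1 / (r\<^sup>2 / (4 * v))" using r v by (intro divide_left_mono) auto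
    then show "exp (- r\<^sup>2 / (4 * v)) \<le> 4 * v / r\<^sup>2" using r v by (simp add: exp_minus inverse_eq_divide)
  qed simp
  finally show ?thesis by simp
qed

text \<open>A point off the frontier has a ball inside R or inside the complement, and the mass
  outside this ball vanishes in the limit. An interior point of R is handled by passing to the
  complement.\<close>

lemma heat_tendsto:
  assumes R: "R \<in> sets borel" and z: "z \<notin> frontier R"
  shows "(\<lambda>n. heat (1 / real (Suc n)) R z) \<longlonglongrightarrow> indicator R z"
proof -
  have v: "0 < 1 / real (Suc n)" for n by simp
  have lim: "(\<lambda>n. c * (1 / real (Suc n))) \<longlonglongrightarrow> 0" for c
    using tendsto_mult[OF tendsto_const[of c] LIMSEQ_inverse_real_of_nat] by (simp add: inverse_eq_divide)
  consider "z \<in> interior R" | "z \<notin> closure R" using z by (auto simp: frontier_def)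
  then show ?thesis
  proof cases
    case 1
    then obtain r where r: "r > 0" "ball z r \<subseteq> R" by (auto simp: mem_interior)
    have "z \<in> R" using 1 interior_subset by auto
    have co: "heat w R z = 1 - heat w (- R) z" if w: "0 < w" for w
    proof -
      have "heat w R z + heat w (- R) z = (LINT a|lborel. indicator R a * gauss w a z + indicator (- R) a * gauss w a z)"
        unfolding heat_def using R w by (intro Bochner_Integration.integral_add[symmetric] integrable_indicator_gauss) auto
      also have "\<dots> = (LINT a|lborel. gauss w z a)"
        by (intro Bochner_Integration.integral_cong refl) (auto simp: indicator_def gauss_commute[of w z])
      finally show ?thesis by (simp add: integral_gauss[OF w])
    qed
    have "heat (1 / real (Suc n)) (- R) z \<le> 8 / r\<^sup>2 * (1 / real (Suc n))" for n
      using R r by (intro gauss_concentrates v) (force simp: dist_norm subset_iff)+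
    then have "(\<lambda>n. heat (1 / real (Suc n)) (- R) z) \<longlonglongrightarrow> 0"
      by (intro tendsto_sandwich[OF _ _ tendsto_const lim[of "8 / r\<^sup>2"]] always_eventually allI heat_nonneg v)
    from tendsto_diff[OF tendsto_const[of 1] this]
    show ?thesis using \<open>z \<in> R\<close> by (simp only: co[OF v]) simp
  next
    case 2
    then obtain r where r: "r > 0" "ball z r \<subseteq> - closure R" using open_contains_ball[of "- closure R"] by auto
    have "z \<notin> R" using 2 closure_subset by auto
    have "heat (1 / real (Suc n)) R z \<le> 8 / r\<^sup>2 * (1 / real (Suc n))" for n
    proof (rule gauss_concentrates[OF v r(1) R])
      fix a assume "a \<in> R"
      then have "a \<notin> ball z r" using r closure_subset by blast
      then show "r \<le> norm (z - a)" by (simp add: dist_norm)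
    qed
    then have "(\<lambda>n. heat (1 / real (Suc n)) R z) \<longlonglongrightarrow> 0"
      by (intro tendsto_sandwich[OF _ _ tendsto_const lim[of "8 / r\<^sup>2"]] always_eventually allI heat_nonneg v)
    then show ?thesis using \<open>z \<notin> R\<close> by simp
  qed
qed

section \<open>Gaussian regularisation of functions in L^p\<close>

locale Lp_function =
  fixes p :: real and F :: "real \<times> real \<Rightarrow> complex"
  assumes p: "2 < p" and F[measurable]: "F \<in> borel_measurable borel"
    and Fp: "integrable lborel (\<lambda>z. cmod (F z) powr p)"
begin

definition norm_p :: real where
  "norm_p = (LINT z|lborel. cmod (F z) powr p) powr (1 / p)"

lemma norm_p_nonneg: "0 \<le> norm_p" by (simp add: norm_p_def)

lemma nn_integral_powr: "(\<integral>\<^sup>+z. cmod (F z) powr p \<partial>lborel) \<le> ennreal (norm_p powr p)"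
proof -
  have "(LINT z|lborel. cmod (F z) powr p) \<ge> 0" by (intro Bochner_Integration.integral_nonneg) auto
  then have "norm_p powr p = (LINT z|lborel. cmod (F z) powr p)"
    using p by (simp add: norm_p_def powr_powr)
  then show ?thesis using nn_integral_eq_integral[OF Fp] by simp
qed

lemma nn_integral_mult_le:
  assumes "k \<in> borel_measurable borel" "\<And>z. 0 \<le> k z" "\<And>z. k z \<le> K" "0 < K" "0 < L" "(\<integral>\<^sup>+z. k z \<partial>lborel) \<le> ennreal L"
  shows "(\<integral>\<^sup>+z. cmod (F z) * k z \<partial>lborel) \<le> ennreal (norm_p * K powr (1/p) * L powr (1 - 1/p))"
  using assms p norm_p_nonneg nn_integral_powr by (intro nn_integral_mult_le_Lp) auto

lemma integrable_mult:
  assumes k[measurable]: "k \<in> borel_measurable borel" and "\<And>z. 0 \<le> k z" "\<And>z. k z \<le> K" "0 < K" "0 < L" "(\<integral>\<^sup>+z. k z \<partial>lborel) \<le> ennreal L"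
  shows "integrable lborel (\<lambda>z. F z * of_real (k z))"
proof (rule integrableI_bounded)
  have "(\<integral>\<^sup>+z. ennreal (norm (F z * of_real (k z))) \<partial>lborel) = (\<integral>\<^sup>+z. cmod (F z) * k z \<partial>lborel)"
    using assms(2) by (simp add: norm_mult)
  also have "\<dots> < \<infinity>" using nn_integral_mult_le[OF assms] by (simp add: le_less_trans)
  finally show "(\<integral>\<^sup>+z. ennreal (norm (F z * of_real (k z))) \<partial>lborel) < \<infinity>" .
qed measurable

lemma integrable_gauss: "0 < v \<Longrightarrow> integrable lborel (\<lambda>z. F z * of_real (gauss v a z))"
  using gauss_le[of v a] gauss_nonneg[of v a] nn_integral_gauss[of v a]
  by (intro integrable_mult[where K = "1 / (2 * pi * v)" and L = 1]) auto

text \<open>The convolution of F with a Gaussian. It is this function, and not F, that is a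
  Bessel-type potential of f pointwise.\<close>

definition smooth :: "real \<Rightarrow> real \<times> real \<Rightarrow> complex" where
  "smooth v a = (LINT z|lborel. F z * of_real (gauss v a z))"

lemma integrable_region:
  assumes R: "R \<in> sets borel" "bounded R"
  shows "integrable lborel (\<lambda>z. F z * of_real (indicator R z))"
proof -
  have fin: "emeasure lborel R < \<infinity>" by (rule emeasure_bounded_finite[OF R(2)])
  show ?thesis
  proof (rule integrable_mult[where K = 1 and L = "measure lborel R + 1"])
    have "(\<integral>\<^sup>+z. ennreal (indicator R z) \<partial>lborel) = ennreal (measure lborel R)"
      using R fin by (simp add: ennreal_indicator emeasure_eq_ennreal_measure)
    also have "\<dots> \<le> ennreal (measure lborel R + 1)" by (intro ennreal_leI) simp
    finally show "(\<integral>\<^sup>+z. ennreal (indicator R z) \<partial>lborel) \<le> ennreal (measure lborel R + 1)" .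
    show "0 < measure lborel R + 1" by (simp add: add_nonneg_pos)
  qed (use R in \<open>auto simp: indicator_def\<close>)
qed

text \<open>The Gaussian kernel is symmetric, so Fubini's theorem moves the regularisation from F to
  the indicator function of R.\<close>

lemma smooth_region:
  assumes R[measurable]: "R \<in> sets borel" and "bounded R" and v: "0 < v"
  shows "integrable lborel (\<lambda>a. smooth v a * of_real (indicator R a))"
    and "(LINT a|lborel. smooth v a * of_real (indicator R a)) = (LINT z|lborel. F z * of_real (heat v R z))"
proof -
  have fin: "emeasure lborel R < \<infinity>" by (rule emeasure_bounded_finite[OF \<open>bounded R\<close>])
  let ?h = "\<lambda>z a. F z * of_real (indicator R a * gauss v a z)"
  have ai: "integrable lborel (\<lambda>a. ?h z a)" for z
    using integrable_indicator_gauss[OF v R, of z] by (intro integrable_mult_right integrable_of_real)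
  have "integrable lborel (\<lambda>z. F z * of_real (heat v R z))"
  proof (rule integrable_mult[where K = 1 and L = "measure lborel R + 1"])
    have "(\<integral>\<^sup>+z. ennreal (heat v R z) \<partial>lborel) = ennreal (measure lborel R)"
      using fin by (simp add: nn_integral_heat[OF v R] emeasure_eq_ennreal_measure)
    also have "\<dots> \<le> ennreal (measure lborel R + 1)" by (intro ennreal_leI) simp
    finally show "(\<integral>\<^sup>+z. ennreal (heat v R z) \<partial>lborel) \<le> ennreal (measure lborel R + 1)" .
    show "0 < measure lborel R + 1" by (simp add: add_nonneg_pos)
  qed (auto intro: heat_nonneg[OF v] heat_le_1[OF v R])
  then have "integrable lborel (\<lambda>z. norm (F z * of_real (heat v R z)))" by (rule integrable_norm)
  moreover have "(LINT a|lborel. norm (?h z a)) = norm (F z * of_real (heat v R z))" for z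
  proof -
    have "norm (?h z a) = cmod (F z) * (indicator R a * gauss v a z)" for a
      using gauss_nonneg[OF v, of a z] by (simp add: norm_mult indicator_def)
    then have "(LINT a|lborel. norm (?h z a)) = cmod (F z) * heat v R z" by (simp add: heat_def)
    then show ?thesis using heat_nonneg[OF v, of R z] by (simp add: norm_mult)
  qed
  ultimately have int: "integrable (lborel \<Otimes>\<^sub>M lborel) (\<lambda>(z, a). ?h z a)"
    using ai by (intro lborel_pair.Fubini_integrable) auto
  have sm: "smooth v a * of_real (indicator R a) = (LINT z|lborel. ?h z a)" for a
    unfolding smooth_def integral_mult_left_zero[symmetric] by (intro Bochner_Integration.integral_cong) (auto simp: mult_ac)
  have "integrable lborel (\<lambda>a. LINT z|lborel. ?h z a)"
    using lborel_pair.integrable_snd[OF int] by simp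
  then show "integrable lborel (\<lambda>a. smooth v a * of_real (indicator R a))" unfolding sm .
  have "(LINT a|lborel. smooth v a * of_real (indicator R a)) = (LINT z|lborel. LINT a|lborel. ?h z a)"
    unfolding sm by (rule lborel_pair.Fubini_integral[OF int])
  also have "\<dots> = (LINT z|lborel. F z * of_real (heat v R z))"
    unfolding heat_def by (simp only: integral_mult_right_zero integral_complex_of_real)
  finally show "(LINT a|lborel. smooth v a * of_real (indicator R a)) = (LINT z|lborel. F z * of_real (heat v R z))" .
qed

text \<open>The frontier of a convex set is null, so the heat flow of the indicator converges almost
  everywhere; a fixed Gaussian dominates.\<close>

lemma smooth_region_tendsto:
  assumes R[measurable]: "R \<in> sets borel" and "bounded R" "convex R"
  shows "(\<lambda>n. LINT a|lborel. smooth (1 / real (Suc n)) a * of_real (indicator R a)) \<longlonglongrightarrow> (LINT z|lborel. F z * of_real (indicator R z))"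
proof -
  have v: "0 < 1 / real (Suc n)" "1 / real (Suc n) \<le> 1" for n by auto
  obtain M where M: "\<And>v z. 0 < v \<Longrightarrow> v \<le> 1 \<Longrightarrow> heat v R z \<le> M * gauss 8 0 z"
    using heat_dominated[OF R \<open>bounded R\<close>] by blast
  have "(\<lambda>n. LINT z|lborel. F z * of_real (heat (1 / real (Suc n)) R z)) \<longlonglongrightarrow> (LINT z|lborel. F z * of_real (indicator R z))"
  proof (rule integral_dominated_convergence)
    have "integrable lborel (\<lambda>z. of_real M * (F z * of_real (gauss 8 0 z)))"
      by (intro integrable_mult_right integrable_gauss) auto
    then show "integrable lborel (\<lambda>z. norm (of_real M * (F z * of_real (gauss 8 0 z))))" by (rule integrable_norm)
    have "AE z in lborel. z \<notin> frontier R"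
    proof -
      have "frontier R \<in> null_sets lebesgue" using negligible_convex_frontier[OF \<open>convex R\<close>] by (simp add: negligible_iff_null_sets)
      then have "frontier R \<in> null_sets lborel" by (simp add: null_sets_def)
      then show ?thesis by (rule AE_not_in)
    qed
    then show "AE z in lborel. (\<lambda>n. F z * of_real (heat (1 / real (Suc n)) R z)) \<longlonglongrightarrow> F z * of_real (indicator R z)"
      by eventually_elim (intro tendsto_mult tendsto_const tendsto_of_real heat_tendsto R)
    fix n
    show "AE z in lborel. norm (F z * of_real (heat (1 / real (Suc n)) R z)) \<le> norm (of_real M * (F z * of_real (gauss 8 0 z)))"
    proof (intro AE_I2)
      fix z
      have "\<bar>heat (1 / real (Suc n)) R z\<bar> \<le> \<bar>M * gauss 8 0 z\<bar>"
        using M[OF v, of n z] heat_nonneg[OF v(1), of n R z] by simp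
      then have "cmod (F z) * \<bar>heat (1 / real (Suc n)) R z\<bar> \<le> cmod (F z) * \<bar>M * gauss 8 0 z\<bar>" by (intro mult_left_mono) auto
      then show "norm (F z * of_real (heat (1 / real (Suc n)) R z)) \<le> norm (of_real M * (F z * of_real (gauss 8 0 z)))"
        by (simp add: norm_mult abs_mult mult_ac)
    qed
  qed measurable
  then show ?thesis by (simp only: smooth_region(2)[OF R \<open>bounded R\<close> v(1)])
qed

end

definition region_avg :: "(real \<times> real) set \<Rightarrow> (real \<times> real \<Rightarrow> complex) \<Rightarrow> complex" where
  "region_avg R h = (LINT z|lborel. h z * of_real (indicator R z)) / of_real (measure lborel R)"

lemma region_avg_close:
  assumes R: "R \<in> sets borel" "bounded R" "0 < measure lborel R"
    and h: "integrable lborel (\<lambda>z. h z * of_real (indicator R z))" and E: "\<And>a. a \<in> R \<Longrightarrow> cmod (h a - c) \<le> E"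
  shows "cmod (region_avg R h - c) \<le> E"
proof -
  let ?m = "measure lborel R"
  have fin: "emeasure lborel R < \<infinity>" by (rule emeasure_bounded_finite[OF R(2)])
  have ind: "integrable lborel (\<lambda>z. indicator R z :: real)" using R fin by (intro integrable_real_indicator) auto
  have c: "integrable lborel (\<lambda>z. c * complex_of_real (indicator R z))"
    by (intro integrable_mult_right integrable_of_real ind)
  have "(LINT z|lborel. h z * of_real (indicator R z) - c * of_real (indicator R z)) = (LINT z|lborel. h z * of_real (indicator R z)) - c * of_real ?m"
    by (simp only: Bochner_Integration.integral_diff[OF h c] integral_mult_right_zero integral_complex_of_real) (simp)
  then have "region_avg R h - c = (LINT z|lborel. h z * of_real (indicator R z) - c * of_real (indicator R z)) / of_real ?m"
    unfolding region_avg_def using R(3) by (simp add: diff_divide_distrib)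
  then have "cmod (region_avg R h - c) = cmod (LINT z|lborel. h z * of_real (indicator R z) - c * of_real (indicator R z)) / ?m"
    using R(3) by (simp add: norm_divide)
  also have "cmod (LINT z|lborel. h z * of_real (indicator R z) - c * of_real (indicator R z)) \<le> (LINT z|lborel. E * indicator R z)"
  proof (rule Bochner_Integration.integral_norm_bound_integral)
    show "integrable lborel (\<lambda>z. h z * of_real (indicator R z) - c * of_real (indicator R z))" by (rule Bochner_Integration.integrable_diff[OF h c])
    show "integrable lborel (\<lambda>z. E * indicator R z)" by (intro integrable_mult_right ind)
    fix z
    show "norm (h z * of_real (indicator R z) - c * of_real (indicator R z)) \<le> E * indicator R z"
      using E[of z] by (simp add: indicator_def)
  qed
  also have "\<dots> = E * ?m" by simp
  finally show ?thesis using R(3) by (simp add: divide_right_mono field_simps)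
qed

text \<open>The average over R is compared with each single value on Q, and then with the average of
  these values.\<close>

lemma region_avg_diff_le:
  assumes R: "R \<in> sets borel" "bounded R" "0 < measure lborel R" "integrable lborel (\<lambda>z. h z * of_real (indicator R z))"
    and Q: "Q \<in> sets borel" "bounded Q" "0 < measure lborel Q" "integrable lborel (\<lambda>z. h z * of_real (indicator Q z))"
    and E: "\<And>a b. a \<in> R \<Longrightarrow> b \<in> Q \<Longrightarrow> cmod (h a - h b) \<le> E"
  shows "cmod (region_avg R h - region_avg Q h) \<le> E"
proof -
  have "cmod (region_avg R h - h b) \<le> E" if "b \<in> Q" for b
    by (rule region_avg_close[OF R]) (rule E[OF _ that])
  then have "cmod (region_avg Q h - region_avg R h) \<le> E"
    by (intro region_avg_close[OF Q]) (simp add: norm_minus_commute)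
  then show ?thesis by (simp add: norm_minus_commute)
qed

context Lp_function
begin

text \<open>Minkowski's integral inequality in effect: the Hoelder estimate is applied for each u
  separately, where sup and L^1 bounds are explicit, and the result is averaged over u.\<close>

lemma nn_integral_mixture_le:
  fixes \<kappa> :: "real \<Rightarrow> real \<times> real \<Rightarrow> real"
  assumes \<alpha>: "0 < \<alpha>" and m[measurable]: "(\<lambda>(u, z). \<kappa> u z) \<in> borel_measurable (gamma_measure \<alpha> \<Otimes>\<^sub>M lborel)"
    and k0: "\<And>u z. 0 \<le> \<kappa> u z" and kK: "\<And>u z. \<kappa> u z \<le> K u" "\<And>u. 0 < K u"
    and kL: "\<And>u. (\<integral>\<^sup>+z. \<kappa> u z \<partial>lborel) \<le> ennreal (L u)" "\<And>u. 0 < L u"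
  shows "(\<integral>\<^sup>+z. cmod (F z) * (\<integral>\<^sup>+u. \<kappa> u z \<partial>gamma_measure \<alpha>) \<partial>lborel)
    \<le> (\<integral>\<^sup>+u. ennreal (norm_p * K u powr (1/p) * L u powr (1 - 1/p)) \<partial>gamma_measure \<alpha>)"
proof -
  interpret prob_space "gamma_measure \<alpha>" by (rule prob_space_gamma_measure[OF \<alpha>])
  interpret pair_sigma_finite "gamma_measure \<alpha>" "lborel :: (real \<times> real) measure" ..
  have mz[measurable]: "(\<lambda>u. \<kappa> u z) \<in> borel_measurable (gamma_measure \<alpha>)" for z
    using measurable_compose[OF measurable_Pair2'[of z lborel "gamma_measure \<alpha>"] m] by simp
  have mu: "\<kappa> u \<in> borel_measurable borel" for u
    using measurable_compose[OF measurable_Pair1'[of u "gamma_measure \<alpha>" lborel] m] by simp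
  have "(\<integral>\<^sup>+z. cmod (F z) * (\<integral>\<^sup>+u. \<kappa> u z \<partial>gamma_measure \<alpha>) \<partial>lborel)
    = (\<integral>\<^sup>+z. \<integral>\<^sup>+u. ennreal (cmod (F z) * \<kappa> u z) \<partial>gamma_measure \<alpha> \<partial>lborel)"
    by (intro nn_integral_cong) (simp add: nn_integral_cmult[symmetric] ennreal_mult k0)
  also have "\<dots> = (\<integral>\<^sup>+u. \<integral>\<^sup>+z. ennreal (cmod (F z) * \<kappa> u z) \<partial>lborel \<partial>gamma_measure \<alpha>)"
    by (rule Fubini') (use m in measurable)
  also have "\<dots> \<le> (\<integral>\<^sup>+u. ennreal (norm_p * K u powr (1/p) * L u powr (1 - 1/p)) \<partial>gamma_measure \<alpha>)"
    by (intro nn_integral_mono nn_integral_mult_le mu k0 kK kL)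
  finally show ?thesis .
qed

end

section \<open>Size and regularity of Bessel potentials\<close>

text \<open>The assumption \<open>test\<close> keeps the Gaussian instances of the distributional
  identity, restated for Borel functions and \<open>lborel\<close>.\<close>

locale bessel_pair = F: Lp_function p F + f: Lp_function p f for p s :: real and F f +
  assumes s: "2 / p < s"
    and test: "\<And>v a. 0 < v \<Longrightarrow> (LINT z|lborel. f z * of_real (bessel_kernel (s / 2) v a z)) = (LINT z|lborel. F z * of_real (gauss v a z))"
begin

abbreviation \<mu> :: "real measure" where "\<mu> \<equiv> gamma_measure (s / 2)"
abbreviation G :: "real \<Rightarrow> real \<times> real \<Rightarrow> real \<times> real \<Rightarrow> real" where "G \<equiv> bessel_kernel (s / 2)"

lemma p_pos: "0 < p" "1 < p" using F.p by auto

lemma s_pos: "0 < s / 2"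
proof -
  have "0 < 2 / p" using p_pos by simp
  then show ?thesis using s by linarith
qed

lemma ennreal_bessel_kernel:
  "0 < v \<Longrightarrow> ennreal (G v a z) = (\<integral>\<^sup>+u. gauss (v + 2 * \<bar>u\<bar>) a z \<partial>\<mu>)"
  unfolding bessel_kernel_def
  by (rule nn_integral_eq_integral[symmetric, OF integrable_gamma_measure_gauss[OF s_pos]]) (auto intro!: AE_I2 gauss_nonneg add_pos_nonneg)

lemma bessel_kernel_nonneg: "0 < v \<Longrightarrow> 0 \<le> G v a z"
  unfolding bessel_kernel_def by (intro Bochner_Integration.integral_nonneg gauss_nonneg) (auto intro: add_pos_nonneg)

text \<open>The bound degenerates as v tends to 0; its purpose is integrability for a fixed
  v.\<close>

lemma nn_integral_bessel_kernel_le: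
  assumes v: "0 < v"
  shows "(\<integral>\<^sup>+z. cmod (f z) * G v a z \<partial>lborel) \<le> ennreal (f.norm_p * (1 / (2 * pi * v)) powr (1/p))"
proof -
  interpret prob_space \<mu> by (rule prob_space_gamma_measure[OF s_pos])
  have t: "0 < v + 2 * \<bar>u\<bar>" "v \<le> v + 2 * \<bar>u\<bar>" for u :: real using v by auto
  have "(\<integral>\<^sup>+z. cmod (f z) * G v a z \<partial>lborel) = (\<integral>\<^sup>+z. cmod (f z) * (\<integral>\<^sup>+u. gauss (v + 2 * \<bar>u\<bar>) a z \<partial>\<mu>) \<partial>lborel)"
    using v by (intro nn_integral_cong) (simp add: ennreal_mult bessel_kernel_nonneg ennreal_bessel_kernel)
  also have "\<dots> \<le> (\<integral>\<^sup>+u. ennreal (f.norm_p * (1 / (2 * pi * v)) powr (1/p) * 1 powr (1 - 1/p)) \<partial>\<mu>)"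
  proof (rule f.nn_integral_mixture_le[OF s_pos])
    fix u and z :: "real \<times> real"
    have "gauss (v + 2 * \<bar>u\<bar>) a z \<le> 1 / (2 * pi * (v + 2 * \<bar>u\<bar>))" by (rule gauss_le[OF t(1)])
    also have "\<dots> \<le> 1 / (2 * pi * v)" using v by (intro divide_left_mono mult_left_mono) auto
    finally show "gauss (v + 2 * \<bar>u\<bar>) a z \<le> 1 / (2 * pi * v)" .
  qed (use v t in \<open>auto intro: gauss_nonneg simp: nn_integral_gauss\<close>)
  also have "\<dots> = ennreal (f.norm_p * (1 / (2 * pi * v)) powr (1/p))" by (simp add: emeasure_space_1[simplified])
  finally show ?thesis .
qed

lemma integrable_bessel_kernel:
  assumes v: "0 < v" shows "integrable lborel (\<lambda>z. f z * of_real (G v a z))"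
proof (rule integrableI_bounded)
  have [measurable]: "G v a \<in> borel_measurable borel" by (rule borel_measurable_bessel_kernel[OF s_pos])
  show "(\<lambda>z. f z * of_real (G v a z)) \<in> borel_measurable lborel" by measurable
  have "(\<integral>\<^sup>+z. ennreal (norm (f z * of_real (G v a z))) \<partial>lborel) = (\<integral>\<^sup>+z. cmod (f z) * G v a z \<partial>lborel)"
    using bessel_kernel_nonneg[OF v] by (simp add: norm_mult)
  also have "\<dots> < \<infinity>" using nn_integral_bessel_kernel_le[OF v, of a] by (simp add: le_less_trans)
  finally show "(\<integral>\<^sup>+z. ennreal (norm (f z * of_real (G v a z))) \<partial>lborel) < \<infinity>" .
qed

lemma smooth_eq: "0 < v \<Longrightarrow> F.smooth v a = (LINT z|lborel. f z * of_real (G v a z))"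
  by (simp add: F.smooth_def test)

text \<open>Twice the moment of order \<open>- (1 / p + \<eta> / 2)\<close> of the Gamma
  distribution of shape s/2. It depends on p, s and \<eta> alone, which allows the constant of the
  theorem to be fixed before F.\<close>

definition holder_const :: "real \<Rightarrow> real" where
  "holder_const \<eta> = 2 * Gamma (s / 2 - (1 / p + \<eta> / 2)) / Gamma (s / 2)"

text \<open>A Gaussian of variance \<open>t\<close> is bounded by \<open>1 / t\<close>, and its translates by \<open>d\<close> have \<open>L\<^sup>1\<close> distance
  at most \<open>min 2 (d / sqrt t)\<close>; the resulting power of \<open>t\<close> is integrable against the Gamma
  distribution exactly when \<open>\<eta> < s - 2 / p\<close>.\<close>

lemma smooth_holder:
  assumes v: "0 < v" and \<eta>: "0 < \<eta>" "\<eta> < s - 2 / p" "\<eta> \<le> 1 - 1 / p"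
  shows "cmod (F.smooth v a - F.smooth v b) \<le> holder_const \<eta> * dist a b powr \<eta> * f.norm_p"
proof (cases "a = b")
  case True then show ?thesis by simp
next
  case False
  interpret prob_space \<mu> by (rule prob_space_gamma_measure[OF s_pos])
  define d where "d = dist a b"
  have d: "d > 0" using False by (simp add: d_def)
  \<comment> \<open>The power of the variance that is lost: 1/p from the sup bound and \<eta>/2 from
    the L^1 distance.\<close>
  define \<beta> where "\<beta> = 1 / p + \<eta> / 2"
  have \<beta>: "0 < s / 2 + - \<beta>" using \<eta> by (simp add: \<beta>_def field_simps)
  have hc: "holder_const \<eta> = 2 * Gamma (s / 2 + - \<beta>) / Gamma (s / 2)"
    unfolding holder_const_def \<beta>_def by (simp only: diff_conv_add_uminus)
  have \<beta>0: "0 \<le> \<beta>" using \<eta>(1) p_pos unfolding \<beta>_def by (intro add_nonneg_nonneg) auto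
  let ?t = "\<lambda>u. v + 2 * \<bar>u\<bar>"
  have t: "0 < ?t u" for u :: real using v by linarith
  let ?\<kappa> = "\<lambda>u z. \<bar>gauss (?t u) a z - gauss (?t u) b z\<bar>"
  let ?K = "\<lambda>u. 1 / ?t u" and ?L = "\<lambda>u. min 2 (d / sqrt (?t u))"
  have km: "(\<lambda>(u, z). ?\<kappa> u z) \<in> borel_measurable (\<mu> \<Otimes>\<^sub>M lborel)" by measurable
  have [measurable]: "G v a \<in> borel_measurable borel" for a by (rule borel_measurable_bessel_kernel[OF s_pos])
  have "F.smooth v a - F.smooth v b = (LINT z|lborel. f z * of_real (G v a z) - f z * of_real (G v b z))"
    using v by (simp add: smooth_eq integrable_bessel_kernel)
  also have "ennreal (cmod \<dots>) \<le> (\<integral>\<^sup>+z. cmod (f z * of_real (G v a z) - f z * of_real (G v b z)) \<partial>lborel)"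
    by (rule integral_norm_bound_ennreal) (intro Bochner_Integration.integrable_diff integrable_bessel_kernel v)
  also have "\<dots> \<le> (\<integral>\<^sup>+z. cmod (f z) * (\<integral>\<^sup>+u. ?\<kappa> u z \<partial>\<mu>) \<partial>lborel)"
  proof (intro nn_integral_mono)
    fix z
    have ga: "integrable (\<mu>) (\<lambda>u. gauss (?t u) a z)" for a by (rule integrable_gamma_measure_gauss[OF s_pos v])
    have "ennreal (\<bar>G v a z - G v b z\<bar>) = ennreal (norm (LINT u|\<mu>. gauss (?t u) a z - gauss (?t u) b z))"
      unfolding bessel_kernel_def by (simp add: ga)
    also have "\<dots> \<le> (\<integral>\<^sup>+u. norm (gauss (?t u) a z - gauss (?t u) b z) \<partial>\<mu>)"
      by (rule integral_norm_bound_ennreal) (intro Bochner_Integration.integrable_diff ga)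
    finally have le: "ennreal (\<bar>G v a z - G v b z\<bar>) \<le> (\<integral>\<^sup>+u. ?\<kappa> u z \<partial>\<mu>)" by simp
    have "cmod (f z * of_real (G v a z) - f z * of_real (G v b z)) = cmod (f z) * \<bar>G v a z - G v b z\<bar>"
      by (simp only: right_diff_distrib[symmetric] of_real_diff[symmetric] norm_mult norm_of_real)
    then show "ennreal (cmod (f z * of_real (G v a z) - f z * of_real (G v b z))) \<le> cmod (f z) * (\<integral>\<^sup>+u. ?\<kappa> u z \<partial>\<mu>)"
      using mult_left_mono[OF le, of "ennreal (cmod (f z))"] by (simp add: ennreal_mult)
  qed
  also have "\<dots> \<le> (\<integral>\<^sup>+u. ennreal (f.norm_p * ?K u powr (1/p) * ?L u powr (1 - 1/p)) \<partial>\<mu>)"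
  proof (rule f.nn_integral_mixture_le[OF s_pos km])
    fix u and z :: "real \<times> real"
    have le1: "gauss (?t u) c z \<le> ?K u" for c
    proof -
      have "gauss (?t u) c z \<le> 1 / (2 * pi * ?t u)" by (rule gauss_le[OF t])
      also have "\<dots> \<le> 1 / ?t u" using t[of u] pi_ge_two by (intro divide_left_mono) (auto intro: mult_pos_pos)
      finally show ?thesis .
    qed
    show "?\<kappa> u z \<le> ?K u" using le1[of a] le1[of b] gauss_nonneg[OF t, of u a z] gauss_nonneg[OF t, of u b z] by linarith
    show "0 < ?K u" using t[of u] by simp
    show "0 < ?L u" using t[of u] d by simp
    have "(\<integral>\<^sup>+z. ?\<kappa> u z \<partial>lborel) \<le> (\<integral>\<^sup>+z. ennreal (gauss (?t u) a z) + ennreal (gauss (?t u) b z) \<partial>lborel)"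
    proof (intro nn_integral_mono)
      fix z
      have g: "0 \<le> gauss (?t u) a z" "0 \<le> gauss (?t u) b z" by (rule gauss_nonneg[OF t])+
      then have "ennreal (?\<kappa> u z) \<le> ennreal (gauss (?t u) a z + gauss (?t u) b z)" by (intro ennreal_leI) linarith
      then show "ennreal (?\<kappa> u z) \<le> ennreal (gauss (?t u) a z) + ennreal (gauss (?t u) b z)" using g by simp
    qed
    also have "\<dots> = ennreal 2" using nn_integral_gauss[OF t, of u] by (simp add: nn_integral_add)
    finally have "(\<integral>\<^sup>+z. ?\<kappa> u z \<partial>lborel) \<le> ennreal 2" .
    moreover have "(\<integral>\<^sup>+z. ?\<kappa> u z \<partial>lborel) \<le> ennreal (d / sqrt (?t u))" unfolding d_def by (rule L1_dist_gauss_le[OF t])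
    ultimately show "(\<integral>\<^sup>+z. ?\<kappa> u z \<partial>lborel) \<le> ennreal (?L u)" by (simp add: min_def)
  qed auto
  also have "\<dots> \<le> (\<integral>\<^sup>+u. ennreal (2 * d powr \<eta> * f.norm_p) * ennreal (u powr (- \<beta>) * exp (- 0 * u)) \<partial>\<mu>)"
  proof (rule nn_integral_mono_AE, rule AE_mp[OF AE_gamma_measure_pos AE_I2], rule impI)
    fix u :: real assume u: "0 < u"
    have tu: "u \<le> ?t u" using u v by simp
    \<comment> \<open>The power is split: \<eta> of it goes to the branch
      \<open>d / sqrt (?t u)\<close> of the minimum and the rest to the branch 2, which is possible
      because \<eta> \<le> 1 - 1/p.\<close>
    have L: "?L u powr (1 - 1/p) \<le> 2 * (d powr \<eta> * ?t u powr (- \<eta> / 2))"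
    proof -
      have L0: "?L u > 0" using t[of u] d by simp
      have "?L u powr (1 - 1/p) = ?L u powr \<eta> * ?L u powr (1 - 1/p - \<eta>)" by (simp flip: powr_add)
      also have "\<dots> \<le> (d / sqrt (?t u)) powr \<eta> * 2 powr 1"
      proof (intro mult_mono)
        show "?L u powr \<eta> \<le> (d / sqrt (?t u)) powr \<eta>" using L0 \<eta> by (intro powr_mono2) auto
        have "?L u powr (1 - 1/p - \<eta>) \<le> 2 powr (1 - 1/p - \<eta>)" using L0 \<eta> by (intro powr_mono2) auto
        also have "\<dots> \<le> 2 powr 1"
        proof (rule powr_mono)
          have "0 < 1 / p" using p_pos by simp
          then show "1 - 1 / p - \<eta> \<le> 1" using \<eta> by linarith
        qed simp
        finally show "?L u powr (1 - 1/p - \<eta>) \<le> 2 powr 1" .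
      qed auto
      also have "(d / sqrt (?t u)) powr \<eta> = d powr \<eta> * ?t u powr (- \<eta> / 2)"
        using d t[of u] by (simp add: powr_divide powr_half_sqrt[symmetric] powr_powr powr_minus field_simps)
      finally show ?thesis by simp
    qed
    have Kt: "?K u powr (1/p) = ?t u powr (- 1 / p)" using t[of u] by (simp add: powr_divide powr_minus field_simps)
    have "f.norm_p * ?K u powr (1/p) * ?L u powr (1 - 1/p) \<le> f.norm_p * ?t u powr (- 1 / p) * (2 * (d powr \<eta> * ?t u powr (- \<eta> / 2)))"
      unfolding Kt by (intro mult_left_mono L) (auto simp: f.norm_p_nonneg)
    also have "f.norm_p * ?t u powr (- 1 / p) * (2 * (d powr \<eta> * ?t u powr (- \<eta> / 2))) = (2 * d powr \<eta> * f.norm_p) * (?t u powr (- 1 / p) * ?t u powr (- \<eta> / 2))" by simp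
    also have "?t u powr (- 1 / p) * ?t u powr (- \<eta> / 2) = ?t u powr (- \<beta>)" by (simp add: powr_add[symmetric] \<beta>_def)
    \<comment> \<open>Dropping v from the variance can only increase its negative power, and makes
      the constant uniform in v.\<close>
    also have "(2 * d powr \<eta> * f.norm_p) * ?t u powr (- \<beta>) \<le> (2 * d powr \<eta> * f.norm_p) * u powr (- \<beta>)"
      using u tu \<eta> p_pos by (intro mult_left_mono powr_mono2') (auto simp: f.norm_p_nonneg \<beta>0)
    finally show "ennreal (f.norm_p * ?K u powr (1/p) * ?L u powr (1 - 1/p)) \<le> ennreal (2 * d powr \<eta> * f.norm_p) * ennreal (u powr (- \<beta>) * exp (- 0 * u))"
      by (simp add: ennreal_mult[symmetric] f.norm_p_nonneg ennreal_leI)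
  qed
  also have "\<dots> = ennreal (2 * d powr \<eta> * f.norm_p) * ennreal (Gamma (s / 2 + - \<beta>) / Gamma (s / 2) * (1 + 0) powr (- (s / 2 + - \<beta>)))"
    by (subst nn_integral_cmult, measurable, subst nn_integral_gamma_measure_powr_exp[OF s_pos \<beta>]) auto
  also have "\<dots> = ennreal (holder_const \<eta> * d powr \<eta> * f.norm_p)"
    using Gamma_real_pos[OF \<beta>] Gamma_real_pos[OF s_pos] by (simp add: ennreal_mult[symmetric] f.norm_p_nonneg hc mult_ac)
  finally have "ennreal (cmod (F.smooth v a - F.smooth v b)) \<le> ennreal (holder_const \<eta> * d powr \<eta> * f.norm_p)" .
  moreover have "0 \<le> holder_const \<eta> * d powr \<eta> * f.norm_p"
    using Gamma_real_pos[OF \<beta>] Gamma_real_pos[OF s_pos] by (simp add: f.norm_p_nonneg hc)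
  ultimately show ?thesis unfolding d_def by (simp add: ennreal_le_iff)
qed

text \<open>Exchanging the integrals replaces each Gaussian by its integral over R, a heat flow that
  is at most 1 and has the measure of R as its L^1 norm. The mixture is taken over a probability
  measure, hence the constant 1.\<close>

lemma smooth_region_le:
  assumes v: "0 < v" and R[measurable]: "R \<in> sets borel" and "bounded R" and m: "0 < measure lborel R"
  shows "cmod (LINT a|lborel. F.smooth v a * of_real (indicator R a)) \<le> f.norm_p * measure lborel R powr (1 - 1/p)"
proof -
  interpret prob_space \<mu> by (rule prob_space_gamma_measure[OF s_pos])
  interpret P: pair_sigma_finite \<mu> "lborel :: (real \<times> real) measure" ..
  have fin: "emeasure lborel R < \<infinity>" by (rule emeasure_bounded_finite[OF \<open>bounded R\<close>])
  let ?t = "\<lambda>u. v + 2 * \<bar>u\<bar>"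
  have t: "0 < ?t u" for u :: real using v by linarith
  have hm: "(\<lambda>(u, z). heat (?t u) R z) \<in> borel_measurable (\<mu> \<Otimes>\<^sub>M lborel)"
    unfolding heat_def by measurable
  have "ennreal (cmod (LINT a|lborel. F.smooth v a * of_real (indicator R a))) \<le> (\<integral>\<^sup>+a. norm (F.smooth v a * of_real (indicator R a)) \<partial>lborel)"
    by (rule integral_norm_bound_ennreal[OF F.smooth_region(1)[OF R \<open>bounded R\<close> v]])
  also have "\<dots> \<le> (\<integral>\<^sup>+a. \<integral>\<^sup>+z. indicator R a * (ennreal (cmod (f z)) * (\<integral>\<^sup>+u. gauss (?t u) a z \<partial>\<mu>)) \<partial>lborel \<partial>lborel)"
  proof (intro nn_integral_mono)
    fix a
    have "ennreal (cmod (F.smooth v a)) \<le> (\<integral>\<^sup>+z. norm (f z * of_real (G v a z)) \<partial>lborel)"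
      unfolding smooth_eq[OF v] by (rule integral_norm_bound_ennreal[OF integrable_bessel_kernel[OF v]])
    also have "\<dots> = (\<integral>\<^sup>+z. ennreal (cmod (f z)) * (\<integral>\<^sup>+u. gauss (?t u) a z \<partial>\<mu>) \<partial>lborel)"
      using v by (intro nn_integral_cong) (simp add: norm_mult ennreal_mult bessel_kernel_nonneg ennreal_bessel_kernel)
    finally show "ennreal (norm (F.smooth v a * of_real (indicator R a))) \<le> (\<integral>\<^sup>+z. indicator R a * (ennreal (cmod (f z)) * (\<integral>\<^sup>+u. gauss (?t u) a z \<partial>\<mu>)) \<partial>lborel)"
      by (auto simp: indicator_def)
  qed
  also have "\<dots> = (\<integral>\<^sup>+z. \<integral>\<^sup>+a. indicator R a * (ennreal (cmod (f z)) * (\<integral>\<^sup>+u. gauss (?t u) a z \<partial>\<mu>)) \<partial>lborel \<partial>lborel)"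
    by (rule lborel_pair.Fubini') measurable
  also have "\<dots> = (\<integral>\<^sup>+z. ennreal (cmod (f z)) * (\<integral>\<^sup>+u. heat (?t u) R z \<partial>\<mu>) \<partial>lborel)"
  proof (intro nn_integral_cong)
    fix z
    have "(\<integral>\<^sup>+u. heat (?t u) R z \<partial>\<mu>) = (\<integral>\<^sup>+u. \<integral>\<^sup>+a. indicator R a * ennreal (gauss (?t u) a z) \<partial>lborel \<partial>\<mu>)"
      by (simp only: ennreal_heat[OF t R])
    also have "\<dots> = (\<integral>\<^sup>+a. \<integral>\<^sup>+u. indicator R a * ennreal (gauss (?t u) a z) \<partial>\<mu> \<partial>lborel)"
      by (rule P.Fubini'[symmetric]) measurable
    also have "\<dots> = (\<integral>\<^sup>+a. indicator R a * (\<integral>\<^sup>+u. gauss (?t u) a z \<partial>\<mu>) \<partial>lborel)"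
      by (intro nn_integral_cong) (simp add: nn_integral_cmult)
    finally have h: "(\<integral>\<^sup>+u. heat (?t u) R z \<partial>\<mu>) = (\<integral>\<^sup>+a. indicator R a * (\<integral>\<^sup>+u. gauss (?t u) a z \<partial>\<mu>) \<partial>lborel)" .
    show "(\<integral>\<^sup>+a. indicator R a * (ennreal (cmod (f z)) * (\<integral>\<^sup>+u. gauss (?t u) a z \<partial>\<mu>)) \<partial>lborel) = ennreal (cmod (f z)) * (\<integral>\<^sup>+u. heat (?t u) R z \<partial>\<mu>)"
      unfolding h by (subst nn_integral_cmult[symmetric]) (auto intro!: nn_integral_cong simp: mult_ac)
  qed
  also have "\<dots> \<le> (\<integral>\<^sup>+u. ennreal (f.norm_p * 1 powr (1/p) * measure lborel R powr (1 - 1/p)) \<partial>\<mu>)"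
    using fin m by (intro f.nn_integral_mixture_le[OF s_pos hm])
      (auto intro: heat_nonneg[OF t] heat_le_1[OF t R] simp: nn_integral_heat[OF t R] emeasure_eq_ennreal_measure)
  also have "\<dots> = ennreal (f.norm_p * measure lborel R powr (1 - 1/p))" by (simp add: emeasure_space_1[simplified])
  finally show ?thesis by (simp add: f.norm_p_nonneg ennreal_le_iff)
qed

lemma region_integral_le:
  assumes R: "R \<in> sets borel" "bounded R" "convex R" "0 < measure lborel R"
  shows "cmod (LINT z|lborel. F z * of_real (indicator R z)) \<le> f.norm_p * measure lborel R powr (1 - 1/p)"
  by (rule LIMSEQ_le_const2[OF tendsto_norm[OF F.smooth_region_tendsto[OF R(1,2,3)]]])
    (use smooth_region_le R in auto)

lemma region_avg_le:
  assumes R: "R \<in> sets borel" "bounded R" "convex R" "0 < measure lborel R"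
  shows "cmod (region_avg R F) \<le> f.norm_p * measure lborel R powr (- 1/p)"
proof -
  let ?m = "measure lborel R"
  have "cmod (region_avg R F) = cmod (LINT z|lborel. F z * of_real (indicator R z)) / ?m"
    unfolding region_avg_def using R(4) by (simp add: norm_divide)
  also have "\<dots> \<le> f.norm_p * ?m powr (1 - 1/p) / ?m"
    using R(4) by (intro divide_right_mono region_integral_le R) auto
  also have "?m powr (1 - 1/p) = ?m * ?m powr (- 1/p)" using R(4) by (simp add: powr_diff powr_minus field_simps)
  finally show ?thesis using R(4) by simp
qed

text \<open>The Hoelder estimate is uniform in v. It therefore passes to averages of the
  regularisation and, as v tends to 0, to averages of F, whose point values carry no
  information.\<close>

lemma region_avg_holder:
  assumes R: "R \<in> sets borel" "bounded R" "convex R" "0 < measure lborel R"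
    and Q: "Q \<in> sets borel" "bounded Q" "convex Q" "0 < measure lborel Q"
    and d: "\<And>a b. a \<in> R \<Longrightarrow> b \<in> Q \<Longrightarrow> dist a b \<le> d"
    and \<eta>: "0 < \<eta>" "\<eta> < s - 2 / p" "\<eta> \<le> 1 - 1 / p"
  shows "cmod (region_avg R F - region_avg Q F) \<le> holder_const \<eta> * d powr \<eta> * f.norm_p"
proof -
  let ?v = "\<lambda>n. 1 / real (Suc n)"
  have hc: "holder_const \<eta> \<ge> 0"
  proof -
    have "0 < s / 2 - (1 / p + \<eta> / 2)" using \<eta> by (simp add: field_simps)
    then show ?thesis unfolding holder_const_def using Gamma_real_pos[OF s_pos] Gamma_real_pos by (intro divide_nonneg_pos mult_nonneg_nonneg less_imp_le) auto
  qed
  have "(\<lambda>n. region_avg A (F.smooth (?v n))) \<longlonglongrightarrow> region_avg A F"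
    if "A \<in> sets borel" "bounded A" "convex A" "0 < measure lborel A" for A
    unfolding region_avg_def using that by (intro tendsto_divide tendsto_const F.smooth_region_tendsto) auto
  then have "(\<lambda>n. cmod (region_avg R (F.smooth (?v n)) - region_avg Q (F.smooth (?v n)))) \<longlonglongrightarrow> cmod (region_avg R F - region_avg Q F)"
    using R Q by (intro tendsto_norm tendsto_diff)
  then show ?thesis
  proof (rule LIMSEQ_le_const2)
    have "cmod (region_avg R (F.smooth (?v n)) - region_avg Q (F.smooth (?v n))) \<le> holder_const \<eta> * d powr \<eta> * f.norm_p" for n
    proof (intro region_avg_diff_le R Q F.smooth_region(1))
      fix a b assume ab: "a \<in> R" "b \<in> Q"
      have "cmod (F.smooth (?v n) a - F.smooth (?v n) b) \<le> holder_const \<eta> * dist a b powr \<eta> * f.norm_p"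
        by (rule smooth_holder[OF _ \<eta>]) simp
      also have "\<dots> \<le> holder_const \<eta> * d powr \<eta> * f.norm_p"
        using d[OF ab] \<eta> hc by (intro mult_right_mono mult_left_mono powr_mono2 f.norm_p_nonneg) auto
      finally show "cmod (F.smooth (?v n) a - F.smooth (?v n) b) \<le> holder_const \<eta> * d powr \<eta> * f.norm_p" .
    qed auto
    then show "\<exists>N. \<forall>n\<ge>N. cmod (region_avg R (F.smooth (?v n)) - region_avg Q (F.smooth (?v n))) \<le> holder_const \<eta> * d powr \<eta> * f.norm_p" by blast
  qed
qed

end

section \<open>The sup norm estimate\<close>

lemma lebesgue_integral_borel_representative:
  fixes f f' k :: "real \<times> real \<Rightarrow> complex"
  assumes [measurable]: "f \<in> borel_measurable lebesgue" and f': "f' \<in> borel_measurable borel" and ae: "AE z in lborel. f z = f' z" and k: "k \<in> borel_measurable borel"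
  shows "(LINT z|lebesgue. f z * k z) = (LINT z|lborel. f' z * k z)"
proof -
  have [measurable]: "f' \<in> borel_measurable lebesgue" "k \<in> borel_measurable lebesgue"
    using f' k by (intro measurable_completion; simp)+
  have "(LINT z|lebesgue. f z * k z) = (LINT z|lebesgue. f' z * k z)"
  proof (rule integral_cong_AE)
    show "AE z in lebesgue. f z * k z = f' z * k z" using AE_completion[OF ae] by eventually_elim simp
  qed measurable
  also have "\<dots> = (LINT z|lborel. f' z * k z)" using f' k by (intro integral_completion) simp
  finally show ?thesis .
qed

lemma measure_lborel_Times:
  fixes A B :: "real set"
  assumes "A \<in> sets borel" "B \<in> sets borel"
  shows "measure lborel (A \<times> B) = measure lborel A * measure lborel B"
  unfolding lborel_prod[symmetric] measure_def using assms
  by (subst lborel.emeasure_pair_measure_Times) (auto simp: enn2real_mult)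

definition dyadic_cell :: "int \<Rightarrow> int \<Rightarrow> real \<times> real \<Rightarrow> (real \<times> real) set" where
  "dyadic_cell k l z = dyadic_interval k \<lfloor>fst z / 2 powi k\<rfloor> \<times> dyadic_interval l \<lfloor>snd z / 2 powi l\<rfloor>"

lemma dyadic_cell:
  "dyadic_cell k l z \<in> sets borel" "bounded (dyadic_cell k l z)" "convex (dyadic_cell k l z)"
  "measure lborel (dyadic_cell k l z) = 2 powi k * 2 powi l" "z \<in> dyadic_cell k l z"
proof -
  have m: "dyadic_interval k j \<in> sets borel" for k j by (simp add: dyadic_interval_def)
  have "dyadic_cell k l z \<in> sets (borel \<Otimes>\<^sub>M borel)" unfolding dyadic_cell_def by (intro pair_measureI m)
  then show "dyadic_cell k l z \<in> sets borel" unfolding borel_prod .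
  have "bounded {a..<b}" for a b :: real by (rule bounded_subset[OF bounded_closed_interval[of a b]]) auto
  then show "bounded (dyadic_cell k l z)" unfolding dyadic_cell_def dyadic_interval_def by (intro bounded_Times)
  show "convex (dyadic_cell k l z)" unfolding dyadic_cell_def dyadic_interval_def by (intro convex_Times convex_real_interval)
  have "measure lborel (dyadic_interval k j) = 2 powi k" for k j unfolding dyadic_interval_eq_ivl by simp
  then show "measure lborel (dyadic_cell k l z) = 2 powi k * 2 powi l" unfolding dyadic_cell_def by (simp add: measure_lborel_Times m)
  show "z \<in> dyadic_cell k l z" unfolding dyadic_cell_def using mem_dyadic_cell[of "fst z" k] mem_dyadic_cell[of "snd z" l] by (cases z) simp
qed

text \<open>Joins the two forms of the average: product weights, which telescope, and regions, to
  which the bounds for Bessel potentials apply.\<close>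

lemma rect_avg_eq_region_avg:
  assumes f: "f \<in> borel_measurable lebesgue" "f' \<in> borel_measurable borel" "AE z in lborel. f z = f' z"
  shows "rect_avg f k l z = region_avg (dyadic_cell k l z) f'"
proof -
  let ?R = "dyadic_cell k l z"
  have w: "cell_weight k (fst z) (fst w) * cell_weight l (snd z) (snd w) = indicator ?R w / (2 powi k * 2 powi l)" for w
    unfolding cell_weight_def dyadic_cell_def by (cases w) (auto simp: indicator_def)
  have "rect_avg f k l z = (LINT w|lebesgue. f w * of_real (indicator ?R w / (2 powi k * 2 powi l)))"
    unfolding rect_avg_def w ..
  also have "\<dots> = (LINT w|lborel. f' w * of_real (indicator ?R w / (2 powi k * 2 powi l)))"
  proof (intro lebesgue_integral_borel_representative f)
    have "(indicator ?R :: real \<times> real \<Rightarrow> real) \<in> borel_measurable borel" by (rule borel_measurable_indicator[OF dyadic_cell(1)])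
    then show "(\<lambda>w. complex_of_real (indicator ?R w / (2 powi k * 2 powi l))) \<in> borel_measurable borel" by measurable
  qed
  also have "\<dots> = (LINT w|lborel. f' w * of_real (indicator ?R w) / of_real (2 powi k * 2 powi l))" by simp
  also have "\<dots> = region_avg ?R f'" unfolding region_avg_def dyadic_cell(4) by (rule integral_divide_zero)
  finally show ?thesis .
qed

text \<open>Here \<open>3 * n\<close> counts the scales from \<open>2 powr (- n)\<close> to
  \<open>2 powr (2 * n)\<close>, and \<open>3 * 2 powr (- n)\<close> bounds the distance between
  points of a small box and of the dyadic square at its corner. B and N stand for the BMO and
  Sobolev norms, H for the Hoelder constant.\<close>

definition sup_bound :: "real \<Rightarrow> real \<Rightarrow> real \<Rightarrow> nat \<Rightarrow> real \<Rightarrow> real \<Rightarrow> real" where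
  "sup_bound p H \<eta> n B N = 2 * (real (3 * n))\<^sup>2 * B + 3 * (N * 2 powr (- (real n / p))) + H * (3 * 2 powr (- real n)) powr \<eta> * N"

context bessel_pair
begin

lemma AE_cmod_le:
  fixes n :: nat
  assumes F0: "F0 \<in> L2_loc" "AE z in lborel. F0 z = F z" and B: "bmo_grid_norm dyadic_grid dyadic_grid F0 \<le> ennreal B" "0 \<le> B"
    and \<eta>: "0 < \<eta>" "\<eta> < s - 2 / p" "\<eta> \<le> 1 - 1 / p"
  shows "AE z in lborel. cmod (F z) \<le> 2 * sup_bound p (holder_const \<eta>) \<eta> n B f.norm_p"
proof -
  define T where "T = sup_bound p (holder_const \<eta>) \<eta> n B f.norm_p"
  note T_def = T_def[unfolded sup_bound_def]
  have F0m: "F0 \<in> borel_measurable lebesgue" using F0(1) by (simp add: L2_loc_def)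
  have Fm: "F \<in> borel_measurable borel" by (rule F.F)
  note avg = rect_avg_eq_region_avg[OF F0m Fm F0(2)]
  have pw: "2 powi i = (2::real) powr (of_int i)" for i by (simp add: powr_real_of_int')
  have N: "f.norm_p \<ge> 0" by (rule f.norm_p_nonneg)
  \<comment> \<open>A cell has measure \<open>2 powr (k + l)\<close>: this is 2^n for the two long
    rectangles below and 2^(4n) for the large square.\<close>
  have le: "cmod (rect_avg F0 k l z) \<le> f.norm_p * 2 powr (- ((of_int k + of_int l) / p))" for k l z
  proof -
    have "cmod (rect_avg F0 k l z) \<le> f.norm_p * (2 powi k * 2 powi l) powr (- 1 / p)"
      unfolding avg using region_avg_le[OF dyadic_cell(1,2,3)[of k l z]] by (simp add: dyadic_cell(4))
    also have "(2 powi k * 2 powi l) powr (- 1 / p) = (2::real) powr (- ((of_int k + of_int l) / p))"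
      unfolding pw by (simp add: powr_add[symmetric] powr_powr)
    finally show ?thesis .
  qed
  have cell: "cmod (rect_avg F0 (- int n) (- int n) z) \<le> 2 * (real (3 * n))\<^sup>2 * B + 3 * (f.norm_p * 2 powr (- (real n / p)))" for z
  proof -
    let ?k = "- int n"
    have e: "?k + int (3 * n) = 2 * int n" by simp
    have "cmod (rect_avg F0 ?k ?k z) \<le> 2 * (real (3 * n))\<^sup>2 * B + cmod (rect_avg F0 (2 * int n) ?k z) + cmod (rect_avg F0 ?k (2 * int n) z) + cmod (rect_avg F0 (2 * int n) (2 * int n) z)"
      using rect_avg_telescope[OF F0(1) B, of ?k z "3 * n"] unfolding e .
    moreover have "cmod (rect_avg F0 (2 * int n) ?k z) \<le> f.norm_p * 2 powr (- (real n / p))"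
      "cmod (rect_avg F0 ?k (2 * int n) z) \<le> f.norm_p * 2 powr (- (real n / p))"
      using le[of "2 * int n" ?k z] le[of ?k "2 * int n" z] by simp_all
    moreover have "cmod (rect_avg F0 (2 * int n) (2 * int n) z) \<le> f.norm_p * 2 powr (- (real n / p))"
    proof -
      have "cmod (rect_avg F0 (2 * int n) (2 * int n) z) \<le> f.norm_p * 2 powr (- (4 * real n / p))"
        using le[of "2 * int n" "2 * int n" z] by simp
      also have "\<dots> \<le> f.norm_p * 2 powr (- (real n / p))"
        using p_pos by (intro mult_left_mono N powr_mono) (auto simp: divide_right_mono)
      finally show ?thesis .
    qed
    ultimately show ?thesis by linarith
  qed
  define r where "r = (2::real) powr (- real n)"
  have r: "r > 0" by (simp add: r_def)
  have rk: "2 powi (- int n) = r" unfolding pw r_def by simp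
  have hc: "0 \<le> holder_const \<eta>"
  proof -
    have "0 < s / 2 - (1 / p + \<eta> / 2)" using \<eta> by (simp add: field_simps)
    from Gamma_real_pos[OF this] Gamma_real_pos[OF s_pos] show ?thesis unfolding holder_const_def by simp
  qed
  have T0: "0 \<le> T" unfolding T_def using B N hc by (intro add_nonneg_nonneg mult_nonneg_nonneg) auto
  \<comment> \<open>The side r of the dyadic squares also limits the boxes, and the lower corner c
    of a box selects the square with which it is compared.\<close>
  have box: "cmod (LINT z|lborel. F z * of_real (indicator (cbox c d) z)) \<le> T * measure lborel (cbox c d)"
    if cd: "box c d \<noteq> {}" "dist c d < r" for c d
  proof -
    let ?K = "cbox c d"
    have m: "0 < measure lborel ?K" using cd(1) by (simp add: content_pos_lt_eq box_ne_empty)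
    let ?Q = "dyadic_cell (- int n) (- int n) c"
    have "cmod (region_avg ?K F - region_avg ?Q F) \<le> holder_const \<eta> * (3 * r) powr \<eta> * f.norm_p"
    proof (rule region_avg_holder[OF _ _ _ m dyadic_cell(1,2,3) _ _ \<eta>])
      show "0 < measure lborel ?Q" by (simp add: dyadic_cell(4))
      fix a b assume a: "a \<in> ?K" and b: "b \<in> ?Q"
      have "norm (a - c) \<le> norm (d - c)"
        using a by (intro norm_le_componentwise) (auto simp: mem_box inner_diff_left intro!: abs_leI)
      then have ac: "dist a c < r" using cd(2) by (simp add: dist_norm norm_minus_commute)
      have "\<bar>fst b - fst c\<bar> \<le> r" "\<bar>snd b - snd c\<bar> \<le> r"
        using b dyadic_cell(5)[of c "- int n" "- int n"] unfolding dyadic_cell_def dyadic_interval_eq_ivl rk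
        by (auto simp: mem_Times_iff abs_le_iff)
      moreover have "dist c b \<le> \<bar>fst b - fst c\<bar> + \<bar>snd b - snd c\<bar>"
        by (cases b, cases c) (simp add: dist_norm norm_Pair norm_minus_commute abs_minus_commute sqrt_sum_squares_le_sum_abs)
      ultimately have "dist c b \<le> 2 * r" by linarith
      \<comment> \<open>Less than r from a to the corner c, and at most r in each coordinate from c
        to b.\<close>
      then show "dist a b \<le> 3 * r" using ac dist_triangle[of a b c] by linarith
    qed auto
    moreover have "cmod (region_avg ?Q F) \<le> 2 * (real (3 * n))\<^sup>2 * B + 3 * (f.norm_p * 2 powr (- (real n / p)))"
      using cell[of c] unfolding avg .
    ultimately have "cmod (region_avg ?K F) \<le> T"
      using norm_triangle_sub[of "region_avg ?K F" "region_avg ?Q F"] unfolding T_def r_def by linarith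
    then have "cmod (LINT z|lborel. F z * of_real (indicator ?K z)) / measure lborel ?K \<le> T"
      unfolding region_avg_def using m by (simp add: norm_divide)
    then show ?thesis by (simp add: pos_divide_le_eq[OF m])
  qed
  have ir: "integrable lborel (\<lambda>z. F z * of_real (indicator (cbox a b) z))" for a b
    by (rule F.integrable_region) auto
  \<comment> \<open>The choices 1, -1, \<i> and -\<i> of c bound the real and imaginary parts with
    both signs. Adding the two parts gives the factor 2 in front of
    \<open>sup_bound\<close>.\<close>
  have part: "AE z in lborel. g z \<le> T" if g: "g = (\<lambda>z. Re (c * F z))" and c: "cmod c = 1" for g c
  proof (rule AE_le_of_small_boxes[OF _ _ r T0])
    show "g \<in> borel_measurable borel" unfolding g using Fm by measurable
    have gi: "(\<lambda>z. indicator (cbox a b) z *\<^sub>R g z) = (\<lambda>z. Re (c * (F z * of_real (indicator (cbox a b) z))))" for a b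
      unfolding g by (auto simp: indicator_def)
    show "set_integrable lborel (cbox a b) g" for a b
      unfolding set_integrable_def gi by (intro integrable_Re integrable_mult_right ir)
    show "(LINT z:cbox a b|lborel. g z) \<le> T * measure lborel (cbox a b)" if "box a b \<noteq> {}" "dist a b < r" for a b
    proof -
      have "(LINT z:cbox a b|lborel. g z) = Re (LINT z|lborel. c * (F z * of_real (indicator (cbox a b) z)))"
        unfolding set_lebesgue_integral_def gi by (intro integral_Re integrable_mult_right ir)
      also have "\<dots> \<le> cmod (LINT z|lborel. c * (F z * of_real (indicator (cbox a b) z)))" by (rule complex_Re_le_cmod)
      also have "\<dots> = cmod (LINT z|lborel. F z * of_real (indicator (cbox a b) z))" using c by (simp add: norm_mult)
      also have "\<dots> \<le> T * measure lborel (cbox a b)" by (rule box[OF that])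
      finally show ?thesis .
    qed
  qed
  from part[OF refl, of 1] part[OF refl, of "-1"] part[OF refl, of \<i>] part[OF refl, of "- \<i>"]
  have "AE z in lborel. Re (F z) \<le> T" "AE z in lborel. - Re (F z) \<le> T" "AE z in lborel. - Im (F z) \<le> T" "AE z in lborel. Im (F z) \<le> T"
    by simp_all
  then show ?thesis unfolding sup_bound_def T_def[symmetric]
  proof eventually_elim
    fix z assume "Re (F z) \<le> T" "- Re (F z) \<le> T" "- Im (F z) \<le> T" "Im (F z) \<le> T"
    then have "\<bar>Re (F z)\<bar> \<le> T" "\<bar>Im (F z)\<bar> \<le> T" by auto
    then show "cmod (F z) \<le> 2 * T" using cmod_le[of "F z"] by linarith
  qed
qed

end

lemma integral_cmod_powr_representative:
  fixes f f' :: "real \<times> real \<Rightarrow> complex"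
  assumes f: "f \<in> Lp_space p" and f': "f' \<in> borel_measurable borel" and ae: "AE z in lborel. f z = f' z"
  shows "integrable lborel (\<lambda>z. cmod (f' z) powr p)" "(LINT z|lborel. cmod (f' z) powr p) = (LINT z|lebesgue. cmod (f z) powr p)"
proof -
  have [measurable]: "f \<in> borel_measurable lebesgue" and int: "integrable lebesgue (\<lambda>z. cmod (f z) powr p)"
    using f by (auto simp: Lp_space_def)
  have f'm[measurable]: "f' \<in> borel_measurable lebesgue" using f' by (intro measurable_completion) simp
  have m: "(\<lambda>z. cmod (f' z) powr p) \<in> borel_measurable lborel" using f' by measurable
  have ae': "AE z in lebesgue. cmod (f z) powr p = cmod (f' z) powr p"
    using AE_completion[OF ae] by eventually_elim simp
  have "integrable lebesgue (\<lambda>z. cmod (f' z) powr p)"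
    by (rule integrable_cong_AE_imp[OF int _ ae']) measurable
  then show "integrable lborel (\<lambda>z. cmod (f' z) powr p)" using integrable_completion[OF m] by simp
  have "(LINT z|lebesgue. cmod (f z) powr p) = (LINT z|lebesgue. cmod (f' z) powr p)"
    by (rule integral_cong_AE[OF _ _ ae']) measurable
  then show "(LINT z|lborel. cmod (f' z) powr p) = (LINT z|lebesgue. cmod (f z) powr p)" using integral_completion[OF m] by simp
qed

lemma AE_cmod_le_Sobolev:
  assumes p: "2 < p" and s: "2 / p < s" and F: "F \<in> L2_loc" "F \<in> Sobolev s p"
    and B: "bmo_grid_norm dyadic_grid dyadic_grid F \<le> ennreal B" "0 \<le> B"
    and \<eta>: "0 < \<eta>" "\<eta> < s - 2 / p" "\<eta> \<le> 1 - 1 / p"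
  shows "AE z in lebesgue. cmod (F z) \<le> 2 * sup_bound p (bessel_pair.holder_const p s \<eta>) \<eta> n B (Sobolev_norm s p F)"
proof -
  \<comment> \<open>The very function selected in \<open>Sobolev_norm\<close>, so that its L^p norm
    is the one in the conclusion.\<close>
  define f where "f = (SOME f. f \<in> Lp_space p \<and> has_bessel_derivative s F f)"
  have f: "f \<in> Lp_space p" "has_bessel_derivative s F f"
    using someI_ex[of "\<lambda>f. f \<in> Lp_space p \<and> has_bessel_derivative s F f"] F(2) unfolding f_def Sobolev_def by auto
  have FL: "F \<in> Lp_space p" using F(2) by (simp add: Sobolev_def)
  have Fm: "F \<in> borel_measurable lebesgue" "f \<in> borel_measurable lebesgue" using FL f by (auto simp: Lp_space_def)
  obtain F' where F': "F' \<in> borel_measurable borel" "AE z in lborel. F z = F' z"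
    using completion_ex_borel_measurable_complex[OF Fm(1)] by auto
  obtain f' where f': "f' \<in> borel_measurable borel" "AE z in lborel. f z = f' z"
    using completion_ex_borel_measurable_complex[OF Fm(2)] by auto
  have s0: "0 < s" using p s by (intro less_trans[OF _ s]) simp
  interpret bessel_pair p s F' f'
  proof
    show "2 < p" "2 / p < s" by fact+
    show "F' \<in> borel_measurable borel" "f' \<in> borel_measurable borel" by fact+
    show "integrable lborel (\<lambda>z. cmod (F' z) powr p)" by (rule integral_cmod_powr_representative(1)[OF FL F'])
    show "integrable lborel (\<lambda>z. cmod (f' z) powr p)" by (rule integral_cmod_powr_representative(1)[OF f(1) f'])
    fix v :: real and a assume v: "0 < v"
    have [measurable]: "bessel_kernel (s / 2) v a \<in> borel_measurable borel" using s0 by (intro borel_measurable_bessel_kernel) simp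
    have "(LINT z|lborel. f' z * of_real (bessel_kernel (s / 2) v a z)) = (LINT z|lebesgue. f z * of_real (bessel_kernel (s / 2) v a z))"
      by (rule lebesgue_integral_borel_representative[symmetric, OF Fm(2) f']) measurable
    also have "\<dots> = (LINT z|lebesgue. F z * of_real (gauss v a z))" by (rule integral_bessel_derivative_gauss[OF s0 v f(2)])
    also have "\<dots> = (LINT z|lborel. F' z * of_real (gauss v a z))"
      by (rule lebesgue_integral_borel_representative[OF Fm(1) F']) measurable
    finally show "(LINT z|lborel. f' z * of_real (bessel_kernel (s / 2) v a z)) = (LINT z|lborel. F' z * of_real (gauss v a z))" .
  qed
  have N: "f.norm_p = Sobolev_norm s p F"
    unfolding f.norm_p_def Sobolev_norm_def f_def[symmetric] Lp_norm_def integral_cmod_powr_representative(2)[OF f(1) f'] ..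
  have "AE z in lborel. cmod (F' z) \<le> 2 * sup_bound p (holder_const \<eta>) \<eta> n B (Sobolev_norm s p F)"
    using AE_cmod_le[OF F(1) F'(2) B \<eta>, of n] unfolding N .
  then have "AE z in lborel. cmod (F z) \<le> 2 * sup_bound p (holder_const \<eta>) \<eta> n B (Sobolev_norm s p F)"
    using F'(2) by eventually_elim simp
  then show ?thesis by (rule AE_completion)
qed

section \<open>The scale for a given \<epsilon> and the final constant\<close>

text \<open>The least n with \<open>2 powr (- n) \<le> \<epsilon>\<close> is at most
  \<open>2 * (1 + ln (1 / \<epsilon>))\<close>. Of the two logarithmic factors in its square, one is
  given away to \<open>1 / \<epsilon>\<close> by \<open>ln x \<le> x - 1\<close>.\<close>

lemma choice_of_scale:
  assumes \<epsilon>: "0 < \<epsilon>" "\<epsilon> < (1 :: real)"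
  shows "\<exists>n. 2 powr (- real n) \<le> \<epsilon> \<and> (real n)\<^sup>2 \<le> 4 * (1 / \<epsilon>) * (1 + ln (1 / \<epsilon>))"
proof -
  define n where "n = nat \<lceil>log 2 (1 / \<epsilon>)\<rceil>"
  define l where "l = ln (1 / \<epsilon>)"
  have l: "l > 0" unfolding l_def using \<epsilon> by (intro ln_gt_zero) simp
  have lg: "log 2 (1 / \<epsilon>) = l / ln 2" by (simp add: log_def l_def)
  have "log 2 (1 / \<epsilon>) \<le> real n" unfolding n_def by linarith
  then have "2 powr (- real n) \<le> 2 powr (- log 2 (1 / \<epsilon>))" by simp
  also have "\<dots> = \<epsilon>" using \<epsilon> by (simp add: powr_minus powr_log_cancel)
  finally have 1: "2 powr (- real n) \<le> \<epsilon>" .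
  have "1 / 2 \<le> ln (2 :: real)" using ln_le_minus_one[of "1 / 2 :: real"] by (simp add: ln_div)
  then have "l / ln 2 \<le> l / (1 / 2)" using l by (intro divide_left_mono) auto
  moreover have "real n \<le> l / ln 2 + 1"
  proof -
    have "0 \<le> log 2 (1 / \<epsilon>)" unfolding lg using l by simp
    then show ?thesis unfolding n_def lg[symmetric] by linarith
  qed
  ultimately have "real n \<le> 2 * (1 + l)" using l by simp
  then have "(real n)\<^sup>2 \<le> (2 * (1 + l))\<^sup>2" by (intro power_mono) auto
  also have "\<dots> = 4 * ((1 + l) * (1 + l))" by (simp add: power2_eq_square algebra_simps)
  also have "\<dots> \<le> 4 * (1 / \<epsilon> * (1 + l))"
  proof -
    have "1 + l \<le> 1 / \<epsilon>" unfolding l_def using ln_le_minus_one[of "1 / \<epsilon>"] \<epsilon> by simp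
    then show ?thesis using l by (intro mult_left_mono mult_right_mono) auto
  qed
  finally show ?thesis using 1 unfolding l_def by auto
qed

theorem theorem1p3:
  fixes \<delta>0 \<theta> p s \<delta> :: real
  assumes "0 < \<delta>0" and "\<delta>0 < 1 / 2"
    and "2 < p" and "s > 2 / p"
    and "\<delta> = min (s - 2 / p) (1 / p)"
  shows "\<delta> > 0 \<and>
    (\<forall>\<gamma>\<in>{0<..<\<delta>}. \<exists>C>0. \<forall>\<epsilon>\<in>{0<..<1}. \<forall>F \<in> BMO \<delta>0 \<inter> Sobolev s p.
       bmo_norm \<delta>0 (F \<circ> rotation \<theta>)
         \<le> ennreal (C * (1 / \<epsilon>) * (1 + ln (1 / \<epsilon>))) * bmo_norm \<delta>0 F
           + ennreal (C * \<epsilon> powr (\<gamma> / 2) * Sobolev_norm s p F))"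
proof -
  have \<delta>: "\<delta> > 0" "\<delta> \<le> s - 2 / p" "\<delta> \<le> 1 / p" using assms(3-5) by auto
  \<comment> \<open>Every \<gamma> < \<delta> satisfies \<gamma>/2 \<le> \<eta>, and halving
    \<delta> makes \<eta> strictly smaller than s - 2/p, as the Hoelder estimate requires. Neither
    \<eta> nor C depends on \<gamma>.\<close>
  define \<eta> where "\<eta> = \<delta> / 2"
  have p2: "1 / p < 1 / 2" using assms(3) by (simp add: field_simps)
  have \<eta>: "0 < \<eta>" "\<eta> < s - 2 / p" "\<eta> \<le> 1 - 1 / p" "\<eta> \<le> 1 / p"
    using \<delta> p2 unfolding \<eta>_def by linarith+
  \<comment> \<open>The absolute value makes C positive here, where no F and f are at hand to
    instantiate the locale.\<close>
  define H where "H = \<bar>bessel_pair.holder_const p s \<eta>\<bar>"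
  \<comment> \<open>144 is 36 times 4: doubling \<open>sup_bound\<close> gives
    \<open>36 * n^2 * B\<close>, and \<open>choice_of_scale\<close> contributes the 4. It also
    covers the coefficient 6 of the three large averages.\<close>
  define C where "C = 144 + 2 * H * 3 powr \<eta>"
  have C: "C > 0" unfolding C_def H_def by (intro add_pos_nonneg) auto
  have main: "bmo_norm \<delta>0 (F \<circ> rotation \<theta>) \<le> ennreal (C * (1 / \<epsilon>) * (1 + ln (1 / \<epsilon>))) * bmo_norm \<delta>0 F + ennreal (C * \<epsilon> powr (\<gamma> / 2) * Sobolev_norm s p F)"
    if \<gamma>: "0 < \<gamma>" "\<gamma> < \<delta>" and \<epsilon>: "0 < \<epsilon>" "\<epsilon> < 1" and F: "F \<in> BMO \<delta>0" "F \<in> Sobolev s p" for \<gamma> \<epsilon> F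
  proof -
    define B where "B = enn2real (bmo_norm \<delta>0 F)"
    have Bfin: "bmo_norm \<delta>0 F < \<infinity>" and F2: "F \<in> L2_loc" using F by (auto simp: BMO_def)
    have B: "bmo_norm \<delta>0 F = ennreal B" "0 \<le> B" using Bfin by (auto simp: B_def)
    have "bmo_grid_norm dyadic_grid dyadic_grid F \<le> bmo_norm \<delta>0 F"
      unfolding bmo_norm_def by (rule SUP_upper2[of "(dyadic_grid, dyadic_grid)"]) auto
    then have Bg: "bmo_grid_norm dyadic_grid dyadic_grid F \<le> ennreal B" by (simp add: B)
    define N where "N = Sobolev_norm s p F"
    have N: "N \<ge> 0" by (simp add: N_def Sobolev_norm_def Lp_norm_def)
    obtain n where n: "2 powr (- real n) \<le> \<epsilon>" "(real n)\<^sup>2 \<le> 4 * (1 / \<epsilon>) * (1 + ln (1 / \<epsilon>))"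
      using choice_of_scale[OF \<epsilon>] by blast
    define E where "E = \<epsilon> powr (\<gamma> / 2)"
    \<comment> \<open>To be applied with x = 1/p and x = \<eta>, both at least \<gamma>/2; as
      \<epsilon> < 1, its powers decrease in the exponent.\<close>
    have pw: "(2 powr (- real n)) powr x \<le> E" if "\<gamma> / 2 \<le> x" for x
    proof -
      have "(2 powr (- real n)) powr x \<le> \<epsilon> powr x" using n that \<gamma> by (intro powr_mono2) auto
      also have "\<dots> \<le> E" unfolding E_def using \<epsilon> that by (intro powr_mono') auto
      finally show ?thesis .
    qed
    have e1: "2 powr (- (real n / p)) \<le> E"
      using pw[of "1 / p"] \<gamma> \<delta> by (simp add: powr_powr)
    have e2: "(3 * 2 powr (- real n)) powr \<eta> \<le> 3 powr \<eta> * E"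
      using pw[of \<eta>] \<gamma> by (simp add: powr_mult \<eta>_def)
    let ?T = "C * (1 / \<epsilon>) * (1 + ln (1 / \<epsilon>)) * B + C * E * N"
    have ln0: "0 \<le> ln (1 / \<epsilon>)" using \<epsilon> by simp
    have E0: "0 \<le> E" by (simp add: E_def)
    have H0: "0 \<le> H" by (simp add: H_def)
    have le: "2 * sup_bound p (bessel_pair.holder_const p s \<eta>) \<eta> n B N \<le> ?T"
    proof -
      have 1: "36 * ((real n)\<^sup>2 * B) \<le> 144 * ((1 / \<epsilon>) * (1 + ln (1 / \<epsilon>)) * B)"
      proof -
        have "(real n)\<^sup>2 * B \<le> 4 * ((1 / \<epsilon>) * (1 + ln (1 / \<epsilon>)) * B)"
          using mult_right_mono[OF n(2) B(2)] by (simp only: mult.assoc)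
        then show ?thesis by linarith
      qed
      have 2: "6 * (N * 2 powr (- (real n / p))) \<le> 6 * (N * E)" by (intro mult_left_mono e1 N) auto
      have "bessel_pair.holder_const p s \<eta> * (3 * 2 powr (- real n)) powr \<eta> * N \<le> H * (3 powr \<eta> * E) * N"
        by (intro mult_right_mono mult_mono e2 N) (auto simp: H_def)
      then have 3: "2 * (bessel_pair.holder_const p s \<eta> * (3 * 2 powr (- real n)) powr \<eta> * N) \<le> (2 * H * 3 powr \<eta>) * (E * N)" by simp
      have 4: "144 * ((1 / \<epsilon>) * (1 + ln (1 / \<epsilon>)) * B) \<le> C * ((1 / \<epsilon>) * (1 + ln (1 / \<epsilon>)) * B)"
        using \<epsilon> ln0 B(2) H0 unfolding C_def by (intro mult_right_mono mult_nonneg_nonneg) auto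
      have 5: "6 * (N * E) + (2 * H * 3 powr \<eta>) * (E * N) \<le> C * (E * N)"
        using E0 N unfolding C_def by (simp add: algebra_simps)
      have "2 * sup_bound p (bessel_pair.holder_const p s \<eta>) \<eta> n B N
        = 36 * ((real n)\<^sup>2 * B) + 6 * (N * 2 powr (- (real n / p))) + 2 * (bessel_pair.holder_const p s \<eta> * (3 * 2 powr (- real n)) powr \<eta> * N)"
        by (simp add: sup_bound_def power_mult_distrib algebra_simps)
      also have "\<dots> \<le> C * ((1 / \<epsilon>) * (1 + ln (1 / \<epsilon>)) * B) + C * (E * N)"
        using 1 2 3 4 5 by linarith
      finally show ?thesis by (simp only: mult.assoc)
    qed
    have "AE z in lebesgue. cmod (F z) \<le> ?T"
      using AE_cmod_le_Sobolev[OF assms(3,4) F2 F(2) Bg B(2) \<eta>(1,2,3), of n]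
      by eventually_elim (rule order_trans[OF _ le[unfolded N_def, folded N_def]], simp add: N_def)
    moreover have "F \<in> borel_measurable lebesgue" using F2 by (simp add: L2_loc_def)
    moreover have T0: "0 \<le> C * (1 / \<epsilon>) * (1 + ln (1 / \<epsilon>)) * B" "0 \<le> C * E * N"
      using C \<epsilon> ln0 B(2) E0 N by (auto intro!: mult_nonneg_nonneg)
    ultimately have "bmo_norm \<delta>0 (F \<circ> rotation \<theta>) \<le> ennreal ?T"
      by (intro bmo_norm_le rotation_measurable_bounded add_nonneg_nonneg)
    also have "\<dots> = ennreal (C * (1 / \<epsilon>) * (1 + ln (1 / \<epsilon>)) * B) + ennreal (C * E * N)"
      by (rule ennreal_plus[OF T0])
    also have "ennreal (C * (1 / \<epsilon>) * (1 + ln (1 / \<epsilon>)) * B) = ennreal (C * (1 / \<epsilon>) * (1 + ln (1 / \<epsilon>))) * bmo_norm \<delta>0 F"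
      unfolding B(1) using C \<epsilon> ln0 B(2) by (intro ennreal_mult) (auto intro!: mult_nonneg_nonneg)
    finally show ?thesis unfolding E_def N_def .
  qed
  show ?thesis
  proof (intro conjI ballI)
    show "\<delta> > 0" by (rule \<delta>)
    fix \<gamma> assume "\<gamma> \<in> {0<..<\<delta>}"
    then show "\<exists>C>0. \<forall>\<epsilon>\<in>{0<..<1}. \<forall>F \<in> BMO \<delta>0 \<inter> Sobolev s p.
       bmo_norm \<delta>0 (F \<circ> rotation \<theta>)
         \<le> ennreal (C * (1 / \<epsilon>) * (1 + ln (1 / \<epsilon>))) * bmo_norm \<delta>0 F
           + ennreal (C * \<epsilon> powr (\<gamma> / 2) * Sobolev_norm s p F)"
      using C by (intro exI[of _ C] conjI ballI main) auto
  qed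
qed

end
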